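(* If $\Gamma$ is generalised max-closed, then W-Max Sol$(\Gamma)$ is in PO.
   Context: W-Max Sol$(\Gamma)$: instances are $(V,D,C,w)$ where $D\subset\mathbb{N}$ is finite, $(V,D,C)$ is a constraint satisfaction instance using relations from the constraint language $\Gamma$, and $w:V\to\mathbb{N}$; a solution is an assignment $f:V\to D$ satisfying all constraints, with measure $\sum_{v} w(v)f(v)$ to be maximised. A constraint language $\Gamma$ over $D\subset\mathbb{N}$ is generalised max-closed if there is a binary operation $f$ that is a polymorphism of $\Gamma$ (every relation of $\Gamma$ is closed under $f$ applied coordinatewise) such that for all $a,b\in D$: (1) if $a\neq b$ and $f(a,b)\le\min(a,b)$ then $f(b,a)>\max(a,b)$; and (2) $f(a,a)\ge a$. PO is the class of optimisation problems solvable to optimality in polynomial time. *)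

theory Defs
  imports Complex_Main "HOL-Library.FuncSet" "HOL-Computational_Algebra.Polynomial"
begin

section \<open>Deterministic multi-tape Turing machines\<close>

text \<open>
  Tape symbols are natural numbers, 0 being the blank. A tape is infinite in both directions; in
  \<open>(l, r)\<close> the list \<open>l\<close> holds the cells to the left of the head (nearest first) and \<open>r\<close> the scanned
  cell followed by the cells to its right. All cells not listed are blank.
\<close>

type_synonym tape = "nat list \<times> nat list"

datatype dir = MoveLeft | MoveRight | Stay

fun scanned :: "tape \<Rightarrow> nat" where
  "scanned (l, []) = 0"
| "scanned (l, a # r) = a"

fun tape_act :: "nat \<times> dir \<Rightarrow> tape \<Rightarrow> tape" where
  "tape_act (a, Stay) (l, r) = (l, a # tl r)"
| "tape_act (a, MoveRight) (l, r) = (a # l, tl r)"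
| "tape_act (a, MoveLeft) ([], r) = ([], 0 # a # tl r)"
| "tape_act (a, MoveLeft) (b # l, r) = (l, b # a # tl r)"

text \<open>
  The working states are \<open>0, \<dots>, states - 1\<close>, with \<open>0\<close> initial; the number \<open>states\<close> itself is the
  halting state. The alphabet is \<open>{..<symbols}\<close>. Input words are over \<open>{1..5}\<close>.
\<close>

record tm =
  tapes :: nat
  states :: nat
  symbols :: nat
  delta :: "nat \<Rightarrow> nat list \<Rightarrow> nat \<times> (nat \<times> dir) list"

definition wf_tm :: "tm \<Rightarrow> bool" where
  "wf_tm M \<longleftrightarrow> tapes M \<ge> 1 \<and> symbols M \<ge> 6 \<and>
     (\<forall>q < states M. \<forall>as. length as = tapes M \<and> set as \<subseteq> {..<symbols M} \<longrightarrow>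
        (case delta M q as of (q', acts) \<Rightarrow>
           q' \<le> states M \<and> length acts = tapes M \<and> (\<forall>(a, d) \<in> set acts. a < symbols M)))"

type_synonym config = "nat \<times> tape list"

definition tm_init :: "tm \<Rightarrow> nat list \<Rightarrow> config" where
  "tm_init M x = (0, ([], x) # replicate (tapes M - 1) ([], []))"

fun tm_step :: "tm \<Rightarrow> config \<Rightarrow> config" where
  "tm_step M (q, ts) =
     (if q < states M
      then (case delta M q (map scanned ts) of (q', acts) \<Rightarrow> (q', map2 tape_act acts ts))
      else (q, ts))"

text \<open>The output is read on the last tape, from the head up to the first blank.\<close>

definition tm_outputs_within :: "tm \<Rightarrow> nat list \<Rightarrow> nat \<Rightarrow> nat list \<Rightarrow> bool" where
  "tm_outputs_within M x n y \<longleftrightarrow>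
     (\<exists>t \<le> n. \<exists>ts. (tm_step M ^^ t) (tm_init M x) = (states M, ts) \<and>
        y = takeWhile (\<lambda>a. a \<noteq> 0) (snd (last ts)))"

section \<open>Optimisation problems and PO\<close>

datatype goal = Maximise | Minimise

text \<open>
  Instances and solutions are abstract objects; \<open>enc_inst\<close> and \<open>enc_sol\<close> give the set of words that
  represent them (a finite set, for example, is represented by any listing of its elements). The
  empty word is reserved for reporting that an instance has no feasible solution and should not
  represent a solution.
\<close>

record ('i, 's) opt_problem =
  instances :: "'i set"
  solutions :: "'i \<Rightarrow> 's set"
  msr :: "'i \<Rightarrow> 's \<Rightarrow> nat"
  goal_of :: goal
  enc_inst :: "'i \<Rightarrow> nat list set"
  enc_sol :: "'i \<Rightarrow> 's \<Rightarrow> nat list set"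

definition optimal :: "('i, 's) opt_problem \<Rightarrow> 'i \<Rightarrow> 's \<Rightarrow> bool" where
  "optimal P I s \<longleftrightarrow> s \<in> solutions P I \<and>
     (\<forall>s' \<in> solutions P I.
        case goal_of P of Maximise \<Rightarrow> msr P I s' \<le> msr P I s
                        | Minimise \<Rightarrow> msr P I s \<le> msr P I s')"

definition PO :: "('i, 's) opt_problem set" where
  "PO = {P. \<exists>M (p :: nat poly). wf_tm M \<and>
     (\<forall>I \<in> instances P. \<forall>x \<in> enc_inst P I. \<exists>y.
        tm_outputs_within M x (poly p (length x)) y \<and>
        (if solutions P I = {} then y = []
         else \<exists>s. optimal P I s \<and> y \<in> enc_sol P I s))}"

section \<open>Encodings\<close>

text \<open>
  Symbols 1 and 2 are the binary digits 0 and 1, symbol 3 ends a number, and 4 and 5 are the opening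
  and closing brackets of a list. Numbers are written in binary, least significant digit first,
  without superfluous zeros. All these codes are self-delimiting.
\<close>

fun binary :: "nat \<Rightarrow> nat list" where
  "binary n = (if n = 0 then [] else (1 + n mod 2) # binary (n div 2))"

declare binary.simps [simp del]

definition enc_nat :: "nat \<Rightarrow> nat list" where
  "enc_nat n = binary n @ [3]"

definition enc_list :: "('a \<Rightarrow> nat list) \<Rightarrow> 'a list \<Rightarrow> nat list" where
  "enc_list e xs = [4] @ concat (map e xs) @ [5]"

definition enc_fun_on :: "nat set \<Rightarrow> (nat \<Rightarrow> nat) \<Rightarrow> nat list set" where
  "enc_fun_on A g = {enc_list (\<lambda>a. enc_nat a @ enc_nat (g a)) as |as. distinct as \<and> set as = A}"

section \<open>Weighted maximum solution over a constraint language\<close>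

text \<open>Tuples are lists. Only the empty relation fails to determine its arity.\<close>

definition relation_over :: "nat set \<Rightarrow> nat \<Rightarrow> nat list set \<Rightarrow> bool" where
  "relation_over D n R \<longleftrightarrow> (\<forall>t \<in> R. length t = n \<and> set t \<subseteq> D)"

definition constraint_language :: "nat set \<Rightarrow> nat list set set \<Rightarrow> bool" where
  "constraint_language D \<Gamma> \<longleftrightarrow> (\<forall>R \<in> \<Gamma>. \<exists>n. relation_over D n R)"

definition polymorphism :: "nat set \<Rightarrow> nat list set set \<Rightarrow> (nat \<Rightarrow> nat \<Rightarrow> nat) \<Rightarrow> bool" where
  "polymorphism D \<Gamma> f \<longleftrightarrow>
     (\<forall>a \<in> D. \<forall>b \<in> D. f a b \<in> D) \<and>
     (\<forall>R \<in> \<Gamma>. \<forall>s \<in> R. \<forall>t \<in> R. map2 f s t \<in> R)"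

definition generalised_max_closed :: "nat set \<Rightarrow> nat list set set \<Rightarrow> bool" where
  "generalised_max_closed D \<Gamma> \<longleftrightarrow>
     (\<exists>f. polymorphism D \<Gamma> f \<and>
        (\<forall>a \<in> D. \<forall>b \<in> D.
           (a \<noteq> b \<and> f a b \<le> min a b \<longrightarrow> f b a > max a b) \<and>
           f a a \<ge> a))"

text \<open>A constraint is a pair of a scope (a list of variables, repetitions allowed) and a relation.\<close>

type_synonym cnstr = "nat list \<times> nat list set"

record wcsp =
  vars :: "nat set"
  dom_of :: "nat set"
  cnstrs :: "cnstr set"
  weight :: "nat \<Rightarrow> nat"

definition wms_instances :: "nat set \<Rightarrow> nat list set set \<Rightarrow> wcsp set" where
  "wms_instances D \<Gamma> = {I. finite (vars I) \<and> dom_of I = D \<and> finite (cnstrs I) \<and>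
     (\<forall>(s, R) \<in> cnstrs I. set s \<subseteq> vars I \<and> R \<in> \<Gamma> \<and> relation_over D (length s) R)}"

definition wms_solutions :: "wcsp \<Rightarrow> (nat \<Rightarrow> nat) set" where
  "wms_solutions I = {g \<in> vars I \<rightarrow>\<^sub>E dom_of I. \<forall>(s, R) \<in> cnstrs I. map g s \<in> R}"

definition wms_measure :: "wcsp \<Rightarrow> (nat \<Rightarrow> nat) \<Rightarrow> nat" where
  "wms_measure I g = (\<Sum>v \<in> vars I. weight I v * g v)"

text \<open>
  An instance is written as its variables, its domain, its constraints and the graph of its weight
  function. A constraint relation is given by listing its tuples, so that no finiteness of the
  constraint language is needed; for a finite language these lists have bounded length.
\<close>

definition lists_relation :: "nat list \<times> nat list list \<Rightarrow> cnstr \<Rightarrow> bool" where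
  "lists_relation c k \<longleftrightarrow> fst c = fst k \<and> distinct (snd c) \<and> set (snd c) = snd k"

definition enc_cnstr :: "nat list \<times> nat list list \<Rightarrow> nat list" where
  "enc_cnstr c = enc_list enc_nat (fst c) @ enc_list (enc_list enc_nat) (snd c)"

definition wms_enc_inst :: "wcsp \<Rightarrow> nat list set" where
  "wms_enc_inst I =
     {enc_list enc_nat vs @ enc_list enc_nat ds @ enc_list enc_cnstr cs @ ws |vs ds cs ks ws.
        distinct vs \<and> set vs = vars I \<and>
        distinct ds \<and> set ds = dom_of I \<and>
        distinct ks \<and> set ks = cnstrs I \<and> list_all2 lists_relation cs ks \<and>
        ws \<in> enc_fun_on (vars I) (weight I)}"

definition w_max_sol :: "nat set \<Rightarrow> nat list set set \<Rightarrow> (wcsp, nat \<Rightarrow> nat) opt_problem" where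
  "w_max_sol D \<Gamma> =
     \<lparr>instances = wms_instances D \<Gamma>,
      solutions = wms_solutions,
      msr = wms_measure,
      goal_of = Maximise,
      enc_inst = wms_enc_inst,
      enc_sol = (\<lambda>I g. enc_fun_on (vars I) g)\<rparr>"

end

theory Submission
  imports Defs
begin

text \<open>
  Arc consistency keeps, for every variable, a set of values closed under the polymorphism. If
  every constraint still has a live tuple at the fixpoint, the live tuples of a constraint are
  closed under the polymorphism as well, and closure under a generalised max operation forces the
  tuple of coordinatewise maxima to be among them; by arc consistency these maxima are the maxima
  of the value sets of the variables. So giving every variable its largest live value is a
  solution, and it dominates all solutions pointwise because no solution is ever pruned. The
  weights play no role.

  Nested lists of numbers have exactly the codes that instances have. A function on them built from
  conditionals, equality tests, list operations and folds is computable in polynomial time as long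
  as every step of a fold enlarges its accumulator only by a term independent of the accumulator.
  On a machine this is a structured program on stacks, a stack being a tape with its top under
  the head.
\<close>

section \<open>A structured language of stack machines\<close>

text \<open>Arc consistency by itself only says that the maximum of each variable occurs in some
  live tuple, and different maxima may occur in different tuples. The true maximum as polymorphism
  would merge these tuples at once. A generalised operation may miss the maximum; all it grants is
  that for distinct arguments it drops to the minimum or below in at most one order, and then
  exceeds the maximum in the other order. An extremal choice of two tuples turns this into the
  existence of a greatest tuple.

  The program never evaluates the operation: it filters lists and tests values for equality, so one
  machine serves all generalised max-closed languages over \<open>D\<close>.

  On the machine side \<open>PO\<close> speaks of concrete transition functions and of time in the
  length of the input word. Costs are therefore proved once per combinator, as polynomials in the
  size of the values that a function may read.\<close>

datatype com =
    Push nat "(nat \<Rightarrow> nat) \<Rightarrow> nat"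
  | Write nat nat
  | Pop nat
  | Seq com com
  | Cond "(nat \<Rightarrow> nat) \<Rightarrow> bool" com com
  | While "(nat \<Rightarrow> nat) \<Rightarrow> bool" com

type_synonym store = "nat \<Rightarrow> nat list"

definition tops :: "store \<Rightarrow> nat \<Rightarrow> nat" where
  "tops s i = (case s i of [] \<Rightarrow> 0 | a # _ \<Rightarrow> a)"

text \<open>The time is the exact number of steps of the machine built below. \<open>Write\<close> has no rule: it
  only occurs as the second half of a \<open>Push\<close>.\<close>

inductive exec :: "com \<Rightarrow> store \<Rightarrow> nat \<Rightarrow> store \<Rightarrow> bool" where
  exec_Push: "g (tops s) \<in> {1..5} \<Longrightarrow> exec (Push i g) s 2 (s(i := g (tops s) # s i))"
| exec_Pop: "exec (Pop i) s 1 (s(i := tl (s i)))"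
| exec_Seq: "exec c s t s' \<Longrightarrow> exec d s' u s'' \<Longrightarrow> exec (Seq c d) s (Suc (t + u)) s''"
| exec_CondT: "b (tops s) \<Longrightarrow> exec c s t s' \<Longrightarrow> exec (Cond b c d) s (Suc t) s'"
| exec_CondF: "\<not> b (tops s) \<Longrightarrow> exec d s t s' \<Longrightarrow> exec (Cond b c d) s (Suc t) s'"
| exec_WhileF: "\<not> b (tops s) \<Longrightarrow> exec (While b c) s 1 s"
| exec_WhileT: "b (tops s) \<Longrightarrow> exec c s t s' \<Longrightarrow> exec (While b c) s' u s'' \<Longrightarrow>
    exec (While b c) s (Suc (t + u)) s''"

fun wf_com :: "nat \<Rightarrow> com \<Rightarrow> bool" where
  "wf_com K (Push i g) \<longleftrightarrow> i < K"
| "wf_com K (Write i a) \<longleftrightarrow> i < K \<and> a < 6"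
| "wf_com K (Pop i) \<longleftrightarrow> i < K"
| "wf_com K (Seq c d) \<longleftrightarrow> wf_com K c \<and> wf_com K d"
| "wf_com K (Cond b c d) \<longleftrightarrow> wf_com K c \<and> wf_com K d"
| "wf_com K (While b c) \<longleftrightarrow> wf_com K c"

lemma wf_com_mono: "wf_com K c \<Longrightarrow> K \<le> L \<Longrightarrow> wf_com L c"
  by (induction c) auto

lemma exec_length: "exec c s t s' \<Longrightarrow> length (s' i) \<le> length (s i) + t"
  by (induction rule: exec.induct) auto

section \<open>Compilation to Turing machines\<close>

definition idle :: "(nat \<Rightarrow> nat) \<Rightarrow> nat \<Rightarrow> nat \<times> dir" where
  "idle h i = (h i, Stay)"

text \<open>A transition writes before it moves, so a push takes two steps: move left, then write.
  The symbol is computed from the old tops and survives in the state, as the argument of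
  \<open>Write\<close>; clamping leaves five such states and so keeps \<open>conts\<close>
  finite.\<close>

definition clamp :: "nat \<Rightarrow> nat" where
  "clamp a = (if a \<in> {1..5} then a else 1)"

text \<open>The states of the machine are the stacks of commands that remain to be executed.\<close>

fun next_state :: "(nat \<Rightarrow> nat) \<Rightarrow> com list \<Rightarrow> com list \<times> (nat \<Rightarrow> nat \<times> dir)" where
  "next_state h [] = ([], idle h)"
| "next_state h (Push i g # k) = (Write i (clamp (g h)) # k, (idle h)(i := (h i, MoveLeft)))"
| "next_state h (Write i a # k) = (k, (idle h)(i := (a, Stay)))"
| "next_state h (Pop i # k) = (k, (idle h)(i := (0, MoveRight)))"
| "next_state h (Seq c d # k) = (c # d # k, idle h)"
| "next_state h (Cond b c d # k) = ((if b h then c else d) # k, idle h)"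
| "next_state h (While b c # k) = (if b h then c # While b c # k else k, idle h)"

text \<open>The continuations met while \<open>c\<close> is executed in front of \<open>k\<close>.
  The body of a loop is continued by the loop itself, so going round any number of times adds no new
  continuation.\<close>

fun conts :: "com \<Rightarrow> com list \<Rightarrow> com list set" where
  "conts (Push i g) k = insert (Push i g # k) ((\<lambda>a. Write i a # k) ` {1..5})"
| "conts (Write i a) k = {Write i a # k}"
| "conts (Pop i) k = {Pop i # k}"
| "conts (Seq c d) k = insert (Seq c d # k) (conts c (d # k) \<union> conts d k)"
| "conts (Cond b c d) k = insert (Cond b c d # k) (conts c k \<union> conts d k)"
| "conts (While b c) k = insert (While b c # k) (conts c (While b c # k))"

lemma finite_conts: "finite (conts c k)"
  by (induction c arbitrary: k) auto

lemma conts_self: "c # k \<in> conts c k"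
  by (cases c) auto

text \<open>The only way out of \<open>conts c k\<close> is to \<open>k\<close>, the continuation
  that is left when \<open>c\<close> has finished. For \<open>k = []\<close> this exit is the
  halting state.\<close>

lemma conts_closed: "k' \<in> conts c k \<Longrightarrow> fst (next_state h k') \<in> insert k (conts c k)"
proof (induction c arbitrary: k k')
  case (Push i g)
  then show ?case by (auto simp: clamp_def)
next
  case (Seq c d)
  then show ?case
    using conts_self[of c "d # k"] conts_self[of d k] Seq.IH(1)[of k' "d # k"] Seq.IH(2)[of k' k]
    by (cases "fst (next_state h k') = d # k") auto
next
  case (Cond b c d)
  then show ?case
    using conts_self[of c k] conts_self[of d k] Cond.IH(1)[of k' k] Cond.IH(2)[of k' k] by auto
next
  case (While b c)
  then show ?case
    using conts_self[of c "While b c # k"] While.IH[of k' "While b c # k"]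
    by (cases "b h") auto
qed auto

lemma conts_wf: "k' \<in> conts c k \<Longrightarrow> wf_com K c \<Longrightarrow> \<exists>d k''. k' = d # k'' \<and> wf_com K d"
  by (induction c arbitrary: k k') (auto; fastforce)+

lemma next_state_symbols:
  assumes "wf_com K d" "\<And>i. i < K \<Longrightarrow> h i < 6" "i < K"
  shows "fst (snd (next_state h (d # k)) i) < 6"
  using assms by (cases d) (auto simp: idle_def)

text \<open>Indices from \<open>K\<close> on read 0, the top of an empty stack.
  \<open>rep_store\<close> keeps those stacks empty, so a guard, which may inspect any index, sees
  the same on tapes as on stacks.\<close>

definition heads :: "nat \<Rightarrow> nat list \<Rightarrow> nat \<Rightarrow> nat" where
  "heads K as i = (if i < K then as ! i else 0)"

text \<open>An intermediate machine with continuations as states. It separates the simulation of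
  commands from the numbering of states.\<close>

definition cont_step :: "nat \<Rightarrow> com list \<times> tape list \<Rightarrow> com list \<times> tape list" where
  "cont_step K = (\<lambda>(k, ts). if k = [] then (k, ts) else case next_state (heads K (map scanned ts)) k of
     (k', act) \<Rightarrow> (k', map (\<lambda>i. tape_act (act i) (ts ! i)) [0..<K]))"

text \<open>The empty continuation gets index \<open>length qs\<close>, the number of the halting
  state. The list \<open>qs\<close> may have repetitions, and any index at which \<open>k\<close>
  stands will do.\<close>

definition state_index :: "com list list \<Rightarrow> com list \<Rightarrow> nat" where
  "state_index qs k = (SOME i. i \<le> length qs \<and> (qs @ [[]]) ! i = k)"

definition machine :: "nat \<Rightarrow> com list list \<Rightarrow> tm" where
  "machine K qs = \<lparr>tapes = K, states = length qs, symbols = 6,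
     delta = (\<lambda>q as. case next_state (heads K as) (qs ! q) of
       (k', act) \<Rightarrow> (state_index qs k', map act [0..<K]))\<rparr>"

lemma state_index:
  assumes "k \<in> insert [] (set qs)"
  shows "state_index qs k \<le> length qs \<and> (qs @ [[]]) ! (state_index qs k) = k"
proof -
  have "\<exists>i. i \<le> length qs \<and> (qs @ [[]]) ! i = k"
  proof (cases "k = []")
    case True
    then show ?thesis by (intro exI[of _ "length qs"]) auto
  next
    case False
    then obtain i where "i < length qs" "qs ! i = k"
      using assms by (auto simp: in_set_conv_nth)
    then show ?thesis by (intro exI[of _ i]) (auto simp: nth_append)
  qed
  then show ?thesis unfolding state_index_def by (rule someI_ex)
qed

locale compiled =
  fixes K :: nat and c :: com and qs :: "com list list"
  assumes K: "K \<ge> 1" and wf: "wf_com K c" and qs: "set qs = conts c []" and qs0: "qs ! 0 = [c]"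
begin

lemma qs_closed: "k \<in> set qs \<Longrightarrow> fst (next_state h k) \<in> insert [] (set qs)"
  using conts_closed qs by blast

lemma qs_cons: "k \<in> set qs \<Longrightarrow> \<exists>d k'. k = d # k' \<and> wf_com K d"
  using conts_wf wf qs by blast

lemma nonempty_state: "q \<le> length qs \<Longrightarrow> (qs @ [[]]) ! q = [] \<Longrightarrow> q = length qs"
  using qs_cons nth_mem by (fastforce simp: nth_append split: if_splits)

lemma wf_machine: "wf_tm (machine K qs)"
  unfolding wf_tm_def
proof (intro conjI allI impI)
  show "tapes (machine K qs) \<ge> 1" "symbols (machine K qs) \<ge> 6"
    using K by (auto simp: machine_def)
  fix q as
  assume q: "q < states (machine K qs)"
    and as: "length as = tapes (machine K qs) \<and> set as \<subseteq> {..<symbols (machine K qs)}"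
  have q': "qs ! q \<in> set qs" using q by (auto simp: machine_def)
  obtain d k where dk: "qs ! q = d # k" "wf_com K d" using qs_cons[OF q'] by blast
  obtain k' act where na: "next_state (heads K as) (qs ! q) = (k', act)" by fastforce
  have "k' \<in> insert [] (set qs)" using qs_closed[OF q', of "heads K as"] na by simp
  then have i: "state_index qs k' \<le> length qs" using state_index by blast
  have "heads K as i < 6" if "i < K" for i
  proof -
    have "as ! i \<in> set as" using as that by (auto simp: machine_def)
    then have "as ! i < 6" using as by (auto simp: machine_def)
    then show ?thesis using that by (simp add: heads_def)
  qed
  then have a: "fst (act i) < 6" if "i < K" for i
    using next_state_symbols[OF dk(2), of "heads K as" i k] that na dk(1) by simp
  then show "case delta (machine K qs) q as of (q', acts) \<Rightarrow>
           q' \<le> states (machine K qs) \<and> length acts = tapes (machine K qs) \<and>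
           (\<forall>(a, d) \<in> set acts. a < symbols (machine K qs))"
    using i na by (auto simp: machine_def) (metis fst_conv)
qed

lemma machine_step:
  assumes "q \<le> length qs" "(qs @ [[]]) ! q = k" "k \<noteq> []" "length ts = K"
    and step: "cont_step K (k, ts) = (k', ts')"
  shows "\<exists>q'. tm_step (machine K qs) (q, ts) = (q', ts') \<and> q' \<le> length qs \<and>
    (qs @ [[]]) ! q' = k' \<and> length ts' = K"
proof -
  have q: "q < length qs" "qs ! q = k" using assms by (auto simp: nth_append split: if_splits)
  obtain k'' act where na: "next_state (heads K (map scanned ts)) k = (k'', act)" by fastforce
  have [simp]: "k'' = k'" and ts': "ts' = map (\<lambda>i. tape_act (act i) (ts ! i)) [0..<K]"
    using step na assms(3) by (auto simp: cont_step_def)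
  have "k' \<in> insert [] (set qs)"
    using qs_closed[of k "heads K (map scanned ts)"] na q nth_mem by fastforce
  note i = state_index[OF this]
  have "map2 tape_act (map act [0..<K]) ts = ts'"
    unfolding ts' using assms(4) by (intro nth_equalityI) auto
  then have "tm_step (machine K qs) (q, ts) = (state_index qs k', ts')"
    using q na by (simp add: machine_def)
  then show ?thesis using i ts' by auto
qed

end

text \<open>Cells left of the head are blank, so moving left exposes a free cell for a push. Blanks
  may follow the word because an idle step on an unlisted cell stores an explicit blank; the word
  itself has none, so scanning 0 means an empty stack.\<close>

definition represents :: "tape \<Rightarrow> nat list \<Rightarrow> bool" where
  "represents tp w \<longleftrightarrow> set (fst tp) \<subseteq> {0} \<and> 0 \<notin> set w \<and> (\<exists>m. snd tp = w @ replicate m 0)"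

definition rep_store :: "nat \<Rightarrow> tape list \<Rightarrow> store \<Rightarrow> bool" where
  "rep_store K ts s \<longleftrightarrow> length ts = K \<and> (\<forall>i<K. represents (ts ! i) (s i)) \<and> (\<forall>i\<ge>K. s i = [])"

lemma represents_scanned:
  "represents tp w \<Longrightarrow> scanned tp = (case w of [] \<Rightarrow> 0 | a # _ \<Rightarrow> a)"
  by (cases tp rule: scanned.cases; cases w)
    (auto simp: represents_def append_eq_Cons_conv Cons_eq_append_conv Cons_replicate_eq)

lemma rep_top: "rep_store K ts s \<Longrightarrow> i < K \<Longrightarrow> tops s i = scanned (ts ! i)"
  using represents_scanned[of "ts ! i" "s i"] by (simp add: rep_store_def tops_def)

lemma rep_heads: "rep_store K ts s \<Longrightarrow> heads K (map scanned ts) = tops s"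
  by (rule ext) (auto simp: heads_def tops_def rep_store_def represents_scanned)

lemma represents_idle:
  assumes "represents tp w"
  shows "represents (tape_act (scanned tp, Stay) tp) w"
proof -
  obtain l m where tp: "tp = (l, w @ replicate m 0)" "set l \<subseteq> {0}" "0 \<notin> set w"
    using assms by (cases tp) (auto simp: represents_def)
  show ?thesis
  proof (cases "w @ replicate m 0")
    case Nil
    then show ?thesis using tp by (auto simp: represents_def intro: exI[of _ 1])
  next
    case (Cons a r)
    then show ?thesis using tp by (auto simp: represents_def intro: exI[of _ m])
  qed
qed

lemma represents_push:
  assumes "represents tp w" "a \<noteq> 0"
  shows "represents (tape_act (a, Stay) (tape_act (scanned tp, MoveLeft) tp)) (a # w)"
proof -
  obtain l r where tp: "tp = (l, r)" by fastforce
  obtain m where r: "r = w @ replicate m 0" "set l \<subseteq> {0}" "0 \<notin> set w"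
    using assms(1) tp by (auto simp: represents_def)
  have "\<exists>m. scanned tp # tl r = w @ replicate m 0"
  proof (cases r)
    case Nil
    then show ?thesis using r tp by (intro exI[of _ 1]) auto
  next
    case (Cons b r')
    then show ?thesis using r tp by (intro exI[of _ m]) auto
  qed
  then show ?thesis using tp r assms(2) by (cases l) (auto simp: represents_def)
qed

text \<open>Writing a blank before moving right is what keeps the cells left of the head
  blank.\<close>

lemma represents_pop:
  assumes "represents tp w"
  shows "represents (tape_act (0, MoveRight) tp) (tl w)"
proof -
  obtain l r where tp: "tp = (l, r)" by fastforce
  obtain m where r: "r = w @ replicate m 0" "set l \<subseteq> {0}" "0 \<notin> set w"
    using assms tp by (auto simp: represents_def)
  show ?thesis
  proof (cases w)
    case Nil
    then show ?thesis using tp r by (auto simp: represents_def intro: exI[of _ "m - 1"])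
  next
    case (Cons b w')
    then show ?thesis using tp r by (auto simp: represents_def)
  qed
qed

text \<open>Steps that only inspect the tops leave the stacks as they are, but the lists of cells
  may gain an explicit blank; hence a new \<open>ts'\<close>.\<close>

lemma cont_step_idle:
  assumes "rep_store K ts s" "next_state (tops s) k = (k', idle (tops s))" "k \<noteq> []"
  shows "\<exists>ts'. cont_step K (k, ts) = (k', ts') \<and> rep_store K ts' s"
proof -
  have "represents (tape_act (idle (tops s) i) (ts ! i)) (s i)" if "i < K" for i
    using represents_idle[of "ts ! i" "s i"] assms(1) that rep_top[OF assms(1) that]
    by (simp add: idle_def rep_store_def)
  then show ?thesis using assms by (auto simp: cont_step_def rep_heads rep_store_def)
qed

text \<open>Induction over the execution, for an arbitrary continuation \<open>k\<close>, so that
  the runs for the parts of a \<open>Seq\<close> or \<open>While\<close> can be chained. The time is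
  exact because a control command costs the one step that replaces it by its parts.\<close>

lemma exec_cont_step:
  assumes "exec c s t s'" "wf_com K c" "rep_store K ts s"
  shows "\<exists>ts'. (cont_step K ^^ t) (c # k, ts) = (k, ts') \<and> rep_store K ts' s'"
  using assms
proof (induction arbitrary: k ts rule: exec.induct)
  case (exec_Push g s i)
  let ?h = "tops s" and ?a = "g (tops s)"
  have h: "heads K (map scanned ts) = ?h" using exec_Push rep_heads by blast
  define ts1 where "ts1 = map (\<lambda>j. tape_act (((idle ?h)(i := (?h i, MoveLeft))) j) (ts ! j)) [0..<K]"
  have 1: "cont_step K (Push i g # k, ts) = (Write i ?a # k, ts1)"
    using exec_Push by (simp add: cont_step_def h ts1_def clamp_def)
  define ts2 where "ts2 = map (\<lambda>j. tape_act (((idle (heads K (map scanned ts1)))(i := (?a, Stay))) j) (ts1 ! j)) [0..<K]"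
  have 2: "cont_step K (Write i ?a # k, ts1) = (k, ts2)"
    by (simp add: cont_step_def ts2_def)
  have sc: "?h j = scanned (ts ! j)" if "j < K" for j
    using exec_Push.prems(2) that by (rule rep_top)
  have "represents (ts2 ! j) ((s(i := ?a # s i)) j)" if j: "j < K" for j
  proof (cases "j = i")
    case True
    then show ?thesis
      using j exec_Push sc[OF j] represents_push[of "ts ! i" "s i" ?a]
      by (auto simp: ts2_def ts1_def rep_store_def)
  next
    case False
    have r: "represents (ts ! j) (s j)" using exec_Push j by (simp add: rep_store_def)
    have "represents (ts1 ! j) (s j)"
      using j False sc[OF j] represents_idle[OF r] by (simp add: ts1_def idle_def)
    moreover have "ts2 ! j = tape_act (scanned (ts1 ! j), Stay) (ts1 ! j)"
      using j False by (simp add: ts2_def idle_def heads_def ts1_def)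
    ultimately show ?thesis using represents_idle False by simp
  qed
  then have "rep_store K ts2 (s(i := ?a # s i))"
    using exec_Push by (auto simp: rep_store_def ts2_def)
  moreover have "(cont_step K ^^ 2) (Push i g # k, ts) = (k, ts2)"
    using 1 2 by (simp add: numeral_2_eq_2)
  ultimately show ?case by blast
next
  case (exec_Pop i s)
  let ?h = "tops s"
  have h: "heads K (map scanned ts) = ?h" using exec_Pop rep_heads by blast
  define ts1 where "ts1 = map (\<lambda>j. tape_act (((idle ?h)(i := (0, MoveRight))) j) (ts ! j)) [0..<K]"
  have 1: "cont_step K (Pop i # k, ts) = (k, ts1)"
    by (simp add: cont_step_def h ts1_def)
  have sc: "?h j = scanned (ts ! j)" if "j < K" for j
    using exec_Pop.prems(2) that by (rule rep_top)
  have "represents (ts1 ! j) ((s(i := tl (s i))) j)" if j: "j < K" for j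
    using j exec_Pop sc[OF j] represents_pop[of "ts ! j" "s j"] represents_idle[of "ts ! j" "s j"]
    by (auto simp: ts1_def rep_store_def idle_def)
  then have "rep_store K ts1 (s(i := tl (s i)))"
    using exec_Pop by (auto simp: rep_store_def ts1_def)
  moreover have "(cont_step K ^^ 1) (Pop i # k, ts) = (k, ts1)" using 1 by simp
  ultimately show ?case by blast
next
  case (exec_Seq c s t s' d u s'')
  obtain ts0 where 0: "cont_step K (Seq c d # k, ts) = (c # d # k, ts0)" "rep_store K ts0 s"
    using cont_step_idle[OF exec_Seq.prems(2), of "Seq c d # k"] by auto
  obtain ts1 where 1: "(cont_step K ^^ t) (c # d # k, ts0) = (d # k, ts1)" "rep_store K ts1 s'"
    using exec_Seq.IH(1)[OF _ 0(2)] exec_Seq.prems by fastforce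
  obtain ts2 where 2: "(cont_step K ^^ u) (d # k, ts1) = (k, ts2)" "rep_store K ts2 s''"
    using exec_Seq.IH(2)[OF _ 1(2)] exec_Seq.prems by fastforce
  have "(cont_step K ^^ Suc (t + u)) (Seq c d # k, ts) = (k, ts2)"
    using 0 1 2 by (simp add: funpow_swap1 funpow_add add.commute[of t])
  then show ?case using 2 by blast
next
  case (exec_CondT b s c t s' d)
  obtain ts0 where 0: "cont_step K (Cond b c d # k, ts) = (c # k, ts0)" "rep_store K ts0 s"
    using cont_step_idle[OF exec_CondT.prems(2), of "Cond b c d # k"] exec_CondT.hyps by auto
  obtain ts1 where 1: "(cont_step K ^^ t) (c # k, ts0) = (k, ts1)" "rep_store K ts1 s'"
    using exec_CondT.IH[OF _ 0(2)] exec_CondT.prems by fastforce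
  then show ?case using 0 by (auto simp: funpow_swap1)
next
  case (exec_CondF b s d t s' c)
  obtain ts0 where 0: "cont_step K (Cond b c d # k, ts) = (d # k, ts0)" "rep_store K ts0 s"
    using cont_step_idle[OF exec_CondF.prems(2), of "Cond b c d # k"] exec_CondF.hyps by auto
  obtain ts1 where 1: "(cont_step K ^^ t) (d # k, ts0) = (k, ts1)" "rep_store K ts1 s'"
    using exec_CondF.IH[OF _ 0(2)] exec_CondF.prems by fastforce
  then show ?case using 0 by (auto simp: funpow_swap1)
next
  case (exec_WhileF b s c)
  then show ?case using cont_step_idle[OF exec_WhileF.prems(2), of "While b c # k"] by auto
next
  case (exec_WhileT b s c t s' u s'')
  obtain ts0 where 0: "cont_step K (While b c # k, ts) = (c # While b c # k, ts0)" "rep_store K ts0 s"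
    using cont_step_idle[OF exec_WhileT.prems(2), of "While b c # k"] exec_WhileT.hyps by auto
  obtain ts1 where 1: "(cont_step K ^^ t) (c # While b c # k, ts0) = (While b c # k, ts1)" "rep_store K ts1 s'"
    using exec_WhileT.IH(1)[OF _ 0(2)] exec_WhileT.prems by fastforce
  obtain ts2 where 2: "(cont_step K ^^ u) (While b c # k, ts1) = (k, ts2)" "rep_store K ts2 s''"
    using exec_WhileT.IH(2)[OF _ 1(2)] exec_WhileT.prems by fastforce
  have "(cont_step K ^^ Suc (t + u)) (While b c # k, ts) = (k, ts2)"
    using 0 1 2 by (simp add: funpow_swap1 funpow_add add.commute[of t])
  then show ?case using 2 by blast
qed

lemma (in compiled) machine_steps:
  assumes "(cont_step K ^^ t) (k, ts) = (k', ts')"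
    "q \<le> length qs" "(qs @ [[]]) ! q = k" "length ts = K"
  shows "\<exists>q'. (tm_step (machine K qs) ^^ t) (q, ts) = (q', ts') \<and> q' \<le> length qs \<and>
    (qs @ [[]]) ! q' = k'"
  using assms
proof (induction t arbitrary: k ts q)
  case 0
  then show ?case by simp
next
  case (Suc t)
  obtain k1 ts1 where s1: "cont_step K (k, ts) = (k1, ts1)" by fastforce
  have "\<exists>q'. tm_step (machine K qs) (q, ts) = (q', ts1) \<and> q' \<le> length qs \<and>
    (qs @ [[]]) ! q' = k1 \<and> length ts1 = K"
  proof (cases "k = []")
    case True
    then have "q = length qs" using nonempty_state Suc.prems(2,3) by blast
    then show ?thesis using s1 True Suc.prems by (auto simp: cont_step_def machine_def)
  next
    case False
    then show ?thesis using machine_step[OF Suc.prems(2,3) False Suc.prems(4) s1] by blast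
  qed
  then obtain q1 where q1: "tm_step (machine K qs) (q, ts) = (q1, ts1)" "q1 \<le> length qs"
    "(qs @ [[]]) ! q1 = k1" "length ts1 = K" by blast
  have "(cont_step K ^^ t) (k1, ts1) = (k', ts')" using Suc.prems(1) s1 by (simp add: funpow_swap1)
  from Suc.IH[OF this q1(2-4)] q1(1) show ?case by (simp add: funpow_swap1)
qed

text \<open>The output is read on the last tape, which holds stack \<open>K - 1\<close>. Reading
  stops at the first blank, and this is the end of the stack since no stack contains 0.\<close>

lemma com_to_tm:
  assumes "wf_com K c" "K \<ge> 1"
  shows "\<exists>M. wf_tm M \<and> (\<forall>x t n s'. 0 \<notin> set x \<longrightarrow> exec c ((\<lambda>_. [])(0 := x)) t s' \<longrightarrow> t \<le> n \<longrightarrow>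
    tm_outputs_within M x n (s' (K - 1)))"
proof -
  obtain qs' where qs': "set qs' = conts c []" using finite_conts finite_list by blast
  \<comment> \<open>\<open>[c]\<close> is put in front to get number 0, that of the initial state;
    it occurs in \<open>qs'\<close> once more.\<close>
  interpret compiled K c "[c] # qs'"
    using assms qs' conts_self[of c "[]"] by unfold_locales auto
  let ?M = "machine K ([c] # qs')"
  have "tm_outputs_within ?M x n (s' (K - 1))"
    if x: "0 \<notin> set x" and e: "exec c ((\<lambda>_. [])(0 := x)) t s'" and t: "t \<le> n" for x t n s'
  proof -
    let ?ts = "([], x) # replicate (K - 1) ([], []) :: tape list"
    have "represents (?ts ! i) (((\<lambda>_. [])(0 := x)) i)" if "i < K" for i
      using that x by (cases i) (auto simp: represents_def)
    then have "rep_store K ?ts ((\<lambda>_. [])(0 := x))"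
      using assms(2) by (auto simp: rep_store_def)
    from exec_cont_step[OF e assms(1) this, of "[]"] obtain ts' where
      ts': "(cont_step K ^^ t) ([c], ?ts) = ([], ts')" "rep_store K ts' s'" by blast
    from machine_steps[OF ts'(1), of 0] obtain q' where
      q': "(tm_step ?M ^^ t) (0, ?ts) = (q', ts')" "q' \<le> length ([c] # qs')"
        "(([c] # qs') @ [[]]) ! q' = []"
      using assms(2) by auto
    have "q' = length ([c] # qs')" by (rule nonempty_state[OF q'(2,3)])
    then have "(tm_step ?M ^^ t) (tm_init ?M x) = (states ?M, ts')"
      using q' by (simp add: tm_init_def machine_def)
    moreover have "s' (K - 1) = takeWhile (\<lambda>a. a \<noteq> 0) (snd (last ts'))"
    proof -
      have "length ts' = K" "represents (ts' ! (K - 1)) (s' (K - 1))"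
        using ts'(2) assms(2) by (auto simp: rep_store_def)
      then have "represents (last ts') (s' (K - 1))"
        using assms(2) by (subst last_conv_nth) auto
      then obtain m where m: "snd (last ts') = s' (K - 1) @ replicate m 0" "0 \<notin> set (s' (K - 1))"
        by (auto simp: represents_def)
      then show ?thesis by (subst m(1), subst takeWhile_append2) (auto intro: gr0I)
    qed
    ultimately show ?thesis using t by (auto simp: tm_outputs_within_def)
  qed
  then show ?thesis using wf_machine by blast
qed

section \<open>Polynomial bounds\<close>

text \<open>An exact polynomial with natural coefficients, not a function bounded by one: such a
  function is monotone, so bounds may be substituted into it.\<close>

definition polyb :: "(nat \<Rightarrow> nat) \<Rightarrow> bool" where
  "polyb T \<longleftrightarrow> (\<exists>p :: nat poly. \<forall>n. T n = poly p n)"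

lemma polyb_const [intro, simp]: "polyb (\<lambda>n. k)"
  unfolding polyb_def by (rule exI[of _ "[:k:]"]) simp

lemma polyb_id [intro, simp]: "polyb (\<lambda>n. n)"
  unfolding polyb_def by (rule exI[of _ "[:0, 1:]"]) simp

lemma polyb_add [intro, simp]:
  assumes "polyb T" "polyb U" shows "polyb (\<lambda>n. T n + U n)"
proof -
  obtain p q where "\<forall>n. T n = poly p n" "\<forall>n. U n = poly q n" using assms unfolding polyb_def by blast
  then show ?thesis unfolding polyb_def by (intro exI[of _ "p + q"]) simp
qed

lemma polyb_mult [intro, simp]:
  assumes "polyb T" "polyb U" shows "polyb (\<lambda>n. T n * U n)"
proof -
  obtain p q where "\<forall>n. T n = poly p n" "\<forall>n. U n = poly q n" using assms unfolding polyb_def by blast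
  then show ?thesis unfolding polyb_def by (intro exI[of _ "p * q"]) simp
qed

lemma polyb_comp [intro]:
  assumes "polyb T" "polyb U" shows "polyb (\<lambda>n. T (U n))"
proof -
  obtain p q where "\<forall>n. T n = poly p n" "\<forall>n. U n = poly q n" using assms unfolding polyb_def by blast
  then show ?thesis unfolding polyb_def by (intro exI[of _ "pcompose p q"]) (simp add: poly_pcompose)
qed

lemma polyb_Suc [intro, simp]: "polyb T \<Longrightarrow> polyb (\<lambda>n. Suc (T n))"
  using polyb_add[of T "\<lambda>_. 1"] by simp

lemma polyb_mono: assumes "polyb T" "m \<le> n" shows "T m \<le> T n"
proof -
  obtain p :: "nat poly" where p: "\<forall>n. T n = poly p n" using assms(1) unfolding polyb_def by blast
  have "poly p m \<le> poly p n"
    using assms(2) by (induction p) (auto intro!: add_left_mono mult_mono)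
  then show ?thesis using p by simp
qed

section \<open>Programs on stacks\<close>

text \<open>Upper bounds replace exact times from here on, which allows rounding.\<close>

definition runs :: "com \<Rightarrow> store \<Rightarrow> store \<Rightarrow> nat \<Rightarrow> bool" where
  "runs c s s' T \<longleftrightarrow> (\<exists>t\<le>T. exec c s t s')"

text \<open>The number of tapes is settled at the very end; until then programs may take any stack
  as scratch space.\<close>

definition prog :: "com \<Rightarrow> bool" where
  "prog c \<longleftrightarrow> (\<exists>K. wf_com K c)"

lemma prog_simps [simp]:
  "prog (Push i g)" "prog (Pop i)" "prog (Seq c d) \<longleftrightarrow> prog c \<and> prog d"
  "prog (Cond b c d) \<longleftrightarrow> prog c \<and> prog d" "prog (While b c) \<longleftrightarrow> prog c"
proof -
  show "prog (Seq c d) \<longleftrightarrow> prog c \<and> prog d" "prog (Cond b c d) \<longleftrightarrow> prog c \<and> prog d"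
    unfolding prog_def by (auto intro: wf_com_mono[OF _ max.cobounded1] wf_com_mono[OF _ max.cobounded2])
qed (auto simp: prog_def)

lemma runs_mono: "runs c s s' T \<Longrightarrow> T \<le> U \<Longrightarrow> runs c s s' U"
  unfolding runs_def by (meson order_trans)

lemma runs_Push: "g (tops s) \<in> {1..5} \<Longrightarrow> s' = s(i := g (tops s) # s i) \<Longrightarrow> runs (Push i g) s s' 2"
  unfolding runs_def using exec_Push by blast

lemma runs_Pop: "s' = s(i := tl (s i)) \<Longrightarrow> runs (Pop i) s s' 1"
  unfolding runs_def using exec_Pop by blast

lemma runs_Seq: "runs c s s1 T \<Longrightarrow> runs d s1 s2 U \<Longrightarrow> runs (Seq c d) s s2 (Suc (T + U))"
  unfolding runs_def by (meson exec_Seq add_mono Suc_le_mono)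

lemma runs_CondT: "b (tops s) \<Longrightarrow> runs c s s' T \<Longrightarrow> runs (Cond b c d) s s' (Suc T)"
  unfolding runs_def by (meson exec_CondT Suc_le_mono)

lemma runs_CondF: "\<not> b (tops s) \<Longrightarrow> runs d s s' T \<Longrightarrow> runs (Cond b c d) s s' (Suc T)"
  unfolding runs_def by (meson exec_CondF Suc_le_mono)

lemma runs_WhileF: "\<not> b (tops s) \<Longrightarrow> runs (While b c) s s 1"
  unfolding runs_def by (meson exec_WhileF order_refl)

lemma runs_WhileT: "b (tops s) \<Longrightarrow> runs c s s1 T \<Longrightarrow> runs (While b c) s1 s2 U \<Longrightarrow>
    runs (While b c) s s2 (Suc (T + U))"
  unfolding runs_def by (meson exec_WhileT add_mono Suc_le_mono)

lemma tops_Cons [simp]: "s i = a # w \<Longrightarrow> tops s i = a"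
  by (simp add: tops_def)

lemma tops_Nil [simp]: "s i = [] \<Longrightarrow> tops s i = 0"
  by (simp add: tops_def)

definition nop :: com where "nop = While (\<lambda>_. False) (Pop 0)"

lemma prog_nop [simp]: "prog nop" by (simp add: nop_def)

lemma runs_nop: "runs nop s s 1" unfolding nop_def by (rule runs_WhileF) simp

section \<open>Moving, erasing and copying stacks\<close>

definition xfer :: "nat \<Rightarrow> nat \<Rightarrow> com" where
  "xfer i j = While (\<lambda>h. h i \<noteq> 0) (Seq (Push j (\<lambda>h. h i)) (Pop i))"

lemma prog_xfer [simp]: "prog (xfer i j)" by (simp add: xfer_def)

text \<open>A round costs five steps: two for the push and one each for the pop, the
  \<open>Seq\<close> and the loop test. As all symbols lie in \<open>{1..5}\<close>, a top of 0
  means that the stack is empty, and every pushed symbol is legal.\<close>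

lemma runs_xfer:
  assumes "i \<noteq> j" "set (s i) \<subseteq> {1..5}" "s' = s(i := [], j := rev (s i) @ s j)"
  shows "runs (xfer i j) s s' (5 * length (s i) + 1)"
  using assms
proof (induction "s i" arbitrary: s)
  case Nil
  then have "s' = s" using assms(1) by auto
  moreover have "runs (xfer i j) s s 1" unfolding xfer_def by (rule runs_WhileF) (use Nil in auto)
  ultimately show ?case by (auto elim: runs_mono)
next
  case (Cons a w)
  note si = Cons.hyps(2)[symmetric]
  let ?s1 = "s(j := a # s j)" and ?s2 = "s(j := a # s j, i := w)"
  have "a \<in> {1..5}" using Cons.prems si by auto
  then have 1: "runs (Push j (\<lambda>h. h i)) s ?s1 2"
    using si by (intro runs_Push) auto
  have 2: "runs (Pop i) ?s1 ?s2 1" using Cons.prems(1) si by (intro runs_Pop) auto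
  have 3: "runs (xfer i j) ?s2 s' (5 * length (?s2 i) + 1)"
    using Cons.prems si by (intro Cons.hyps(1)) auto
  have "runs (xfer i j) s s' (Suc (Suc (2 + 1) + (5 * length (?s2 i) + 1)))"
    unfolding xfer_def
    by (rule runs_WhileT[OF _ runs_Seq[OF 1 2] 3[unfolded xfer_def]])
      (use \<open>a \<in> {1..5}\<close> si in auto)
  then show ?case using si by (elim runs_mono) auto
qed

definition clear :: "nat \<Rightarrow> com" where
  "clear i = While (\<lambda>h. h i \<noteq> 0) (Pop i)"

lemma prog_clear [simp]: "prog (clear i)" by (simp add: clear_def)

lemma runs_clear:
  assumes "set (s i) \<subseteq> {1..5}" "s' = s(i := [])"
  shows "runs (clear i) s s' (2 * length (s i) + 1)"
  using assms
proof (induction "s i" arbitrary: s)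
  case Nil
  then have "s' = s" by auto
  moreover have "runs (clear i) s s 1" unfolding clear_def by (rule runs_WhileF) (use Nil in auto)
  ultimately show ?case by (auto elim: runs_mono)
next
  case (Cons a w)
  note si = Cons.hyps(2)[symmetric]
  let ?s2 = "s(i := w)"
  have a: "a \<in> {1..5}" using Cons.prems si by auto
  have 2: "runs (Pop i) s ?s2 1" using si by (intro runs_Pop) auto
  have 3: "runs (clear i) ?s2 s' (2 * length (?s2 i) + 1)"
    using Cons.prems si by (intro Cons.hyps(1)) auto
  have "runs (clear i) s s' (Suc (1 + (2 * length (?s2 i) + 1)))"
    unfolding clear_def
    by (rule runs_WhileT[OF _ 2 3[unfolded clear_def]]) (use a si in auto)
  then show ?case using si by (elim runs_mono) auto
qed

fun pushw :: "nat \<Rightarrow> nat list \<Rightarrow> com" where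
  "pushw i [] = nop"
| "pushw i (a # w) = Seq (pushw i w) (Push i (\<lambda>_. a))"

lemma prog_pushw [simp]: "prog (pushw i w)" by (induction w) auto

lemma runs_pushw:
  assumes "set w \<subseteq> {1..5}" "s' = s(i := w @ s i)"
  shows "runs (pushw i w) s s' (3 * length w + 1)"
  using assms
proof (induction w arbitrary: s')
  case Nil
  then show ?case using runs_nop by (auto elim: runs_mono)
next
  case (Cons a w)
  have "runs (pushw i (a # w)) s s' (Suc ((3 * length w + 1) + 2))"
    unfolding pushw.simps
    by (rule runs_Seq[OF Cons.IH[OF _ refl] runs_Push]) (use Cons.prems in auto)
  then show ?case by (elim runs_mono) auto
qed

text \<open>The word travels through \<open>k\<close>, so it is reversed twice and both copies end
  up in the original order.\<close>

definition dup :: "nat \<Rightarrow> nat \<Rightarrow> nat \<Rightarrow> com" where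
  "dup i k j = Seq (xfer i k)
     (While (\<lambda>h. h k \<noteq> 0) (Seq (Push i (\<lambda>h. h k)) (Seq (Push j (\<lambda>h. h k)) (Pop k))))"

lemma prog_dup [simp]: "prog (dup i k j)" by (simp add: dup_def)

lemma runs_dup_loop:
  assumes "i \<noteq> j" "i \<noteq> k" "j \<noteq> k" "set (s k) \<subseteq> {1..5}"
    "s' = s(k := [], i := rev (s k) @ s i, j := rev (s k) @ s j)"
  shows "runs (While (\<lambda>h. h k \<noteq> 0) (Seq (Push i (\<lambda>h. h k)) (Seq (Push j (\<lambda>h. h k)) (Pop k))))
    s s' (8 * length (s k) + 1)" (is "runs (While ?b ?c) _ _ _")
  using assms
proof (induction "s k" arbitrary: s)
  case Nil
  then have "s' = s" using assms by (auto simp: fun_upd_idem)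
  moreover have "runs (While ?b ?c) s s 1" by (rule runs_WhileF) (use Nil in auto)
  ultimately show ?case by (auto elim: runs_mono)
next
  case (Cons a w)
  note sk = Cons.hyps(2)[symmetric]
  let ?s1 = "s(i := a # s i)" and ?s2 = "s(i := a # s i, j := a # s j)"
    and ?s3 = "s(i := a # s i, j := a # s j, k := w)"
  have a: "a \<in> {1..5}" using Cons.prems sk by auto
  have 1: "runs (Push i (\<lambda>h. h k)) s ?s1 2" using a sk Cons.prems by (intro runs_Push) auto
  have 2: "runs (Push j (\<lambda>h. h k)) ?s1 ?s2 2" using a sk Cons.prems by (intro runs_Push) auto
  have 3: "runs (Pop k) ?s2 ?s3 1" using Cons.prems sk by (intro runs_Pop) auto
  have 4: "runs (While ?b ?c) ?s3 s' (8 * length (?s3 k) + 1)"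
    using Cons.prems sk by (intro Cons.hyps(1)) auto
  have "runs (While ?b ?c) s s' (Suc (Suc (2 + Suc (2 + 1)) + (8 * length (?s3 k) + 1)))"
    by (rule runs_WhileT[OF _ runs_Seq[OF 1 runs_Seq[OF 2 3]] 4]) (use a sk in auto)
  then show ?case using sk by (elim runs_mono) auto
qed

lemma runs_dup:
  assumes "i \<noteq> j" "i \<noteq> k" "j \<noteq> k" "set (s i) \<subseteq> {1..5}" "s j = []" "s k = []"
    "s' = s(j := s i)"
  shows "runs (dup i k j) s s' (13 * length (s i) + 3)"
proof -
  have "runs (dup i k j) s s' (Suc ((5 * length (s i) + 1) + (8 * length (rev (s i)) + 1)))"
    unfolding dup_def
  proof (rule runs_Seq[OF runs_xfer[OF _ _ refl]])
    let ?s1 = "s(i := [], k := rev (s i) @ s k)"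
    have "runs (While (\<lambda>h. h k \<noteq> 0) (Seq (Push i (\<lambda>h. h k)) (Seq (Push j (\<lambda>h. h k)) (Pop k))))
       ?s1 s' (8 * length (?s1 k) + 1)"
      using assms by (intro runs_dup_loop) (auto intro!: ext)
    then show "runs (While (\<lambda>h. h k \<noteq> 0) (Seq (Push i (\<lambda>h. h k)) (Seq (Push j (\<lambda>h. h k)) (Pop k))))
       ?s1 s' (8 * length (rev (s i)) + 1)" using assms by simp
  qed (use assms in auto)
  then show ?thesis by (elim runs_mono) auto
qed

section \<open>Nested lists of numbers\<close>

datatype val = Num nat | Lst "val list"

fun enc :: "val \<Rightarrow> nat list" where
  "enc (Num n) = enc_nat n"
| "enc (Lst vs) = 4 # concat (map enc vs) @ [5]"

lemma binary_symbols: "set (binary n) \<subseteq> {1, 2}"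
proof (induction n rule: binary.induct)
  case (1 n)
  then show ?case by (subst binary.simps) (auto simp: mod_2_eq_odd split: if_splits)
qed

lemma binary_inj: "binary m = binary n \<Longrightarrow> m = n"
proof (induction m arbitrary: n rule: binary.induct)
  case (1 m)
  show ?case
  proof (cases "m = 0 \<or> n = 0")
    case True
    then show ?thesis using 1(2) by (subst (asm) (1 2) binary.simps) (auto split: if_splits)
  next
    case False
    then have "m mod 2 = n mod 2" "binary (m div 2) = binary (n div 2)"
      using 1(2) by (subst (asm) (1 2) binary.simps, simp)+
    then show ?thesis using 1(1)[of "n div 2"] False by (metis div_mult_mod_eq)
  qed
qed

lemma enc_symbols: "set (enc v) \<subseteq> {1..5}"
proof (induction v)
  case (Num n)
  then show ?case using binary_symbols[of n] by (auto simp: enc_nat_def)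
qed fastforce

lemma enc_nonempty: "enc v \<noteq> []"
  by (cases v) (auto simp: enc_nat_def)

lemma split_at_3:
  assumes "u @ 3 # r = u' @ 3 # r'" "(3::nat) \<notin> set u" "3 \<notin> set u'"
  shows "u = u' \<and> r = r'"
  using assms by (induction u arbitrary: u') (case_tac u'; auto)+

lemma hd_enc_Num: "hd (enc (Num n) @ r) \<in> {1, 2, 3}"
  using binary_symbols[of n] by (cases "binary n") (auto simp: enc_nat_def)

text \<open>A closing bracket never begins a value. Hence inside a list a top of 5 means that no
  element is left.\<close>

lemma hd_enc: "hd (enc v @ r) \<noteq> 5"
proof (cases v)
  case (Num n)
  then show ?thesis using hd_enc_Num[of n r] by (auto simp del: enc.simps)
qed simp

text \<open>The first symbol tells numbers from lists. A number ends at the first 3; list bodies are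
  compared element by element, their end being recognised by \<open>hd_enc\<close>. The remainders
  have to vary for the induction over the elements.\<close>

lemma enc_prefix_free: "enc v @ r = enc v' @ r' \<Longrightarrow> v = v' \<and> r = r'"
proof (induction v arbitrary: v' r r')
  case (Num n)
  show ?case
  proof (cases v')
    case (Num n')
    have "3 \<notin> set (binary n)" "3 \<notin> set (binary n')" using binary_symbols by fastforce+
    then have "binary n = binary n' \<and> r = r'"
      using Num Num.prems by (intro split_at_3) (auto simp: enc_nat_def)
    then show ?thesis using Num binary_inj by blast
  next
    case (Lst vs)
    then show ?thesis using hd_enc_Num[of n r] Num by auto
  qed
next
  case (Lst vs)
  show ?case
  proof (cases v')
    case (Num n')
    then show ?thesis using hd_enc_Num[of n' r'] Lst.prems by (metis enc.simps(2) append_Cons list.sel(1) insert_iff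
      empty_iff numeral_eq_iff num.distinct(1) semiring_norm(83,84,85,86,87,88,89,90) one_eq_numeral_iff)
  next
    case L': (Lst vs')
    have "vs = vs' \<and> r = r'"
      if "concat (map enc vs) @ 5 # r = concat (map enc vs') @ 5 # r'"
      using that Lst.IH
    proof (induction vs arbitrary: vs')
      case Nil
      then show ?case
      proof (cases vs')
        case (Cons w ws)
        then show ?thesis using Nil hd_enc[of w "concat (map enc ws) @ 5 # r'"]
          by (metis append.left_neutral append.assoc concat.simps list.simps(8,9) list.sel(1))
      qed auto
    next
      case (Cons v vs)
      show ?case
      proof (cases vs')
        case Nil
        then show ?thesis using Cons.prems(1) hd_enc[of v "concat (map enc vs) @ 5 # r"]
          by (metis append.left_neutral append.assoc concat.simps list.simps(8,9) list.sel(1))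
      next
        case (Cons w ws)
        with Cons.prems have "enc v @ concat (map enc vs) @ 5 # r = enc w @ concat (map enc ws) @ 5 # r'"
          by simp
        then have "v = w \<and> concat (map enc vs) @ 5 # r = concat (map enc ws) @ 5 # r'"
          using Cons.prems(2)[of v] by auto
        then show ?thesis using Cons Cons.IH[of ws] Cons.prems by auto
      qed
    qed
    then show ?thesis using L' Lst.prems by simp
  qed
qed

lemma enc_inj: "enc v = enc w \<longleftrightarrow> v = w"
  using enc_prefix_free[of v "[]" w "[]"] by auto

section \<open>Cutting the first value off a word\<close>

definition take_body :: "nat \<Rightarrow> nat \<Rightarrow> nat \<Rightarrow> com" where
  "take_body i j k = Seq (Push j (\<lambda>h. h i)) (Seq
     (Cond (\<lambda>h. h i = 4) (Push k (\<lambda>_. 4)) (Cond (\<lambda>h. h i = 5) (Pop k) nop)) (Pop i))"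

text \<open>Moves one value from the top of \<open>i\<close> onto \<open>j\<close>, in reverse; \<open>k\<close> counts the open brackets.\<close>

definition take_val :: "nat \<Rightarrow> nat \<Rightarrow> nat \<Rightarrow> com" where
  "take_val i j k = While (\<lambda>h. h k \<noteq> 0 \<or> h j \<noteq> 3 \<and> h j \<noteq> 5) (take_body i j k)"

lemma prog_take_val [simp]: "prog (take_val i j k)" by (simp add: take_val_def take_body_def)

context
  fixes i j k :: nat
  assumes distinct: "i \<noteq> j" "i \<noteq> k" "j \<noteq> k"
begin

definition tv_state :: "store \<Rightarrow> nat list \<Rightarrow> nat list \<Rightarrow> nat \<Rightarrow> store" where
  "tv_state s u w d = s(i := u, j := w, k := replicate d 4)"

text \<open>Read backwards, from the state after one symbol to the state before it. The stack
  \<open>k\<close> holds one 4 per open bracket. The last hypothesis is the loop guard: a bracket is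
  open, or nothing has been moved yet, or the last symbol moved ends neither a number nor a list.
  Nine steps bound one round.\<close>

lemma take_val_step:
  assumes "runs (take_val i j k) (tv_state s u (a # w) d') s' T" "a \<in> {1..5}"
    "d' = (if a = 4 then Suc d else if a = 5 then d - 1 else d)"
    "d > 0 \<or> w = [] \<or> hd w \<noteq> 3 \<and> hd w \<noteq> 5"
  shows "runs (take_val i j k) (tv_state s (a # u) w d) s' (9 + T)"
proof -
  let ?s0 = "tv_state s (a # u) w d" and ?s1 = "tv_state s (a # u) (a # w) d"
    and ?s2 = "tv_state s (a # u) (a # w) d'" and ?s3 = "tv_state s u (a # w) d'"
  have [simp]: "tops ?s1 i = a" using distinct by (simp add: tv_state_def)
  have 1: "runs (Push j (\<lambda>h. h i)) ?s0 ?s1 2"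
    using distinct assms by (intro runs_Push) (auto simp: tv_state_def)
  have 2: "runs (Cond (\<lambda>h. h i = 4) (Push k (\<lambda>_. 4)) (Cond (\<lambda>h. h i = 5) (Pop k) nop)) ?s1 ?s2 3"
  proof (cases "a = 4")
    case True
    have "runs (Cond (\<lambda>h. h i = 4) (Push k (\<lambda>_. 4)) (Cond (\<lambda>h. h i = 5) (Pop k) nop)) ?s1 ?s2 (Suc 2)"
      using True assms(3) distinct by (intro runs_CondT runs_Push) (auto simp: tv_state_def)
    then show ?thesis by (elim runs_mono) simp
  next
    case False
    have "runs (Cond (\<lambda>h. h i = 5) (Pop k) nop) ?s1 ?s2 (Suc 1)"
    proof (cases "a = 5")
      case True
      then show ?thesis using assms(3) distinct
        by (intro runs_CondT runs_Pop) (auto simp: tv_state_def tl_replicate)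
    next
      case f: False
      then have "?s2 = ?s1" using False assms(3) by simp
      then show ?thesis using f runs_nop by (intro runs_CondF) simp_all
    qed
    then have "runs (Cond (\<lambda>h. h i = 4) (Push k (\<lambda>_. 4)) (Cond (\<lambda>h. h i = 5) (Pop k) nop)) ?s1 ?s2 (Suc (Suc 1))"
      using False by (intro runs_CondF[where T = "Suc 1"]) simp_all
    then show ?thesis by (elim runs_mono) simp
  qed
  have 3: "runs (Pop i) ?s2 ?s3 1" 
    using distinct by (intro runs_Pop) (auto simp: tv_state_def)
  have b: "tops ?s0 k \<noteq> 0 \<or> tops ?s0 j \<noteq> 3 \<and> tops ?s0 j \<noteq> 5"
    using assms(4) distinct by (cases d; cases w) (auto simp: tv_state_def tops_def)
  have "runs (take_val i j k) ?s0 s' (Suc (Suc (2 + Suc (3 + 1)) + T))"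
    unfolding take_val_def
    by (rule runs_WhileT[OF b _ assms(1)[unfolded take_val_def]])
      (unfold take_body_def, rule runs_Seq[OF 1 runs_Seq[OF 2 3]])
  then show ?thesis by (elim runs_mono) simp
qed

lemma take_val_bits:
  assumes "runs (take_val i j k) (tv_state s u (rev b @ w) d) s' T" "set b \<subseteq> {1, 2}"
    "d > 0 \<or> w = [] \<or> hd w \<noteq> 3 \<and> hd w \<noteq> 5"
  shows "runs (take_val i j k) (tv_state s (b @ u) w d) s' (9 * length b + T)"
  using assms
proof (induction b arbitrary: w)
  case (Cons a b)
  have "runs (take_val i j k) (tv_state s (b @ u) (a # w) d) s' (9 * length b + T)"
    using Cons.prems by (intro Cons.IH) auto
  then have "runs (take_val i j k) (tv_state s (a # b @ u) w d) s' (9 + (9 * length b + T))"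
    using Cons.prems by (intro take_val_step) auto
  then show ?case by (simp add: algebra_simps)
qed simp

lemma take_val_Num:
  assumes "runs (take_val i j k) (tv_state s u (rev (enc (Num n)) @ w) d) s' T"
    "d > 0 \<or> w = [] \<or> hd w \<noteq> 3 \<and> hd w \<noteq> 5"
  shows "runs (take_val i j k) (tv_state s (enc (Num n) @ u) w d) s' (9 * length (enc (Num n)) + T)"
proof -
  have b: "set (binary n) \<subseteq> {1, 2}" by (rule binary_symbols)
  have "hd (rev (binary n) @ w) \<noteq> 3 \<and> hd (rev (binary n) @ w) \<noteq> 5 \<or> d > 0 \<or> rev (binary n) @ w = []"
  proof (cases "rev (binary n)")
    case Nil
    then show ?thesis using assms by auto
  next
    case (Cons a b')
    then have "a \<in> set (binary n)" by (metis list.set_intros(1) set_rev)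
    then show ?thesis using Cons b by auto
  qed
  then have "runs (take_val i j k) (tv_state s (3 # u) (rev (binary n) @ w) d) s' (9 + T)"
    using assms(1) by (intro take_val_step) (auto simp: enc_nat_def)
  then have "runs (take_val i j k) (tv_state s (binary n @ 3 # u) w d) s' (9 * length (binary n) + (9 + T))"
    using b assms by (intro take_val_bits) auto
  then show ?thesis by (simp add: enc_nat_def algebra_simps)
qed

lemma take_vals_nested:
  assumes "\<And>v w u T. v \<in> set vs \<Longrightarrow> runs (take_val i j k) (tv_state s u (rev (enc v) @ w) d) s' T \<Longrightarrow>
      runs (take_val i j k) (tv_state s (enc v @ u) w d) s' (9 * length (enc v) + T)"
    "runs (take_val i j k) (tv_state s u (rev (concat (map enc vs)) @ w) d) s' T"
  shows "runs (take_val i j k) (tv_state s (concat (map enc vs) @ u) w d) s'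
    (9 * length (concat (map enc vs)) + T)"
  using assms
proof (induction vs arbitrary: w)
  case (Cons v vs)
  have "runs (take_val i j k) (tv_state s (concat (map enc vs) @ u) (rev (enc v) @ w) d) s'
      (9 * length (concat (map enc vs)) + T)"
    using Cons.prems by (intro Cons.IH) auto
  from Cons.prems(1)[OF _ this] show ?case by (simp add: algebra_simps)
qed simp

text \<open>While a bracket is open the guard holds whatever symbol was moved last, so the values
  inside a list follow one another without further conditions. An inner list is processed at depth
  \<open>Suc d\<close>.\<close>

lemma take_val_nested:
  assumes "runs (take_val i j k) (tv_state s u (rev (enc v) @ w) d) s' T" "d > 0"
  shows "runs (take_val i j k) (tv_state s (enc v @ u) w d) s' (9 * length (enc v) + T)"
  using assms
proof (induction v arbitrary: w d T u)
  case (Num n)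
  then show ?case by (intro take_val_Num) auto
next
  case (Lst vs)
  let ?c = "concat (map enc vs)"
  have "runs (take_val i j k) (tv_state s (5 # u) (rev ?c @ 4 # w) (Suc d)) s' (9 + T)"
    using Lst.prems by (intro take_val_step) auto
  then have "runs (take_val i j k) (tv_state s (?c @ 5 # u) (4 # w) (Suc d)) s' (9 * length ?c + (9 + T))"
    using Lst.IH by (intro take_vals_nested) auto
  then have "runs (take_val i j k) (tv_state s (4 # ?c @ 5 # u) w d) s' (9 + (9 * length ?c + (9 + T)))"
    using Lst.prems by (intro take_val_step) auto
  then show ?case by (simp add: algebra_simps)
qed

lemma take_val_correct: "runs (take_val i j k) (tv_state s (enc v @ u) [] 0)
    (tv_state s u (rev (enc v)) 0) (9 * length (enc v) + 1)"
proof (cases v)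
  case (Num n)
  have "runs (take_val i j k) (tv_state s u (rev (enc v)) 0) (tv_state s u (rev (enc v)) 0) 1"
    unfolding take_val_def
    by (rule runs_WhileF) (use Num distinct in \<open>auto simp: tv_state_def enc_nat_def\<close>)
  then show ?thesis unfolding Num by (intro take_val_Num) simp_all
next
  case (Lst vs)
  let ?c = "concat (map enc vs)" and ?s' = "tv_state s u (rev (enc v)) 0"
  have "runs (take_val i j k) (tv_state s u (rev (enc v)) 0) ?s' 1"
    unfolding take_val_def
    by (rule runs_WhileF) (use Lst distinct in \<open>auto simp: tv_state_def\<close>)
  then have "runs (take_val i j k) (tv_state s (5 # u) (rev ?c @ [4]) 1) ?s' (9 + 1)"
    using Lst by (intro take_val_step) auto
  then have "runs (take_val i j k) (tv_state s (?c @ 5 # u) [4] 1) ?s' (9 * length ?c + (9 + 1))"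
    by (intro take_vals_nested take_val_nested) auto
  then have "runs (take_val i j k) (tv_state s (4 # ?c @ 5 # u) [] 0) ?s' (9 + (9 * length ?c + (9 + 1)))"
    by (intro take_val_step) auto
  then show ?thesis using Lst by (simp add: algebra_simps)
qed

end

lemma runs_take_val:
  assumes "i \<noteq> j" "i \<noteq> k" "j \<noteq> k" "s i = enc v @ u" "s j = []" "s k = []"
    "s' = s(i := u, j := rev (enc v))"
  shows "runs (take_val i j k) s s' (9 * length (enc v) + 1)"
proof -
  have "tv_state i j k s (enc v @ u) [] 0 = s" "tv_state i j k s u (rev (enc v)) 0 = s'"
    using assms by (auto simp: tv_state_def[OF assms(1-3)] intro!: ext)
  then show ?thesis using take_val_correct[OF assms(1-3), of s v u] by simp
qed

section \<open>Polynomial-time functions\<close>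

text \<open>A context lists the values that a function of an abstract environment may read. A program
  for \<open>F\<close> finds the values of the context in registers below \<open>n\<close> and leaves \<open>F\<close> in register \<open>n\<close>,
  using the initially empty registers from \<open>n\<close> on as scratch space; its running time depends
  only on the size of the context.\<close>

type_synonym 'e ctxt = "('e \<Rightarrow> val) list"

definition csize :: "'e ctxt \<Rightarrow> 'e \<Rightarrow> nat" where
  "csize S e = (\<Sum>g\<leftarrow>S. length (enc (g e)))"

definition loaded :: "'e ctxt \<Rightarrow> (nat \<Rightarrow> nat) \<Rightarrow> nat \<Rightarrow> 'e \<Rightarrow> store \<Rightarrow> bool" where
  "loaded S loc n e s \<longleftrightarrow> (\<forall>j<length S. s (loc j) = enc ((S ! j) e)) \<and> (\<forall>i\<ge>n. s i = [])"

definition located :: "'e ctxt \<Rightarrow> (nat \<Rightarrow> nat) \<Rightarrow> nat \<Rightarrow> bool" where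
  "located S loc n \<longleftrightarrow> (\<forall>j<length S. loc j < n)"

definition computes :: "'e ctxt \<Rightarrow> (nat \<Rightarrow> nat) \<Rightarrow> nat \<Rightarrow> ('e \<Rightarrow> val) \<Rightarrow> com \<Rightarrow> (nat \<Rightarrow> nat) \<Rightarrow> bool" where
  "computes S loc n F c T \<longleftrightarrow> prog c \<and> polyb T \<and>
     (\<forall>e s. loaded S loc n e s \<longrightarrow> runs c s (s(n := enc (F e))) (T (csize S e)))"

text \<open>Quantifying over the base register and the placement of the context makes programs
  relocatable: a subprogram can run above the results of its predecessors.\<close>

definition ptime :: "'e ctxt \<Rightarrow> ('e \<Rightarrow> val) \<Rightarrow> bool" where
  "ptime S F \<longleftrightarrow> (\<forall>n loc. located S loc n \<longrightarrow> (\<exists>c T. computes S loc n F c T))"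

definition bounded_by_ctxt :: "'e ctxt \<Rightarrow> ('e \<Rightarrow> nat) \<Rightarrow> bool" where
  "bounded_by_ctxt S h \<longleftrightarrow> (\<exists>T. polyb T \<and> (\<forall>e. h e \<le> T (csize S e)))"

lemma ptimeI:
  assumes "\<And>n loc. located S loc n \<Longrightarrow> \<exists>c T. computes S loc n F c T"
  shows "ptime S F"
  using assms by (simp add: ptime_def)

lemma ptimeE:
  assumes "ptime S F" "located S loc n"
  obtains c T where "prog c" "polyb T"
    "\<And>e s s'. loaded S loc n e s \<Longrightarrow> s' = s(n := enc (F e)) \<Longrightarrow> runs c s s' (T (csize S e))"
proof -
  obtain c T where "computes S loc n F c T" using assms unfolding ptime_def by blast
  then show thesis by (intro that[of c T]) (auto simp: computes_def)
qed

lemma computesI: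
  assumes "prog c" "polyb T" "\<And>e s. loaded S loc n e s \<Longrightarrow> runs c s (s(n := enc (F e))) (T (csize S e))"
  shows "\<exists>c T. computes S loc n F c T"
  using assms by (auto simp: computes_def)

lemma loaded_empty: "loaded S loc n e s \<Longrightarrow> i \<ge> n \<Longrightarrow> s i = []"
  by (simp add: loaded_def)

lemma loaded_upd:
  assumes "loaded S loc n e s" "located S loc n"
  shows "loaded S loc (Suc n) e (s(n := w))"
  using assms by (auto simp: loaded_def located_def)

lemma located_Suc: "located S loc n \<Longrightarrow> located S loc (Suc n)"
  by (auto simp: located_def less_Suc_eq)

text \<open>A program cannot write more symbols than it takes steps.\<close>

lemma ptime_bounded:
  assumes "ptime S F" shows "bounded_by_ctxt S (\<lambda>e. length (enc (F e)))"
proof -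
  have "located S id (length S)" by (simp add: located_def)
  from ptimeE[OF assms this] obtain c T where T: "polyb T"
    "\<And>e s s'. loaded S id (length S) e s \<Longrightarrow> s' = s(length S := enc (F e)) \<Longrightarrow> runs c s s' (T (csize S e))"
    by metis
  have "length (enc (F e)) \<le> T (csize S e)" for e
  proof -
    let ?s = "\<lambda>j. if j < length S then enc ((S ! j) e) else []"
    have "runs c ?s (?s(length S := enc (F e))) (T (csize S e))"
      by (rule T(2)) (auto simp: loaded_def)
    then obtain t where "t \<le> T (csize S e)" "exec c ?s t (?s(length S := enc (F e)))"
      by (auto simp: runs_def)
    from exec_length[OF this(2), of "length S"] this(1) show ?thesis by simp
  qed
  then show ?thesis using T(1) by (auto simp: bounded_by_ctxt_def)
qed

lemma bounded_const: "bounded_by_ctxt S (\<lambda>e. k)"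
  unfolding bounded_by_ctxt_def by (rule exI[of _ "\<lambda>_. k"]) simp

lemma bounded_add:
  assumes "bounded_by_ctxt S g" "bounded_by_ctxt S h"
  shows "bounded_by_ctxt S (\<lambda>e. g e + h e)"
proof -
  obtain T U where "polyb T" "\<forall>e. g e \<le> T (csize S e)" "polyb U" "\<forall>e. h e \<le> U (csize S e)"
    using assms unfolding bounded_by_ctxt_def by blast
  then show ?thesis unfolding bounded_by_ctxt_def
    by (intro exI[of _ "\<lambda>n. T n + U n"]) (auto intro: add_mono)
qed

lemma ptime_var:
  assumes "F \<in> set S" shows "ptime S F"
proof (rule ptimeI)
  fix n loc assume loc: "located S loc n"
  obtain j where j: "j < length S" "S ! j = F" using assms by (auto simp: in_set_conv_nth)
  show "\<exists>c T. computes S loc n F c T"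
  proof (rule computesI)
    show "prog (dup (loc j) (Suc n) n)" "polyb (\<lambda>m. 13 * m + 3)" by auto
    fix e s assume l: "loaded S loc n e s"
    have s: "s (loc j) = enc (F e)" "s n = []" "s (Suc n) = []" "loc j < n"
      using l j loc by (auto simp: loaded_def located_def)
    have "length (enc (F e)) \<le> csize S e"
      unfolding csize_def using assms by (intro member_le_sum_list) auto
    moreover have "runs (dup (loc j) (Suc n) n) s (s(n := enc (F e))) (13 * length (s (loc j)) + 3)"
      using s enc_symbols by (intro runs_dup) auto
    ultimately show "runs (dup (loc j) (Suc n) n) s (s(n := enc (F e))) (13 * csize S e + 3)"
      using s by (elim runs_mono) auto
  qed
qed

lemma ptime_const: "ptime S (\<lambda>e. v)"
proof (rule ptimeI)
  fix n loc assume loc: "located S loc n"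
  show "\<exists>c T. computes S loc n (\<lambda>e. v) c T"
  proof (rule computesI)
    show "prog (pushw n (enc v))" "polyb (\<lambda>m. 3 * length (enc v) + 1)" by auto
    fix e s assume l: "loaded S loc n e s"
    show "runs (pushw n (enc v)) s (s(n := enc v)) (3 * length (enc v) + 1)"
      using loaded_empty[OF l, of n] enc_symbols by (intro runs_pushw) auto
  qed
qed

text \<open>Bound variables: the body of a map, filter or fold depends on the outer environment and
  on one more value, which is paired with it and whose encoder is appended to the context.\<close>

definition lift :: "'e ctxt \<Rightarrow> ('x \<Rightarrow> val) \<Rightarrow> ('e \<times> 'x) ctxt" where
  "lift S ex = map (\<lambda>g z. g (fst z)) S @ [\<lambda>z. ex (snd z)]"

lemma csize_lift: "csize (lift S ex) z = csize S (fst z) + length (enc (ex (snd z)))"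
  by (simp add: csize_def lift_def comp_def)

lemma ptime_new: "ptime (lift S ex) (\<lambda>z. ex (snd z))"
  by (rule ptime_var) (simp add: lift_def)

text \<open>Weakening and exchange for contexts. The program stays the same and only the register
  map is composed with \<open>\<pi>\<close>; as the new context is at least as large, the old time
  bound, being monotone, still holds.\<close>

lemma ptime_reindex:
  assumes "ptime S F"
    and \<pi>: "\<And>j. j < length S \<Longrightarrow> \<pi> j < length S' \<and> (\<forall>z. (S' ! \<pi> j) z = (S ! j) (\<rho> z))"
    and size: "\<And>z. csize S (\<rho> z) \<le> csize S' z"
  shows "ptime S' (\<lambda>z. F (\<rho> z))"
proof (rule ptimeI)
  fix n loc assume loc: "located S' loc n"
  then have "located S (loc \<circ> \<pi>) n" using \<pi> by (auto simp: located_def)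
  from ptimeE[OF assms(1) this] obtain c T where c: "prog c" "polyb T"
    "\<And>e s s'. loaded S (loc \<circ> \<pi>) n e s \<Longrightarrow> s' = s(n := enc (F e)) \<Longrightarrow> runs c s s' (T (csize S e))" by metis
  show "\<exists>c T. computes S' loc n (\<lambda>z. F (\<rho> z)) c T"
  proof (rule computesI[OF c(1,2)])
    fix z s assume l: "loaded S' loc n z s"
    have "loaded S (loc \<circ> \<pi>) n (\<rho> z) s"
      using l \<pi> by (auto simp: loaded_def)
    from c(3)[OF this refl] show "runs c s (s(n := enc (F (\<rho> z)))) (T (csize S' z))"
      by (rule runs_mono) (intro polyb_mono[OF c(2)] size)
  qed
qed

lemma ptime_lift:
  assumes "ptime S F" shows "ptime (lift S ex) (\<lambda>z. F (fst z))"
  by (rule ptime_reindex[OF assms, of id]) (auto simp: csize_lift, auto simp: lift_def nth_append)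

text \<open>In a fold the accumulator stands between the environment and the element. This rule
  carries a function of environment and element over to that context.\<close>

lemma ptime_lift_mid:
  assumes "ptime (lift S ex) F" shows "ptime (lift (lift S ea) ex) (\<lambda>z. F (fst (fst z), snd z))"
  by (rule ptime_reindex[OF assms, of "\<lambda>j. if j = length S then Suc j else j"])
    (auto simp: csize_lift, auto simp: lift_def nth_append less_Suc_eq)

text \<open>The codes \<open>[4, 5]\<close> and \<open>[3]\<close> differ in the first symbol, so a
  branch has to look at one top only.\<close>

fun VB :: "bool \<Rightarrow> val" where
  "VB True = Lst []" | "VB False = Num 0"

lemma enc_VB: "enc (VB True) = [4, 5]" "enc (VB False) = [3]"
  by (auto simp: enc_nat_def binary.simps)

lemma ptime_if:
  assumes "ptime S (\<lambda>e. VB (b e))" "ptime S F" "ptime S G"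
  shows "ptime S (\<lambda>e. if b e then F e else G e)"
proof (rule ptimeI)
  fix n loc assume loc: "located S loc n"
  obtain c1 T1 where c1: "prog c1" "polyb T1"
    "\<And>e s s'. loaded S loc n e s \<Longrightarrow> s' = s(n := enc (VB (b e))) \<Longrightarrow> runs c1 s s' (T1 (csize S e))"
    using ptimeE[OF assms(1) loc] by metis
  obtain c2 T2 where c2: "prog c2" "polyb T2"
    "\<And>e s s'. loaded S loc n e s \<Longrightarrow> s' = s(n := enc (F e)) \<Longrightarrow> runs c2 s s' (T2 (csize S e))"
    using ptimeE[OF assms(2) loc] by metis
  obtain c3 T3 where c3: "prog c3" "polyb T3"
    "\<And>e s s'. loaded S loc n e s \<Longrightarrow> s' = s(n := enc (G e)) \<Longrightarrow> runs c3 s s' (T3 (csize S e))"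
    using ptimeE[OF assms(3) loc] by metis
  \<comment> \<open>Either branch expects register \<open>n\<close> empty, so the truth value is
    popped first: two symbols if true, one if false.\<close>
  let ?c = "Seq c1 (Cond (\<lambda>h. h n = 4) (Seq (Pop n) (Seq (Pop n) c2)) (Seq (Pop n) c3))"
  show "\<exists>c T. computes S loc n (\<lambda>e. if b e then F e else G e) c T"
  proof (rule computesI)
    show "prog ?c" using c1 c2 c3 by simp
    show "polyb (\<lambda>m. T1 m + T2 m + T3 m + 10)" using c1 c2 c3 by auto
    fix e s assume l: "loaded S loc n e s"
    let ?s' = "s(n := enc (if b e then F e else G e))"
    have sn: "s n = []" using loaded_empty[OF l] by simp
    have 1: "runs c1 s (s(n := enc (VB (b e)))) (T1 (csize S e))" by (rule c1(3)[OF l refl])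
    have 2: "runs (Cond (\<lambda>h. h n = 4) (Seq (Pop n) (Seq (Pop n) c2)) (Seq (Pop n) c3))
      (s(n := enc (VB (b e)))) ?s' (T2 (csize S e) + T3 (csize S e) + 9)"
    proof (cases "b e")
      case True
      have "runs (Seq (Pop n) (Seq (Pop n) c2)) (s(n := [4, 5])) ?s' (Suc (1 + Suc (1 + T2 (csize S e))))"
        using True sn l
        by (intro runs_Seq[OF runs_Pop[OF refl]] c2(3)) (simp_all add: fun_upd_idem)
      then have "runs (Cond (\<lambda>h. h n = 4) (Seq (Pop n) (Seq (Pop n) c2)) (Seq (Pop n) c3))
        (s(n := enc (VB (b e)))) ?s' (Suc (Suc (1 + Suc (1 + T2 (csize S e)))))"
        using True by (intro runs_CondT) (simp_all only: enc_VB, simp)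
      then show ?thesis by (elim runs_mono) simp
    next
      case False
      have "runs (Seq (Pop n) c3) (s(n := [3])) ?s' (Suc (1 + T3 (csize S e)))"
        using False sn l
        by (intro runs_Seq[OF runs_Pop[OF refl]] c3(3)) (simp_all add: fun_upd_idem)
      then have "runs (Cond (\<lambda>h. h n = 4) (Seq (Pop n) (Seq (Pop n) c2)) (Seq (Pop n) c3))
        (s(n := enc (VB (b e)))) ?s' (Suc (Suc (1 + T3 (csize S e))))"
        using False by (intro runs_CondF) (simp_all only: enc_VB, simp)
      then show ?thesis by (elim runs_mono) simp
    qed
    show "runs ?c s ?s' (T1 (csize S e) + T2 (csize S e) + T3 (csize S e) + 10)"
      using runs_Seq[OF 1 2] by (elim runs_mono) simp
  qed
qed

definition eq_loop :: "nat \<Rightarrow> nat \<Rightarrow> com" where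
  "eq_loop i j = While (\<lambda>h. h i \<noteq> 0 \<and> h i = h j) (Seq (Pop i) (Pop j))"

text \<open>Removing the longest common prefix leaves two empty stacks exactly when the words agree.
  Together with \<open>enc_inj\<close> this decides equality of values.\<close>

lemma runs_eq_loop:
  assumes "i \<noteq> j" "0 \<notin> set u" "0 \<notin> set v"
  shows "\<exists>u' v'. runs (eq_loop i j) (s(i := u, j := v)) (s(i := u', j := v')) (4 * length u + 1) \<and>
    set u' \<subseteq> set u \<and> set v' \<subseteq> set v \<and> length u' \<le> length u \<and> length v' \<le> length v \<and>
    (u' = [] \<and> v' = [] \<longleftrightarrow> u = v)"
  using assms
proof (induction u arbitrary: v)
  case Nil
  have "runs (eq_loop i j) (s(i := [], j := v)) (s(i := [], j := v)) 1"
    unfolding eq_loop_def by (rule runs_WhileF) (use assms in auto)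
  then have "runs (eq_loop i j) (s(i := [], j := v)) (s(i := [], j := v)) (4 * length [] + 1)"
    by (rule runs_mono) simp
  then show ?case
    by (intro exI conjI) (assumption, auto)
next
  case (Cons a u)
  show ?case
  proof (cases "\<exists>w. v = a # w")
    case False
    have "runs (eq_loop i j) (s(i := a # u, j := v)) (s(i := a # u, j := v)) 1"
      unfolding eq_loop_def by (rule runs_WhileF) (use Cons.prems False in \<open>cases v; auto simp: tops_def\<close>)
    then have "runs (eq_loop i j) (s(i := a # u, j := v)) (s(i := a # u, j := v)) (4 * length (a # u) + 1)"
      by (elim runs_mono) simp
    moreover have "a # u \<noteq> v" using False by blast
    ultimately show ?thesis by (intro exI conjI) (assumption, auto)
  next
    case True
    then obtain w where v: "v = a # w" by blast
    have nz: "0 \<notin> set u" "0 \<notin> set w" using Cons.prems v by auto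
    from Cons.IH[OF assms(1) nz] obtain u' w' where I: "runs (eq_loop i j) (s(i := u, j := w)) (s(i := u', j := w')) (4 * length u + 1)"
      "set u' \<subseteq> set u" "set w' \<subseteq> set w" "length u' \<le> length u" "length w' \<le> length w"
      "u' = [] \<and> w' = [] \<longleftrightarrow> u = w"
      by blast
    have "runs (Seq (Pop i) (Pop j)) (s(i := a # u, j := v)) (s(i := u, j := w)) (Suc (1 + 1))"
      using assms(1) v by (intro runs_Seq[OF runs_Pop[OF refl] runs_Pop] ext) simp
    then have "runs (eq_loop i j) (s(i := a # u, j := v)) (s(i := u', j := w')) (Suc (Suc (1 + 1) + (4 * length u + 1)))"
      unfolding eq_loop_def
      by (rule runs_WhileT[rotated, OF _ I(1)[unfolded eq_loop_def]])
        (use Cons.prems v in \<open>simp add: tops_def\<close>)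
    then have "runs (eq_loop i j) (s(i := a # u, j := v)) (s(i := u', j := w')) (4 * length (a # u) + 1)"
      by (elim runs_mono) simp
    then show ?thesis by (intro exI conjI) (assumption, use I(2-) v in auto)
  qed
qed

lemma ptime_eq:
  assumes "ptime S F" "ptime S G"
  shows "ptime S (\<lambda>e. VB (F e = G e))"
proof (rule ptimeI)
  fix n loc assume loc: "located S loc n"
  obtain c1 T1 where c1: "prog c1" "polyb T1"
    "\<And>e s s'. loaded S loc n e s \<Longrightarrow> s' = s(n := enc (F e)) \<Longrightarrow> runs c1 s s' (T1 (csize S e))"
    using ptimeE[OF assms(1) loc] by metis
  obtain c2 T2 where c2: "prog c2" "polyb T2"
    "\<And>e s s'. loaded S loc (Suc n) e s \<Longrightarrow> s' = s(Suc n := enc (G e)) \<Longrightarrow> runs c2 s s' (T2 (csize S e))"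
    using ptimeE[OF assms(2) located_Suc[OF loc]] by metis
  obtain TF where TF: "polyb TF" "\<And>e. length (enc (F e)) \<le> TF (csize S e)"
    using ptime_bounded[OF assms(1)] unfolding bounded_by_ctxt_def by blast
  obtain TG where TG: "polyb TG" "\<And>e. length (enc (G e)) \<le> TG (csize S e)"
    using ptime_bounded[OF assms(2)] unfolding bounded_by_ctxt_def by blast
  let ?d = "Cond (\<lambda>h. h n = 0 \<and> h (Suc n) = 0) (pushw n (enc (VB True)))
      (Seq (clear n) (Seq (clear (Suc n)) (pushw n (enc (VB False)))))"
  let ?c = "Seq c1 (Seq c2 (Seq (eq_loop n (Suc n)) ?d))"
  show "\<exists>c T. computes S loc n (\<lambda>e. VB (F e = G e)) c T"
  proof (rule computesI)
    show "prog ?c" using c1 c2 by (simp add: eq_loop_def)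
    show "polyb (\<lambda>m. T1 m + T2 m + 6 * TF m + 2 * TG m + 20)" using c1 c2 TF TG by auto
    fix e s assume l: "loaded S loc n e s"
    let ?m = "csize S e" and ?s' = "s(n := enc (VB (F e = G e)))"
    have sn: "s n = []" "s (Suc n) = []" using loaded_empty[OF l] by auto
    have 1: "runs c1 s (s(n := enc (F e))) (T1 ?m)" by (rule c1(3)[OF l refl])
    have 2: "runs c2 (s(n := enc (F e))) (s(n := enc (F e), Suc n := enc (G e))) (T2 ?m)"
      by (rule c2(3)[OF loaded_upd[OF l loc] refl])
    have z: "0 \<notin> set (enc v)" for v using enc_symbols[of v] by auto
    obtain u' v' where u: "runs (eq_loop n (Suc n)) (s(n := enc (F e), Suc n := enc (G e)))
        (s(n := u', Suc n := v')) (4 * length (enc (F e)) + 1)"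
      "set u' \<subseteq> set (enc (F e))" "set v' \<subseteq> set (enc (G e))"
      "length u' \<le> length (enc (F e))" "length v' \<le> length (enc (G e))"
      "u' = [] \<and> v' = [] \<longleftrightarrow> F e = G e"
      using runs_eq_loop[of n "Suc n" "enc (F e)" "enc (G e)" s] z enc_inj by auto
    have sub: "set u' \<subseteq> {1..5}" "set v' \<subseteq> {1..5}" using u enc_symbols by blast+
    have 3: "runs ?d (s(n := u', Suc n := v')) ?s' (2 * length u' + 2 * length v' + 9)"
    proof (cases "F e = G e")
      case True
      then have "runs ?d (s(n := u', Suc n := v')) ?s' (Suc (3 * length (enc (VB True)) + 1))"
        using u(6) sn enc_symbols[of "VB True"] by (intro runs_CondT runs_pushw) (auto simp: fun_upd_idem)
      then show ?thesis by (elim runs_mono) simp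
    next
      case False
      have "u' \<noteq> [] \<or> v' \<noteq> []" using u(6) False by blast
      then have h: "\<not> (tops (s(n := u', Suc n := v')) n = 0 \<and> tops (s(n := u', Suc n := v')) (Suc n) = 0)"
        using sub by (cases u'; cases v') (auto simp: tops_def)
      have a: "runs (clear n) (s(n := u', Suc n := v')) (s(Suc n := v')) (2 * length u' + 1)"
      proof -
        have "s(Suc n := v') = (s(n := u', Suc n := v'))(n := [])"
          by (rule ext) (use sn in simp)
        from runs_clear[OF _ this] show ?thesis using sub by simp
      qed
      have b: "runs (clear (Suc n)) (s(Suc n := v')) s (2 * length v' + 1)"
      proof -
        have "s = (s(Suc n := v'))(Suc n := [])" by (rule ext) (use sn in simp)
        from runs_clear[OF _ this] show ?thesis using sub by simp
      qed
      have c: "runs (pushw n (enc (VB False))) s ?s' (3 * length (enc (VB False)) + 1)"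
        using False sn enc_symbols[of "VB False"] by (intro runs_pushw) (auto simp del: enc.simps)
      have "runs ?d (s(n := u', Suc n := v')) ?s' (Suc (Suc ((2 * length u' + 1) + Suc ((2 * length v' + 1) +
          (3 * length (enc (VB False)) + 1)))))"
        using h by (intro runs_CondF runs_Seq[OF a runs_Seq[OF b c]])
      then show ?thesis by (elim runs_mono) (simp add: enc_nat_def binary.simps)
    qed
    show "runs ?c s ?s' (T1 ?m + T2 ?m + 6 * TF ?m + 2 * TG ?m + 20)"
      using runs_Seq[OF 1 runs_Seq[OF 2 runs_Seq[OF u(1) 3]]] u(4,5) TF(2)[of e] TG(2)[of e]
      by (elim runs_mono) simp
  qed
qed

lemma ptime_snoc:
  assumes "ptime S (\<lambda>e. Lst (vs e))" "ptime S F"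
  shows "ptime S (\<lambda>e. Lst (vs e @ [F e]))"
proof (rule ptimeI)
  fix n loc assume loc: "located S loc n"
  obtain c1 T1 where c1: "prog c1" "polyb T1"
    "\<And>e s s'. loaded S loc n e s \<Longrightarrow> s' = s(n := enc (Lst (vs e))) \<Longrightarrow> runs c1 s s' (T1 (csize S e))"
    using ptimeE[OF assms(1) loc] by metis
  obtain c2 T2 where c2: "prog c2" "polyb T2"
    "\<And>e s s'. loaded S loc (Suc n) e s \<Longrightarrow> s' = s(Suc n := enc (F e)) \<Longrightarrow> runs c2 s s' (T2 (csize S e))"
    using ptimeE[OF assms(2) located_Suc[OF loc]] by metis
  obtain TL where TL: "polyb TL" "\<And>e. length (enc (Lst (vs e))) \<le> TL (csize S e)"
    using ptime_bounded[OF assms(1)] unfolding bounded_by_ctxt_def by blast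
  obtain TF where TF: "polyb TF" "\<And>e. length (enc (F e)) \<le> TF (csize S e)"
    using ptime_bounded[OF assms(2)] unfolding bounded_by_ctxt_def by blast
  let ?c = "Seq c1 (Seq c2 (Seq (xfer n (n + 2)) (Seq (Pop (n + 2)) (Seq (xfer (Suc n) (n + 3))
    (Seq (pushw n [5]) (Seq (xfer (n + 3) n) (xfer (n + 2) n)))))))"
  show "\<exists>c T. computes S loc n (\<lambda>e. Lst (vs e @ [F e])) c T"
  proof (rule computesI)
    show "prog ?c" using c1 c2 by simp
    show "polyb (\<lambda>m. T1 m + T2 m + 10 * TL m + 10 * TF m + 40)" using c1 c2 TF TL by auto
    fix e s assume l: "loaded S loc n e s"
    let ?m = "csize S e" and ?b = "concat (map enc (vs e))" and ?x = "enc (F e)"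
    let ?s' = "s(n := enc (Lst (vs e @ [F e])))"
    have sn: "s n = []" "s (Suc n) = []" "s (n + 2) = []" "s (n + 3) = []"
      using loaded_empty[OF l] by auto
    have sym: "set ?b \<subseteq> {1..5}" "set ?x \<subseteq> {1..5}" "\<And>v. set (enc v) \<subseteq> {1..5}"
      using enc_symbols enc_symbols[of "Lst (vs e)"] by auto
    have 1: "runs c1 s (s(n := enc (Lst (vs e)))) (T1 ?m)" by (rule c1(3)[OF l refl])
    have 2: "runs c2 (s(n := enc (Lst (vs e)))) (s(n := enc (Lst (vs e)), Suc n := ?x)) (T2 ?m)"
      by (rule c2(3)[OF loaded_upd[OF l loc] refl])
    have 3: "runs (xfer n (n + 2)) (s(n := enc (Lst (vs e)), Suc n := ?x))
        (s(Suc n := ?x, n + 2 := 5 # rev ?b @ [4])) (5 * length (4 # ?b @ [5]) + 1)"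
      using runs_xfer[of n "n + 2" "s(n := enc (Lst (vs e)), Suc n := ?x)"
         "s(Suc n := ?x, n + 2 := 5 # rev ?b @ [4])"] sym sn
      by (simp add: fun_eq_iff)
    have 4: "runs (Pop (n + 2)) (s(Suc n := ?x, n + 2 := 5 # rev ?b @ [4]))
        (s(Suc n := ?x, n + 2 := rev ?b @ [4])) 1"
      by (intro runs_Pop) simp
    have 5: "runs (xfer (Suc n) (n + 3)) (s(Suc n := ?x, n + 2 := rev ?b @ [4]))
        (s(n + 2 := rev ?b @ [4], n + 3 := rev ?x)) (5 * length ?x + 1)"
      using runs_xfer[of "Suc n" "n + 3" "s(Suc n := ?x, n + 2 := rev ?b @ [4])"
         "s(n + 2 := rev ?b @ [4], n + 3 := rev ?x)"] sym sn
      by (simp add: fun_eq_iff)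
    have 6: "runs (pushw n [5]) (s(n + 2 := rev ?b @ [4], n + 3 := rev ?x))
        (s(n := [5], n + 2 := rev ?b @ [4], n + 3 := rev ?x)) (3 * length [5::nat] + 1)"
      using sn by (intro runs_pushw) (simp_all add: fun_eq_iff)
    have 7: "runs (xfer (n + 3) n) (s(n := [5], n + 2 := rev ?b @ [4], n + 3 := rev ?x))
        (s(n := ?x @ [5], n + 2 := rev ?b @ [4])) (5 * length ?x + 1)"
      using runs_xfer[of "n + 3" n "s(n := [5], n + 2 := rev ?b @ [4], n + 3 := rev ?x)"
         "s(n := ?x @ [5], n + 2 := rev ?b @ [4])"] sym sn
      by (simp add: fun_eq_iff)
    have 8: "runs (xfer (n + 2) n) (s(n := ?x @ [5], n + 2 := rev ?b @ [4])) ?s'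
        (5 * (length ?b + 1) + 1)"
      using runs_xfer[of "n + 2" n "s(n := ?x @ [5], n + 2 := rev ?b @ [4])" ?s'] sym sn
      by (simp add: fun_eq_iff)
    note r = runs_Seq[OF 1 runs_Seq[OF 2 runs_Seq[OF 3 runs_Seq[OF 4 runs_Seq[OF 5 runs_Seq[OF 6
      runs_Seq[OF 7 8]]]]]]]
    show "runs ?c s ?s' (T1 ?m + T2 ?m + 10 * TL ?m + 10 * TF ?m + 40)"
      using TL(2)[of e] TF(2)[of e] by (intro runs_mono[OF r]) simp
  qed
qed

section \<open>Taking lists apart\<close>

definition hd_val :: "val list \<Rightarrow> val" where
  "hd_val vs = (case vs of [] \<Rightarrow> Num 0 | v # _ \<Rightarrow> v)"

lemma runs_take_first:
  assumes "s n = []" "s (Suc n) = []" "s (n + 2) = []"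
  shows "runs (take_val n (Suc n) (n + 2)) (s(n := enc v @ u)) (s(n := u, Suc n := rev (enc v)))
    (9 * length (enc v) + 1)"
  using assms by (intro runs_take_val) (simp_all add: fun_eq_iff)

lemma top_body: "tops (s(n := concat (map enc vs) @ [5])) n = 5 \<longleftrightarrow> vs = []"
proof (cases vs)
  case (Cons v ws)
  then show ?thesis
    using hd_enc[of v "concat (map enc ws) @ [5]"] enc_nonempty[of v]
    by (cases "enc v") (auto simp: tops_def)
qed simp

lemma ptime_hd:
  assumes "ptime S (\<lambda>e. Lst (vs e))"
  shows "ptime S (\<lambda>e. hd_val (vs e))"
proof (rule ptimeI)
  fix n loc assume loc: "located S loc n"
  obtain c1 T1 where c1: "prog c1" "polyb T1"
    "\<And>e s s'. loaded S loc n e s \<Longrightarrow> s' = s(n := enc (Lst (vs e))) \<Longrightarrow> runs c1 s s' (T1 (csize S e))"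
    using ptimeE[OF assms(1) loc] by metis
  obtain TL where TL: "polyb TL" "\<And>e. length (enc (Lst (vs e))) \<le> TL (csize S e)"
    using ptime_bounded[OF assms(1)] unfolding bounded_by_ctxt_def by blast
  let ?d = "Cond (\<lambda>h. h n = 5) (Seq (Pop n) (pushw n (enc (Num 0))))
    (Seq (take_val n (Suc n) (n + 2)) (Seq (clear n) (xfer (Suc n) n)))"
  let ?c = "Seq c1 (Seq (Pop n) ?d)"
  show "\<exists>c T. computes S loc n (\<lambda>e. hd_val (vs e)) c T"
  proof (rule computesI)
    show "prog ?c" using c1 by simp
    show "polyb (\<lambda>m. T1 m + 20 * TL m + 20)" using c1 TL by auto
    fix e s assume l: "loaded S loc n e s"
    let ?m = "csize S e" and ?b = "concat (map enc (vs e))"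
    let ?s' = "s(n := enc (hd_val (vs e)))"
    have sn: "s n = []" "s (Suc n) = []" "s (n + 2) = []" using loaded_empty[OF l] by auto
    have 1: "runs c1 s (s(n := enc (Lst (vs e)))) (T1 ?m)" by (rule c1(3)[OF l refl])
    have 2: "runs (Pop n) (s(n := enc (Lst (vs e)))) (s(n := ?b @ [5])) 1"
      by (intro runs_Pop) simp
    have 3: "runs ?d (s(n := ?b @ [5])) ?s' (20 * TL ?m + 15)"
    proof (cases "vs e")
      case Nil
      have "runs (Seq (Pop n) (pushw n (enc (Num 0)))) (s(n := ?b @ [5])) ?s'
        (Suc (1 + (3 * length (enc (Num 0)) + 1)))"
        using Nil sn enc_symbols[of "Num 0"]
        by (intro runs_Seq[OF runs_Pop[OF refl] runs_pushw]) (simp_all add: hd_val_def fun_eq_iff)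
      then have "runs ?d (s(n := ?b @ [5])) ?s' (Suc (Suc (1 + (3 * length (enc (Num 0)) + 1))))"
        using Nil by (intro runs_CondT) (simp_all add: top_body)
      then show ?thesis by (elim runs_mono) (simp add: enc_nat_def binary.simps)
    next
      case (Cons v ws)
      let ?u = "concat (map enc ws) @ [5]"
      have b: "?b @ [5] = enc v @ ?u" using Cons by simp
      have s5: "set ?u \<subseteq> {1..5}" using enc_symbols[of "Lst ws"] by auto
      have a1: "runs (take_val n (Suc n) (n + 2)) (s(n := ?b @ [5]))
        (s(n := ?u, Suc n := rev (enc v))) (9 * length (enc v) + 1)"
        unfolding b by (rule runs_take_first) (use sn in simp_all)
      have a2: "runs (clear n) (s(n := ?u, Suc n := rev (enc v))) (s(Suc n := rev (enc v)))
        (2 * length ?u + 1)"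
        using runs_clear[of "s(n := ?u, Suc n := rev (enc v))" n "s(Suc n := rev (enc v))"] s5 sn
        by (simp add: fun_eq_iff)
      have a3: "runs (xfer (Suc n) n) (s(Suc n := rev (enc v))) ?s' (5 * length (enc v) + 1)"
        using runs_xfer[of "Suc n" n "s(Suc n := rev (enc v))" ?s'] sn enc_symbols[of v] Cons
        by (simp add: fun_eq_iff hd_val_def)
      have "runs ?d (s(n := ?b @ [5])) ?s' (Suc (Suc ((9 * length (enc v) + 1) +
        Suc ((2 * length ?u + 1) + (5 * length (enc v) + 1)))))"
        using Cons by (intro runs_CondF[OF _ runs_Seq[OF a1 runs_Seq[OF a2 a3]]]) (simp only: top_body, simp)
      then show ?thesis using TL(2)[of e] Cons by (elim runs_mono) simp
    qed
    show "runs ?c s ?s' (T1 ?m + 20 * TL ?m + 20)"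
      by (intro runs_mono[OF runs_Seq[OF 1 runs_Seq[OF 2 3]]]) simp
  qed
qed

lemma ptime_tl:
  assumes "ptime S (\<lambda>e. Lst (vs e))"
  shows "ptime S (\<lambda>e. Lst (tl (vs e)))"
proof (rule ptimeI)
  fix n loc assume loc: "located S loc n"
  obtain c1 T1 where c1: "prog c1" "polyb T1"
    "\<And>e s s'. loaded S loc n e s \<Longrightarrow> s' = s(n := enc (Lst (vs e))) \<Longrightarrow> runs c1 s s' (T1 (csize S e))"
    using ptimeE[OF assms(1) loc] by metis
  obtain TL where TL: "polyb TL" "\<And>e. length (enc (Lst (vs e))) \<le> TL (csize S e)"
    using ptime_bounded[OF assms(1)] unfolding bounded_by_ctxt_def by blast
  let ?d = "Cond (\<lambda>h. h n = 5) nop (Seq (take_val n (Suc n) (n + 2)) (clear (Suc n)))"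
  let ?c = "Seq c1 (Seq (Pop n) (Seq ?d (pushw n [4])))"
  show "\<exists>c T. computes S loc n (\<lambda>e. Lst (tl (vs e))) c T"
  proof (rule computesI)
    show "prog ?c" using c1 by simp
    show "polyb (\<lambda>m. T1 m + 20 * TL m + 20)" using c1 TL by auto
    fix e s assume l: "loaded S loc n e s"
    let ?m = "csize S e" and ?b = "concat (map enc (vs e))" and ?u = "concat (map enc (tl (vs e))) @ [5]"
    let ?s' = "s(n := enc (Lst (tl (vs e))))"
    have sn: "s n = []" "s (Suc n) = []" "s (n + 2) = []" using loaded_empty[OF l] by auto
    have 1: "runs c1 s (s(n := enc (Lst (vs e)))) (T1 ?m)" by (rule c1(3)[OF l refl])
    have 2: "runs (Pop n) (s(n := enc (Lst (vs e)))) (s(n := ?b @ [5])) 1"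
      by (intro runs_Pop) simp
    have 3: "runs ?d (s(n := ?b @ [5])) (s(n := ?u)) (11 * TL ?m + 10)"
    proof (cases "vs e")
      case Nil
      then have "runs ?d (s(n := ?b @ [5])) (s(n := ?u)) (Suc 1)"
        using runs_nop by (intro runs_CondT) simp_all
      then show ?thesis by (elim runs_mono) simp
    next
      case (Cons v ws)
      have b: "?b @ [5] = enc v @ ?u" using Cons by simp
      have a1: "runs (take_val n (Suc n) (n + 2)) (s(n := ?b @ [5]))
        (s(n := ?u, Suc n := rev (enc v))) (9 * length (enc v) + 1)"
        unfolding b by (rule runs_take_first) (use sn in simp_all)
      have a2: "runs (clear (Suc n)) (s(n := ?u, Suc n := rev (enc v))) (s(n := ?u))
        (2 * length (enc v) + 1)"
        using runs_clear[of "s(n := ?u, Suc n := rev (enc v))" "Suc n" "s(n := ?u)"] enc_symbols[of v] sn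
        by (simp add: fun_eq_iff)
      have "runs ?d (s(n := ?b @ [5])) (s(n := ?u)) (Suc (Suc ((9 * length (enc v) + 1) +
        (2 * length (enc v) + 1))))"
        using Cons by (intro runs_CondF[OF _ runs_Seq[OF a1 a2]]) (simp only: top_body, simp)
      then show ?thesis using TL(2)[of e] Cons by (elim runs_mono) simp
    qed
    have 4: "runs (pushw n [4]) (s(n := ?u)) ?s' (3 * length [4::nat] + 1)"
      by (intro runs_pushw) (simp_all add: fun_eq_iff)
    show "runs ?c s ?s' (T1 ?m + 20 * TL ?m + 20)"
      by (intro runs_mono[OF runs_Seq[OF 1 runs_Seq[OF 2 runs_Seq[OF 3 4]]]]) simp
  qed
qed

section \<open>Folds with additive growth of the accumulator\<close>

definition fold_body :: "com \<Rightarrow> nat \<Rightarrow> com" where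
  "fold_body cB n = Seq (take_val n (n + 3) (n + 4)) (Seq (xfer (n + 3) (n + 2)) (Seq cB
     (Seq (clear (n + 1)) (Seq (clear (n + 2)) (Seq (xfer (n + 3) (n + 2)) (xfer (n + 2) (n + 1)))))))"

text \<open>Registers of a round: \<open>n\<close> has the unread part of the list,
  \<open>n + 1\<close> the accumulator, \<open>n + 2\<close> the current element, and the step
  leaves its result in \<open>n + 3\<close>. The accumulator precedes the element, as in
  \<open>lift (lift S ea) ex\<close>.\<close>

definition fold_loc :: "'e ctxt \<Rightarrow> (nat \<Rightarrow> nat) \<Rightarrow> nat \<Rightarrow> nat \<Rightarrow> nat" where
  "fold_loc S loc n j = (if j < length S then loc j else if j = length S then n + 1 else n + 2)"

lemma fold_located: "located S loc n \<Longrightarrow> located (lift (lift S ea) ex) (fold_loc S loc n) (n + 3)"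
  by (fastforce simp: located_def lift_def fold_loc_def)

lemma fold_loaded:
  assumes "loaded S loc n e s" "located S loc n"
  shows "loaded (lift (lift S ea) ex) (fold_loc S loc n) (n + 3) ((e, a), x)
    (s(n := u, n + 1 := enc (ea a), n + 2 := enc (ex x)))" (is "loaded ?S _ _ _ ?s")
proof -
  have "?s (fold_loc S loc n j) = enc ((?S ! j) ((e, a), x))" if "j < length S + 2" for j
  proof -
    consider "j < length S" | "j = length S" | "j = Suc (length S)" using \<open>j < length S + 2\<close> by linarith
    then show ?thesis
    proof cases
      case 1
      then have "loc j < n" "s (loc j) = enc ((S ! j) e)"
        using assms by (auto simp: loaded_def located_def)
      then show ?thesis using 1 by (simp add: fold_loc_def lift_def nth_append)
    qed (simp_all add: fold_loc_def lift_def nth_append)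
  qed
  then show ?thesis using assms(1) by (simp add: loaded_def lift_def)
qed

lemma runs_fold_body:
  fixes S :: "'e ctxt" and ea :: "'a \<Rightarrow> val" and ex :: "'x \<Rightarrow> val"
  assumes l: "loaded S loc n e s" and loc: "located S loc n"
    and cB: "\<And>z s s'. loaded (lift (lift S ea) ex) (fold_loc S loc n) (n + 3) z s \<Longrightarrow>
      s' = s(n + 3 := enc (ea (B (fst (fst z)) (snd (fst z)) (snd z)))) \<Longrightarrow>
      runs cB s s' (TB (csize (lift (lift S ea) ex) z))"
    and TB: "polyb TB"
    and bounds: "length (enc (ex x)) \<le> X" "length (enc (ea a)) \<le> A" "length (enc (ea (B e a x))) \<le> A"
  shows "runs (fold_body cB n) (s(n := enc (ex x) @ u, n + 1 := enc (ea a)))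
    (s(n := u, n + 1 := enc (ea (B e a x)))) (16 * X + 12 * A + TB (csize S e + A + X) + 20)"
proof -
  let ?x = "enc (ex x)" and ?a = "enc (ea a)" and ?y = "enc (ea (B e a x))"
  have sn: "s n = []" "s (n + 1) = []" "s (n + 2) = []" "s (n + 3) = []" "s (n + 4) = []"
    using loaded_empty[OF l] by auto
  have sym: "set ?x \<subseteq> {1..5}" "set ?a \<subseteq> {1..5}" "set ?y \<subseteq> {1..5}" by (rule enc_symbols)+
  have 1: "runs (take_val n (n + 3) (n + 4)) (s(n := ?x @ u, n + 1 := ?a))
      (s(n := u, n + 1 := ?a, n + 3 := rev ?x)) (9 * length ?x + 1)"
    by (rule runs_take_val) (use sn in \<open>simp_all add: fun_eq_iff\<close>)
  have 2: "runs (xfer (n + 3) (n + 2)) (s(n := u, n + 1 := ?a, n + 3 := rev ?x))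
      (s(n := u, n + 1 := ?a, n + 2 := ?x)) (5 * length ?x + 1)"
    using runs_xfer[of "n + 3" "n + 2" "s(n := u, n + 1 := ?a, n + 3 := rev ?x)"
      "s(n := u, n + 1 := ?a, n + 2 := ?x)"] sn sym by (simp add: fun_eq_iff)
  have 3: "runs cB (s(n := u, n + 1 := ?a, n + 2 := ?x)) (s(n := u, n + 1 := ?a, n + 2 := ?x, n + 3 := ?y))
      (TB (csize S e + length ?a + length ?x))"
    using cB[OF fold_loaded[OF l loc, of ea ex a x u] refl] by (simp add: csize_lift)
  have 4: "runs (clear (n + 1)) (s(n := u, n + 1 := ?a, n + 2 := ?x, n + 3 := ?y))
      (s(n := u, n + 2 := ?x, n + 3 := ?y)) (2 * length ?a + 1)"
    using runs_clear[of "s(n := u, n + 1 := ?a, n + 2 := ?x, n + 3 := ?y)" "n + 1"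
      "s(n := u, n + 2 := ?x, n + 3 := ?y)"] sn sym by (simp add: fun_eq_iff)
  have 5: "runs (clear (n + 2)) (s(n := u, n + 2 := ?x, n + 3 := ?y))
      (s(n := u, n + 3 := ?y)) (2 * length ?x + 1)"
    using runs_clear[of "s(n := u, n + 2 := ?x, n + 3 := ?y)" "n + 2"
      "s(n := u, n + 3 := ?y)"] sn sym by (simp add: fun_eq_iff)
  have 6: "runs (xfer (n + 3) (n + 2)) (s(n := u, n + 3 := ?y)) (s(n := u, n + 2 := rev ?y)) (5 * length ?y + 1)"
    using runs_xfer[of "n + 3" "n + 2" "s(n := u, n + 3 := ?y)" "s(n := u, n + 2 := rev ?y)"] sn sym
    by (simp add: fun_eq_iff)
  have 7: "runs (xfer (n + 2) (n + 1)) (s(n := u, n + 2 := rev ?y)) (s(n := u, n + 1 := ?y)) (5 * length ?y + 1)"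
    using runs_xfer[of "n + 2" "n + 1" "s(n := u, n + 2 := rev ?y)" "s(n := u, n + 1 := ?y)"] sn sym
    by (simp add: fun_eq_iff)
  note r = runs_Seq[OF 1 runs_Seq[OF 2 runs_Seq[OF 3 runs_Seq[OF 4 runs_Seq[OF 5 runs_Seq[OF 6 7]]]]]]
  have "TB (csize S e + length ?a + length ?x) \<le> TB (csize S e + A + X)"
    using bounds by (intro polyb_mono[OF TB]) simp
  then show ?thesis unfolding fold_body_def using bounds by (intro runs_mono[OF r]) simp
qed

text \<open>The last hypothesis lets every step enlarge the accumulator only by a term that does not
  depend on the accumulator, so that it cannot grow exponentially.\<close>

lemma ptime_fold:
  fixes S :: "'e ctxt" and ea :: "'a \<Rightarrow> val" and ex :: "'x \<Rightarrow> val"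
  assumes L: "ptime S (\<lambda>e. Lst (map ex (xs e)))" and Z: "ptime S (\<lambda>e. ea (z e))"
    and B: "ptime (lift (lift S ea) ex) (\<lambda>y. ea (B (fst (fst y)) (snd (fst y)) (snd y)))"
    and h: "bounded_by_ctxt (lift S ex) h"
    and grow: "\<And>e a x. length (enc (ea (B e a x))) \<le> length (enc (ea a)) + h (e, x)"
  shows "ptime S (\<lambda>e. ea (fold (\<lambda>x a. B e a x) (xs e) (z e)))"
proof (rule ptimeI)
  fix n loc assume loc: "located S loc n"
  obtain c1 T1 where c1: "prog c1" "polyb T1"
    "\<And>e s s'. loaded S loc n e s \<Longrightarrow> s' = s(n := enc (Lst (map ex (xs e)))) \<Longrightarrow> runs c1 s s' (T1 (csize S e))"
    using ptimeE[OF L loc] by metis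
  obtain c2 T2 where c2: "prog c2" "polyb T2"
    "\<And>e s s'. loaded S loc (Suc n) e s \<Longrightarrow> s' = s(Suc n := enc (ea (z e))) \<Longrightarrow> runs c2 s s' (T2 (csize S e))"
    using ptimeE[OF Z located_Suc[OF loc]] by metis
  obtain cB TB where cB: "prog cB" "polyb TB"
    "\<And>y s s'. loaded (lift (lift S ea) ex) (fold_loc S loc n) (n + 3) y s \<Longrightarrow>
      s' = s(n + 3 := enc (ea (B (fst (fst y)) (snd (fst y)) (snd y)))) \<Longrightarrow>
      runs cB s s' (TB (csize (lift (lift S ea) ex) y))"
    using ptimeE[OF B fold_located[OF loc]] by metis
  obtain TL where TL: "polyb TL" "\<And>e. length (enc (Lst (map ex (xs e)))) \<le> TL (csize S e)"
    using ptime_bounded[OF L] unfolding bounded_by_ctxt_def by blast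
  obtain TZ where TZ: "polyb TZ" "\<And>e. length (enc (ea (z e))) \<le> TZ (csize S e)"
    using ptime_bounded[OF Z] unfolding bounded_by_ctxt_def by blast
  obtain H where H: "polyb H" "\<And>e x. h (e, x) \<le> H (csize S e + length (enc (ex x)))"
    using h unfolding bounded_by_ctxt_def by (metis csize_lift fst_conv snd_conv)
  \<comment> \<open>Bound for the accumulator in all rounds: its initial size plus one increment per
    round. \<open>TL\<close> bounds the code of the whole list, and thereby both the number of
    rounds and the size of each element.\<close>
  let ?A = "\<lambda>m. TZ m + TL m * H (m + TL m)"
  \<comment> \<open>Cost of a round: the bound of \<open>runs_fold_body\<close> for elements of size
    \<open>TL m\<close> and accumulators of size \<open>?A m\<close>.\<close>
  let ?W = "\<lambda>m. 16 * TL m + 12 * ?A m + TB (m + ?A m + TL m) + 20"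
  let ?loop = "While (\<lambda>h. h n \<noteq> 5) (fold_body cB n)"
  let ?c = "Seq c1 (Seq c2 (Seq (Pop n) (Seq ?loop (Seq (Pop n) (Seq (xfer (n + 1) (n + 2)) (xfer (n + 2) n))))))"
  show "\<exists>c T. computes S loc n (\<lambda>e. ea (fold (\<lambda>x a. B e a x) (xs e) (z e))) c T"
  proof (rule computesI)
    show "prog ?c" using c1 c2 cB by (simp add: fold_body_def)
    show "polyb (\<lambda>m. T1 m + T2 m + TL m * Suc (?W m) + 10 * ?A m + 20)"
      using c1(2) c2(2) TL(1) TZ(1)
      by (intro polyb_add polyb_mult polyb_const polyb_Suc polyb_id polyb_comp[OF H(1)] polyb_comp[OF cB(2)])
    fix e s assume l: "loaded S loc n e s"
    let ?m = "csize S e" and ?f = "\<lambda>x a. B e a x"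
    let ?s' = "s(n := enc (ea (fold ?f (xs e) (z e))))"
    have sn: "s n = []" "s (n + 1) = []" "s (n + 2) = []" using loaded_empty[OF l] by auto
    \<comment> \<open>The first premise is the loop invariant: the current accumulator together with
      all increments still to come stays within \<open>?A\<close>. By \<open>grow\<close>, a round
      at most moves its increment from the sum into the accumulator.\<close>
    have loop: "runs ?loop (s(n := concat (map (\<lambda>x. enc (ex x)) ys) @ [5], n + 1 := enc (ea a)))
        (s(n := [5], n + 1 := enc (ea (fold ?f ys a)))) (length ys * Suc (?W ?m) + 1)
      \<and> length (enc (ea (fold ?f ys a))) \<le> ?A ?m"
      if "length (enc (ea a)) + (\<Sum>y\<leftarrow>ys. h (e, y)) \<le> ?A ?m"
        "\<And>y. y \<in> set ys \<Longrightarrow> length (enc (ex y)) \<le> TL ?m" for ys a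
      using that
    proof (induction ys arbitrary: a)
      case Nil
      have "runs ?loop (s(n := [5], n + 1 := enc (ea a))) (s(n := [5], n + 1 := enc (ea a))) 1"
        by (rule runs_WhileF) simp
      then show ?case using Nil by (simp del: fun_upd_apply)
    next
      case (Cons y ys)
      let ?u = "concat (map (\<lambda>x. enc (ex x)) ys) @ [5]"
      have g: "length (enc (ea (B e a y))) + (\<Sum>y\<leftarrow>ys. h (e, y)) \<le> ?A ?m"
        using grow[of e a y] Cons.prems(1) by simp
      have 1: "runs (fold_body cB n) (s(n := enc (ex y) @ ?u, n + 1 := enc (ea a)))
          (s(n := ?u, n + 1 := enc (ea (B e a y)))) (?W ?m)"
        using Cons.prems g by (intro runs_fold_body[OF l loc cB(3) cB(2)]) simp_all
      have p: "\<And>x. x \<in> set ys \<Longrightarrow> length (enc (ex x)) \<le> TL ?m" using Cons.prems(2) by simp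
      note IH = conjunct1[OF Cons.IH[OF g p]] conjunct2[OF Cons.IH[OF g p]]
      have "tops (s(n := enc (ex y) @ ?u, n + 1 := enc (ea a))) n \<noteq> 5"
        using hd_enc[of "ex y" ?u] enc_nonempty[of "ex y"] by (cases "enc (ex y)") (simp_all add: tops_def)
      from runs_WhileT[OF this 1 IH(1)] IH(2) show ?case by (simp del: fun_upd_apply)
    qed
    have el: "length (enc (ex y)) \<le> TL ?m" if "y \<in> set (xs e)" for y
    proof -
      have "length (enc (ex y)) \<le> (\<Sum>v\<leftarrow>map ex (xs e). length (enc v))"
        using that by (intro member_le_sum_list) auto
      also have "\<dots> \<le> length (enc (Lst (map ex (xs e))))" by (simp add: length_concat comp_def)
      finally show ?thesis using TL(2)[of e] by simp
    qed
    \<comment> \<open>No code is empty, so a list has at most as many elements as its code has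
      symbols.\<close>
    have len: "length (xs e) \<le> TL ?m"
    proof -
      have "length ys \<le> length (concat (map (\<lambda>x. enc (ex x)) ys))" for ys
      proof (induction ys)
        case (Cons y ys)
        then show ?case using enc_nonempty[of "ex y"] by (cases "enc (ex y)") simp_all
      qed simp
      from this[of "xs e"] TL(2)[of e] show ?thesis by (simp add: comp_def)
    qed
    have "(\<Sum>y\<leftarrow>xs e. h (e, y)) \<le> (\<Sum>y\<leftarrow>xs e. H (?m + TL ?m))"
      by (intro sum_list_mono order_trans[OF H(2)] polyb_mono[OF H(1)] add_left_mono el)
    also have "\<dots> \<le> TL ?m * H (?m + TL ?m)" using len by (simp add: sum_list_triv)
    finally have "length (enc (ea (z e))) + (\<Sum>y\<leftarrow>xs e. h (e, y)) \<le> ?A ?m"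
      using TZ(2)[of e] by simp
    note lp = loop[OF this el]
    let ?r = "enc (ea (fold ?f (xs e) (z e)))" and ?b = "concat (map (\<lambda>x. enc (ex x)) (xs e)) @ [5]"
    have 1: "runs c1 s (s(n := enc (Lst (map ex (xs e))))) (T1 ?m)" by (rule c1(3)[OF l refl])
    have 2: "runs c2 (s(n := enc (Lst (map ex (xs e))))) (s(n := enc (Lst (map ex (xs e))), Suc n := enc (ea (z e)))) (T2 ?m)"
      by (rule c2(3)[OF loaded_upd[OF l loc] refl])
    have 3: "runs (Pop n) (s(n := enc (Lst (map ex (xs e))), Suc n := enc (ea (z e))))
      (s(n := ?b, n + 1 := enc (ea (z e)))) 1"
      by (intro runs_Pop) (simp add: fun_eq_iff comp_def)
    have 4: "runs ?loop (s(n := ?b, n + 1 := enc (ea (z e)))) (s(n := [5], n + 1 := ?r))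
      (TL ?m * Suc (?W ?m) + 1)"
      using lp len by (intro runs_mono[OF conjunct1[OF lp]] add_right_mono mult_right_mono) simp_all
    have 5: "runs (Pop n) (s(n := [5], n + 1 := ?r)) (s(n + 1 := ?r)) 1"
      using sn by (intro runs_Pop) (simp add: fun_eq_iff)
    have 6: "runs (xfer (n + 1) (n + 2)) (s(n + 1 := ?r)) (s(n + 2 := rev ?r)) (5 * length ?r + 1)"
      using runs_xfer[of "n + 1" "n + 2" "s(n + 1 := ?r)" "s(n + 2 := rev ?r)"] sn enc_symbols
      by (simp add: fun_eq_iff)
    have 7: "runs (xfer (n + 2) n) (s(n + 2 := rev ?r)) ?s' (5 * length ?r + 1)"
      using runs_xfer[of "n + 2" n "s(n + 2 := rev ?r)" ?s'] sn enc_symbols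
      by (simp add: fun_eq_iff)
    note r = runs_Seq[OF 1 runs_Seq[OF 2 runs_Seq[OF 3 runs_Seq[OF 4 runs_Seq[OF 5 runs_Seq[OF 6 7]]]]]]
    show "runs ?c s ?s' (T1 ?m + T2 ?m + TL ?m * Suc (?W ?m) + 10 * ?A ?m + 20)"
      using conjunct2[OF lp] by (intro runs_mono[OF r]) simp
  qed
qed

lemma ptime_new_lift: "ptime (lift (lift S ea) ex) (\<lambda>z. ea (snd (fst z)))"
  by (rule ptime_lift[OF ptime_new])

lemma ptime_append:
  assumes "ptime S (\<lambda>e. Lst (f e))" "ptime S (\<lambda>e. Lst (g e))"
  shows "ptime S (\<lambda>e. Lst (f e @ g e))"
proof -
  have "fold (\<lambda>x a. a @ [x]) ys zs = zs @ ys" for ys zs :: "val list"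
    by (induction ys arbitrary: zs) auto
  moreover have "ptime S (\<lambda>e. Lst (fold (\<lambda>x a. (\<lambda>e a x. a @ [x]) e a x) (g e) (f e)))"
  proof (rule ptime_fold[where ex = "\<lambda>v. v" and h = "\<lambda>z. length (enc (snd z))"])
    show "ptime (lift (lift S Lst) (\<lambda>v. v)) (\<lambda>y. Lst (snd (fst y) @ [snd y]))"
      by (intro ptime_snoc ptime_new_lift[where ea = Lst] ptime_new[where ex = "\<lambda>v. v"])
    show "bounded_by_ctxt (lift S (\<lambda>v. v)) (\<lambda>z. length (enc (snd z)))"
      by (intro ptime_bounded ptime_new[where ex = "\<lambda>v. v"])
  qed (use assms in simp_all)
  ultimately show ?thesis by simp
qed

text \<open>Each step appends a list that depends on the element and the environment alone; the
  length of its code serves as growth bound. Maps and filters are the cases of exactly one and at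
  most one value per element.\<close>

lemma ptime_concat_map:
  assumes "ptime S (\<lambda>e. Lst (map ex (xs e)))" "ptime (lift S ex) (\<lambda>z. Lst (G (fst z) (snd z)))"
  shows "ptime S (\<lambda>e. Lst (concat (map (G e) (xs e))))"
proof -
  have "fold (\<lambda>x a. a @ G e x) ys zs = zs @ concat (map (G e) ys)" for ys zs e
    by (induction ys arbitrary: zs) auto
  moreover have "ptime S (\<lambda>e. Lst (fold (\<lambda>x a. (\<lambda>e a x. a @ G e x) e a x) (xs e) []))"
  proof (rule ptime_fold[where ex = ex and h = "\<lambda>z. length (enc (Lst (G (fst z) (snd z))))"])
    show "ptime (lift (lift S Lst) ex) (\<lambda>y. Lst (snd (fst y) @ G (fst (fst y)) (snd y)))"
      using ptime_lift_mid[OF assms(2)] by (intro ptime_append ptime_new_lift[where ea = Lst]) simp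
    show "bounded_by_ctxt (lift S ex) (\<lambda>z. length (enc (Lst (G (fst z) (snd z)))))"
      by (intro ptime_bounded assms)
  qed (use assms ptime_const in simp_all)
  ultimately show ?thesis by simp
qed

section \<open>Encoded types and a calculus of list functions and tests\<close>

definition VL :: "('a \<Rightarrow> val) \<Rightarrow> 'a list \<Rightarrow> val" where
  "VL ex xs = Lst (map ex xs)"

definition VP :: "('a \<Rightarrow> val) \<Rightarrow> ('b \<Rightarrow> val) \<Rightarrow> 'a \<times> 'b \<Rightarrow> val" where
  "VP ea eb p = Lst [ea (fst p), eb (snd p)]"

lemma VP_inj: "inj ea \<Longrightarrow> inj eb \<Longrightarrow> inj (VP ea eb)"
  by (auto simp: inj_def VP_def)

lemma inj_Num: "inj Num" by (auto simp: inj_def)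

lemma ptime_map:
  assumes "ptime S (\<lambda>e. VL ex (xs e))" "ptime (lift S ex) (\<lambda>z. ey (f (fst z) (snd z)))"
  shows "ptime S (\<lambda>e. VL ey (map (f e) (xs e)))"
proof -
  have "ptime (lift S ex) (\<lambda>z. Lst ([] @ [ey (f (fst z) (snd z))]))"
    by (intro ptime_snoc ptime_const assms)
  then have "ptime S (\<lambda>e. Lst (concat (map (\<lambda>x. [ey (f e x)]) (xs e))))"
    using assms by (intro ptime_concat_map[where ex = ex]) (simp_all add: VL_def)
  moreover have "concat (map (\<lambda>x. [ey (f e x)]) ys) = map ey (map (f e) ys)" for e ys
    by (induction ys) auto
  ultimately show ?thesis by (simp add: VL_def comp_def)
qed

lemma ptime_filter:
  assumes "ptime S (\<lambda>e. VL ex (xs e))" "ptime (lift S ex) (\<lambda>z. VB (P (fst z) (snd z)))"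
  shows "ptime S (\<lambda>e. VL ex (filter (P e) (xs e)))"
proof -
  have "ptime (lift S ex) (\<lambda>z. Lst ([] @ [ex (snd z)]))"
    by (intro ptime_snoc ptime_const ptime_new)
  then have "ptime (lift S ex) (\<lambda>z. if P (fst z) (snd z) then Lst [ex (snd z)] else Lst [])"
    using assms by (intro ptime_if ptime_const) simp_all
  then have "ptime (lift S ex) (\<lambda>z. Lst (if P (fst z) (snd z) then [ex (snd z)] else []))"
    by (simp add: if_distrib)
  then have "ptime S (\<lambda>e. Lst (concat (map (\<lambda>x. if P e x then [ex x] else []) (xs e))))"
    using assms by (intro ptime_concat_map[where ex = ex]) (simp_all add: VL_def)
  moreover have "concat (map (\<lambda>x. if P e x then [ex x] else []) ys) = map ex (filter (P e) ys)" for e ys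
    by (induction ys) auto
  ultimately show ?thesis by (simp add: VL_def)
qed

lemma ptime_bool_if:
  assumes "ptime S (\<lambda>e. VB (b e))" "ptime S (\<lambda>e. VB (c e))" "ptime S (\<lambda>e. VB (d e))"
  shows "ptime S (\<lambda>e. VB (if b e then c e else d e))"
  using ptime_if[OF assms] by (simp add: if_distrib[of VB])

lemma ptime_imp:
  assumes "ptime S (\<lambda>e. VB (b e))" "ptime S (\<lambda>e. VB (c e))"
  shows "ptime S (\<lambda>e. VB (b e \<longrightarrow> c e))"
proof -
  have "(\<lambda>e. VB (b e \<longrightarrow> c e)) = (\<lambda>e. VB (if b e then c e else True))" by auto
  then show ?thesis using ptime_bool_if[OF assms ptime_const[of S "VB True"]] by simp
qed

lemma ptime_not:
  assumes "ptime S (\<lambda>e. VB (b e))" shows "ptime S (\<lambda>e. VB (\<not> b e))"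
  using ptime_imp[OF assms ptime_const[of S "VB False"]] by simp

lemma ptime_conj:
  assumes "ptime S (\<lambda>e. VB (b e))" "ptime S (\<lambda>e. VB (c e))"
  shows "ptime S (\<lambda>e. VB (b e \<and> c e))"
  using ptime_not[OF ptime_imp[OF assms(1) ptime_not[OF assms(2)]]] by simp

lemma ptime_null:
  assumes "ptime S (\<lambda>e. VL ex (xs e))" shows "ptime S (\<lambda>e. VB (xs e = []))"
  using ptime_eq[OF assms ptime_const[of S "Lst []"]] by (simp add: VL_def)

text \<open>Filtering for counterexamples must give the empty list.\<close>

lemma ptime_ball:
  assumes "ptime S (\<lambda>e. VL ex (xs e))" "ptime (lift S ex) (\<lambda>z. VB (P (fst z) (snd z)))"
  shows "ptime S (\<lambda>e. VB (\<forall>x\<in>set (xs e). P e x))"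
  using ptime_null[OF ptime_filter[OF assms(1) ptime_not[OF assms(2)]]]
  by (simp add: filter_empty_conv)

lemma ptime_bex:
  assumes "ptime S (\<lambda>e. VL ex (xs e))" "ptime (lift S ex) (\<lambda>z. VB (P (fst z) (snd z)))"
  shows "ptime S (\<lambda>e. VB (\<exists>x\<in>set (xs e). P e x))"
  using ptime_not[OF ptime_ball[OF assms(1) ptime_not[OF assms(2)]]] by simp

lemma ptime_eq_inj:
  assumes "ptime S (\<lambda>e. ex (f e))" "ptime S (\<lambda>e. ex (g e))" "inj ex"
  shows "ptime S (\<lambda>e. VB (f e = g e))"
  using ptime_eq[OF assms(1,2)] by (simp add: inj_eq[OF assms(3)])

lemma ptime_mem:
  assumes "ptime S (\<lambda>e. VL ex (xs e))" "ptime S (\<lambda>e. ex (f e))" "inj ex"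
  shows "ptime S (\<lambda>e. VB (f e \<in> set (xs e)))"
proof -
  have "ptime S (\<lambda>e. VB (\<exists>x\<in>set (xs e). f e = x))"
    by (rule ptime_bex[OF assms(1)], rule ptime_eq_inj[OF ptime_lift[OF assms(2)] ptime_new assms(3)])
  then show ?thesis by simp
qed

lemma ptime_pair:
  assumes "ptime S (\<lambda>e. ea (a e))" "ptime S (\<lambda>e. eb (b e))"
  shows "ptime S (\<lambda>e. VP ea eb (a e, b e))"
proof -
  have "ptime S (\<lambda>e. Lst (([] @ [ea (a e)]) @ [eb (b e)]))"
    by (intro ptime_snoc ptime_const assms)
  then show ?thesis by (simp add: VP_def)
qed

lemma ptime_fst:
  assumes "ptime S (\<lambda>e. VP ea eb (p e))" shows "ptime S (\<lambda>e. ea (fst (p e)))"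
  using ptime_hd[OF assms[unfolded VP_def]] by (simp add: hd_val_def)

lemma ptime_snd:
  assumes "ptime S (\<lambda>e. VP ea eb (p e))" shows "ptime S (\<lambda>e. eb (snd (p e)))"
  using ptime_hd[OF ptime_tl[OF assms[unfolded VP_def]]] by (simp add: hd_val_def)

text \<open>On the empty list \<open>hd\<close> is unspecified, but it is one fixed value, hence a constant.\<close>

lemma ptime_hd_typed:
  assumes "ptime S (\<lambda>e. VL ex (xs e))" shows "ptime S (\<lambda>e. ex (hd (xs e)))"
proof -
  have "ptime S (\<lambda>e. if xs e = [] then ex (hd []) else hd_val (map ex (xs e)))"
    by (intro ptime_if ptime_null[OF assms] ptime_const ptime_hd assms[unfolded VL_def])
  moreover have "(if ys = [] then ex (hd []) else hd_val (map ex ys)) = ex (hd ys)" for ys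
    by (cases ys) (auto simp: hd_val_def)
  ultimately show ?thesis by simp
qed

lemma ptime_tl_typed:
  assumes "ptime S (\<lambda>e. VL ex (xs e))" shows "ptime S (\<lambda>e. VL ex (tl (xs e)))"
  using ptime_tl[OF assms[unfolded VL_def]] by (simp add: VL_def map_tl)

lemma ptime_snoc_typed:
  assumes "ptime S (\<lambda>e. VL ex (xs e))" "ptime S (\<lambda>e. ex (f e))"
  shows "ptime S (\<lambda>e. VL ex (xs e @ [f e]))"
  using ptime_snoc[OF assms(1)[unfolded VL_def] assms(2)] by (simp add: VL_def)

text \<open>Zipping as a fold over the first list: the accumulator holds the pairs made so far and
  the unread part of the second list. The partner of \<open>x\<close> only moves within the
  accumulator, so a step adds at most the code of \<open>x\<close> and two brackets, the growth
  bound in \<open>ptime_zip\<close>.\<close>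

definition zip_step :: "'a \<Rightarrow> ('a \<times> 'b) list \<times> 'b list \<Rightarrow> ('a \<times> 'b) list \<times> 'b list" where
  "zip_step x a = (if snd a = [] then a else (fst a @ [(x, hd (snd a))], tl (snd a)))"

lemma zip_step_simps:
  "zip_step x (d, []) = (d, [])" "zip_step x (d, y # ys) = (d @ [(x, y)], ys)"
  by (auto simp: zip_step_def)

lemma fold_zip_step: "fst (fold zip_step xs (d, ys)) = d @ zip xs ys"
proof (induction xs arbitrary: d ys)
  case (Cons x xs)
  have "fold zip_step xs (d, []) = (d, [])" by (induction xs) (auto simp: zip_step_simps)
  then show ?case using Cons by (cases ys) (auto simp: zip_step_simps)
qed simp

lemma ptime_zip:
  assumes "ptime S (\<lambda>e. VL ex (xs e))" "ptime S (\<lambda>e. VL ey (ys e))"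
  shows "ptime S (\<lambda>e. VL (VP ex ey) (zip (xs e) (ys e)))"
proof -
  let ?ea = "VP (VL (VP ex ey)) (VL ey)"
  have "ptime S (\<lambda>e. ?ea (fold (\<lambda>x a. (\<lambda>e a x. zip_step x a) e a x) (xs e) ([], ys e)))"
  proof (rule ptime_fold[where ex = ex and h = "\<lambda>z. length (enc (ex (snd z))) + 2"])
    show "ptime S (\<lambda>e. Lst (map ex (xs e)))" using assms by (simp add: VL_def)
    show "ptime S (\<lambda>e. ?ea ([], ys e))"
      by (intro ptime_pair assms) (simp add: VL_def ptime_const)
    let ?S = "lift (lift S ?ea) ex"
    have a: "ptime ?S (\<lambda>y. ?ea (snd (fst y)))" by (rule ptime_new_lift)
    have f: "ptime ?S (\<lambda>y. VL (VP ex ey) (fst (snd (fst y))))"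
      and r: "ptime ?S (\<lambda>y. VL ey (snd (snd (fst y))))"
      using ptime_fst[OF a] ptime_snd[OF a] by simp_all
    have x: "ptime ?S (\<lambda>y. ex (snd y))" by (rule ptime_new)
    have p: "ptime ?S (\<lambda>y. VP ex ey (snd y, hd (snd (snd (fst y)))))"
      by (intro ptime_pair x ptime_hd_typed r)
    have "ptime ?S (\<lambda>y. if snd (snd (fst y)) = [] then ?ea (snd (fst y)) else
        ?ea (fst (snd (fst y)) @ [(snd y, hd (snd (snd (fst y))))], tl (snd (snd (fst y)))))"
      by (intro ptime_if ptime_null[OF r] a ptime_pair[where ea = "VL (VP ex ey)"]
          ptime_snoc_typed[OF f p] ptime_tl_typed[OF r])
    then show "ptime ?S (\<lambda>y. ?ea (zip_step (snd y) (snd (fst y))))"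
      by (simp add: zip_step_def if_distrib[of ?ea])
    show "bounded_by_ctxt (lift S ex) (\<lambda>z. length (enc (ex (snd z))) + 2)"
      by (intro bounded_add bounded_const ptime_bounded ptime_new)
    show "length (enc (?ea (zip_step x a))) \<le> length (enc (?ea a)) + (length (enc (ex (snd (e, x)))) + 2)"
      for e :: 'a and a x
      by (cases a; cases "snd a") (auto simp: zip_step_def VP_def VL_def)
  qed
  from ptime_fst[OF this] show ?thesis by (simp add: fold_zip_step)
qed

text \<open>\<open>enc_cnstr\<close> puts no brackets around a scope and its tuples, so a list of
  constraints is a flat sequence of alternating items that has to be regrouped. The second component
  is empty or holds a first half waiting for its partner.\<close>

definition pair_step :: "'a \<Rightarrow> ('a \<times> 'a) list \<times> 'a list \<Rightarrow> ('a \<times> 'a) list \<times> 'a list" where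
  "pair_step x a = (if snd a = [] then (fst a, [x]) else (fst a @ [(hd (snd a), x)], []))"

lemma fold_pair_step:
  "fold pair_step (concat (map (\<lambda>p. [fst p, snd p]) ps)) (d, []) = (d @ ps, [])"
proof (induction ps arbitrary: d)
  case (Cons p ps)
  have "pair_step (fst p) (d, []) = (d, [fst p])" "pair_step (snd p) (d, [fst p]) = (d @ [p], [])"
    by (auto simp: pair_step_def)
  then show ?case using Cons by simp
qed simp

lemma ptime_pairing:
  assumes "ptime S (\<lambda>e. Lst (concat (map (\<lambda>p. [ea (fst p), eb (snd p)]) (ps e))))"
  shows "ptime S (\<lambda>e. VL (VP ea eb) (ps e))"
proof -
  \<comment> \<open>The flat list mixes two types, so the fold runs on bare values with the identity
    as encoder; the pairs get their types back at the end.\<close>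
  let ?i = "\<lambda>v :: val. v"
  let ?ea = "VP (VL (VP ?i ?i)) (VL ?i)"
  let ?xs = "\<lambda>e. concat (map (\<lambda>p. [ea (fst p), eb (snd p)]) (ps e))"
  have "ptime S (\<lambda>e. ?ea (fold (\<lambda>x a. (\<lambda>e a x. pair_step x a) e a x) (?xs e) ([], [])))"
  proof (rule ptime_fold[where ex = ?i and h = "\<lambda>z. length (enc (?i (snd z))) + 2"])
    show "ptime S (\<lambda>e. Lst (map ?i (?xs e)))" using assms by simp
    show "ptime S (\<lambda>e. ?ea ([], []))" by (rule ptime_const)
    let ?S = "lift (lift S ?ea) ?i"
    have a: "ptime ?S (\<lambda>y. ?ea (snd (fst y)))" by (rule ptime_new_lift)
    have f: "ptime ?S (\<lambda>y. VL (VP ?i ?i) (fst (snd (fst y))))"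
      and r: "ptime ?S (\<lambda>y. VL ?i (snd (snd (fst y))))"
      using ptime_fst[OF a] ptime_snd[OF a] by simp_all
    have x: "ptime ?S (\<lambda>y. ?i (snd y))" by (rule ptime_new)
    have nil: "ptime ?S (\<lambda>y. VL ?i [])" by (rule ptime_const)
    have one: "ptime ?S (\<lambda>y. VL ?i [snd y])" using ptime_snoc_typed[OF nil x] by simp
    have p: "ptime ?S (\<lambda>y. VP ?i ?i (hd (snd (snd (fst y))), snd y))"
      by (intro ptime_pair[where ea = ?i and eb = ?i] x ptime_hd_typed[where ex = ?i] r)
    have "ptime ?S (\<lambda>y. if snd (snd (fst y)) = [] then ?ea (fst (snd (fst y)), [snd y]) else
        ?ea (fst (snd (fst y)) @ [(hd (snd (snd (fst y))), snd y)], []))"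
      by (intro ptime_if ptime_null[OF r] ptime_pair[where ea = "VL (VP ?i ?i)"] f one nil
          ptime_snoc_typed[OF f p])
    then show "ptime ?S (\<lambda>y. ?ea (pair_step (snd y) (snd (fst y))))"
      by (simp add: pair_step_def if_distrib[of ?ea])
    show "bounded_by_ctxt (lift S ?i) (\<lambda>z. length (enc (?i (snd z))) + 2)"
      by (intro bounded_add bounded_const ptime_bounded ptime_new[where ex = ?i])
    show "length (enc (?ea (pair_step x a))) \<le> length (enc (?ea a)) + (length (enc (snd (e, x))) + 2)"
      for e :: 'a and a x
      by (cases a; cases "snd a") (auto simp: pair_step_def VP_def VL_def)
  qed
  from ptime_fst[OF this]
  have "ptime S (\<lambda>e. VL (VP ?i ?i) (fst (fold pair_step (?xs e) ([], []))))" by simp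
  moreover have "fold pair_step (?xs e) ([], []) = (map (\<lambda>p. (ea (fst p), eb (snd p))) (ps e), [])" for e
    using fold_pair_step[of "map (\<lambda>p. (ea (fst p), eb (snd p))) (ps e)" "[]"]
    by (simp add: comp_def)
  ultimately show ?thesis by (simp add: VL_def VP_def[abs_def] comp_def)
qed

section \<open>Arc consistency\<close>

text \<open>A scope may repeat a variable. The zip of scope and tuple is an assignment only if
  repeated variables get equal values.\<close>

definition consistent :: "(nat \<times> nat) list \<Rightarrow> bool" where
  "consistent t \<longleftrightarrow> (\<forall>p\<in>set t. \<forall>q\<in>set t. fst p = fst q \<longrightarrow> snd p = snd q)"

definition assignments :: "nat list \<times> nat list list \<Rightarrow> (nat \<times> nat) list list" where
  "assignments c = filter consistent (map (zip (fst c)) (snd c))"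

definition live_tuple :: "(nat \<times> nat) list \<Rightarrow> (nat \<times> nat) list \<Rightarrow> bool" where
  "live_tuple L t \<longleftrightarrow> (\<forall>p\<in>set t. p \<in> set L)"

text \<open>The premise finds out from the tuples of \<open>C\<close> whether the variable of
  \<open>p\<close> is in the scope. A \<open>C\<close> without tuples makes no demand here;
  \<open>feasible\<close> rejects it.\<close>

definition supported :: "(nat \<times> nat) list list list \<Rightarrow> (nat \<times> nat) list \<Rightarrow> nat \<times> nat \<Rightarrow> bool" where
  "supported N L p \<longleftrightarrow> (\<forall>C\<in>set N. (\<exists>t\<in>set C. \<exists>q\<in>set t. fst q = fst p) \<longrightarrow>
     (\<exists>t\<in>set C. p \<in> set t \<and> live_tuple L t))"

definition prune :: "(nat \<times> nat) list list list \<Rightarrow> (nat \<times> nat) list \<Rightarrow> (nat \<times> nat) list" where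
  "prune N L = filter (supported N L) L"

definition all_pairs :: "nat list \<Rightarrow> nat list \<Rightarrow> (nat \<times> nat) list" where
  "all_pairs vs ds = concat (map (\<lambda>v. map (\<lambda>d. (v, d)) ds) vs)"

text \<open>The list of all pairs is starting point and clock at once: each round before the
  fixpoint removes a pair, so its length is a sufficient number of rounds.\<close>

definition arc_closure :: "nat list \<Rightarrow> nat list \<Rightarrow> (nat list \<times> nat list list) list \<Rightarrow> (nat \<times> nat) list" where
  "arc_closure vs ds cs = fold (\<lambda>_. prune (map assignments cs)) (all_pairs vs ds) (all_pairs vs ds)"

text \<open>Live tuples alone would miss an unconstrained variable over an empty domain; live values
  alone would miss a constraint with an empty list of assignments, which prunes nothing.\<close>

definition feasible :: "nat list \<Rightarrow> nat list \<Rightarrow> (nat list \<times> nat list list) list \<Rightarrow> (nat \<times> nat) list \<Rightarrow> bool" where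
  "feasible vs ds cs L \<longleftrightarrow> (\<forall>v\<in>set vs. \<exists>d\<in>set ds. (v, d) \<in> set L) \<and>
     (\<forall>C\<in>set (map assignments cs). \<exists>t\<in>set C. live_tuple L t)"

text \<open>With \<open>ds\<close> in decreasing order the head of the filtered list is the largest
  live value, so numbers are never compared by size.\<close>

definition best :: "nat list \<Rightarrow> (nat \<times> nat) list \<Rightarrow> nat \<Rightarrow> nat" where
  "best ds L v = hd (filter (\<lambda>d. (v, d) \<in> set L) ds)"

lemma fold_const: "fold (\<lambda>_. g) xs a = (g ^^ length xs) a"
  by (induction xs arbitrary: a) (auto simp: funpow_swap1)

text \<open>After \<open>k\<close> rounds the list is stable or has lost at least \<open>k\<close>
  pairs. For \<open>k = length L\<close> the second case leaves the empty list, which is stable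
  too.\<close>

lemma prune_fixpoint: "prune N ((prune N ^^ length L) L) = (prune N ^^ length L) L"
proof -
  have "prune N ((prune N ^^ k) L) = (prune N ^^ k) L \<or> length ((prune N ^^ k) L) + k \<le> length L" for k
  proof (induction k)
    case (Suc k)
    show ?case
    proof (cases "prune N ((prune N ^^ k) L) = (prune N ^^ k) L")
      case False
      let ?M = "(prune N ^^ k) L"
      have "length (prune N ?M) < length ?M"
      proof -
        obtain p where "p \<in> set ?M" "\<not> supported N ?M p"
          using False by (auto simp: prune_def filter_id_conv)
        then show ?thesis unfolding prune_def by (rule length_filter_less)
      qed
      then show ?thesis using Suc False by auto
    qed simp
  qed simp
  from this[of "length L"] show ?thesis by (auto simp: prune_def)
qed

text \<open>Induction on the set of coordinates. Let \<open>s\<close> dominate \<open>T\<close> on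
  \<open>I\<close> with the largest possible entry at \<open>i\<close>, and suppose that some
  element exceeds \<open>s\<close> at \<open>i\<close>; let \<open>t\<close> be such an element with
  the largest sum on \<open>I\<close>. Combining \<open>s\<close> and \<open>t\<close> in either
  order increases that sum, so neither combination exceeds \<open>s i\<close> at \<open>i\<close>;
  but \<open>gmax\<close> at \<open>i\<close> forbids that both stay so low. The set
  \<open>X\<close> confines all requirements to the positions of a tuple, as list indexing says
  nothing outside.\<close>

lemma max_closed_sup:
  fixes T :: "('i \<Rightarrow> nat) set" and D :: "nat set"
  assumes "finite D" "T \<noteq> {}" and D: "\<And>s i. s \<in> T \<Longrightarrow> i \<in> X \<Longrightarrow> s i \<in> D"
    and closed: "\<And>s t. s \<in> T \<Longrightarrow> t \<in> T \<Longrightarrow> \<exists>u\<in>T. \<forall>i\<in>X. u i = f (s i) (t i)"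
    and gmax: "\<And>a b. a \<in> D \<Longrightarrow> b \<in> D \<Longrightarrow> a \<noteq> b \<Longrightarrow> f a b \<le> min a b \<Longrightarrow> f b a > max a b"
    and idem: "\<And>a. a \<in> D \<Longrightarrow> f a a \<ge> a"
    and "finite I" "I \<subseteq> X"
  shows "\<exists>s\<in>T. \<forall>j\<in>I. \<forall>t\<in>T. t j \<le> s j"
  using assms(7,8)
proof (induction I)
  case empty
  then show ?case using assms(2) by auto
next
  case (insert i I)
  have bd: "s j \<le> Max D" if "s \<in> T" "j \<in> X" for s j using D[OF that] assms(1) by simp
  let ?P = "\<lambda>s. s \<in> T \<and> (\<forall>j\<in>I. \<forall>t\<in>T. t j \<le> s j)"
  obtain s0 where "?P s0" using insert by auto
  then obtain s where s: "?P s" "\<And>t. ?P t \<Longrightarrow> t i \<le> s i"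
    using ex_has_greatest_nat[of ?P s0 "\<lambda>s. s i" "Suc (Max D)"] bd insert.prems
    by (metis insert_subset less_Suc_eq_le)
  have "t i \<le> s i" if "t \<in> T" for t
  proof (rule ccontr)
    assume "\<not> t i \<le> s i"
    let ?Q = "\<lambda>t. t \<in> T \<and> t i > s i"
    have "?Q t" using that \<open>\<not> t i \<le> s i\<close> by simp
    moreover have "\<forall>t. ?Q t \<longrightarrow> (\<Sum>j\<in>I. t j) < Suc (\<Sum>j\<in>I. Max D)"
      using bd insert.prems by (auto simp: less_Suc_eq_le simp del: sum_constant intro!: sum_mono)
    ultimately obtain t where t: "?Q t" "\<And>u. ?Q u \<Longrightarrow> (\<Sum>j\<in>I. u j) \<le> (\<Sum>j\<in>I. t j)"
      using ex_has_greatest_nat[of ?Q t "\<lambda>t. \<Sum>j\<in>I. t j" "Suc (\<Sum>j\<in>I. Max D)"] by blast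
    obtain u where u: "u \<in> T" "\<And>j. j \<in> X \<Longrightarrow> u j = f (s j) (t j)"
      using closed[of s t] s(1) t(1) by auto
    obtain u' where u': "u' \<in> T" "\<And>j. j \<in> X \<Longrightarrow> u' j = f (t j) (s j)"
      using closed[of t s] s(1) t(1) by auto
    \<comment> \<open>As \<open>s\<close> dominates on \<open>I\<close>, no value at
      \<open>j\<close> exceeds \<open>s j\<close>, which is the larger of \<open>s j\<close> and
      \<open>t j\<close>. So if the entries differ, \<open>gmax\<close> forbids either order to give
      \<open>t j\<close> or less; for equal entries \<open>idem\<close> applies.\<close>
    have ge: "u j \<ge> t j \<and> u' j \<ge> t j \<and> (t j < s j \<longrightarrow> u j > t j \<and> u' j > t j)" if j: "j \<in> I" for j
    proof -
      have X: "j \<in> X" "s j \<in> D" "t j \<in> D" using j insert.prems D s t by auto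
      have m: "t j \<le> s j" "f (s j) (t j) \<le> s j" "f (t j) (s j) \<le> s j"
        using s(1) t(1) u(1) u'(1) j by (auto simp flip: u(2)[OF X(1)] u'(2)[OF X(1)])
      show ?thesis
      proof (cases "t j = s j")
        case True
        then show ?thesis using idem[OF X(2)] u u' X by auto
      next
        case False
        then have "t j < s j" using m by simp
        have "f (s j) (t j) > t j"
          by (rule ccontr) (use gmax[OF X(2,3)] m \<open>t j < s j\<close> in simp)
        moreover have "f (t j) (s j) > t j"
          by (rule ccontr) (use gmax[OF X(3,2)] m \<open>t j < s j\<close> in simp)
        ultimately show ?thesis using u(2)[OF X(1)] u'(2)[OF X(1)] by simp
      qed
    qed
    \<comment> \<open>If \<open>t\<close> were nowhere smaller than \<open>s\<close> on
      \<open>I\<close>, it would dominate \<open>T\<close> there as well and contradict the choice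
      of \<open>s\<close>.\<close>
    have "\<exists>j\<in>I. t j < s j"
    proof (rule ccontr)
      assume "\<not> (\<exists>j\<in>I. t j < s j)"
      then have "?P t" using s(1) t(1) by (meson leI order_trans)
      then show False using s(2) t(1) by fastforce
    qed
    then obtain j where j: "j \<in> I" "t j < s j" by blast
    have "(\<Sum>j\<in>I. t j) < (\<Sum>j\<in>I. u j)" "(\<Sum>j\<in>I. t j) < (\<Sum>j\<in>I. u' j)"
      using ge j insert.hyps(1) by (auto intro!: sum_strict_mono_ex1)
    then have "\<not> ?Q u" "\<not> ?Q u'" using t(2) by (auto simp: not_le[symmetric])
    \<comment> \<open>Here \<open>s i\<close> is the smaller entry: if \<open>f (s i) (t i)\<close>
      is at most \<open>s i\<close>, then \<open>f (t i) (s i)\<close> lies above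
      \<open>t i\<close>.\<close>
    moreover have "u i > s i \<or> u' i > s i"
    proof (rule ccontr)
      assume n: "\<not> (u i > s i \<or> u' i > s i)"
      have "i \<in> X" using insert.prems by simp
      then have "s i \<in> D" "t i \<in> D" "u i = f (s i) (t i)" "u' i = f (t i) (s i)"
        using D s(1) t(1) u(2) u'(2) by auto
      then show False using gmax[of "s i" "t i"] n t(1) by simp
    qed
    ultimately show False using u(1) u'(1) by blast
  qed
  then show ?case using s(1) by blast
qed

section \<open>Correctness of pruning under a generalised max operation\<close>

locale gmax_instance =
  fixes D :: "nat set" and f :: "nat \<Rightarrow> nat \<Rightarrow> nat" and ds vs :: "nat list"
    and cs :: "(nat list \<times> nat list list) list"
  assumes ds: "set ds = D" "sorted_wrt (\<ge>) ds"
    and f_D: "\<And>a b. a \<in> D \<Longrightarrow> b \<in> D \<Longrightarrow> f a b \<in> D"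
    and gmax: "\<And>a b. a \<in> D \<Longrightarrow> b \<in> D \<Longrightarrow> a \<noteq> b \<Longrightarrow> f a b \<le> min a b \<Longrightarrow> f b a > max a b"
    and idem: "\<And>a. a \<in> D \<Longrightarrow> f a a \<ge> a"
    and scope: "\<And>s R. (s, R) \<in> set cs \<Longrightarrow> set s \<subseteq> set vs"
    and tuple: "\<And>s R r. (s, R) \<in> set cs \<Longrightarrow> r \<in> set R \<Longrightarrow> length r = length s \<and> set r \<subseteq> D"
    and closed: "\<And>s R r r'. (s, R) \<in> set cs \<Longrightarrow> r \<in> set R \<Longrightarrow> r' \<in> set R \<Longrightarrow> map2 f r r' \<in> set R"
begin

abbreviation "N \<equiv> map assignments cs"

definition solution :: "(nat \<Rightarrow> nat) \<Rightarrow> bool" where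
  "solution g \<longleftrightarrow> (\<forall>v\<in>set vs. g v \<in> D) \<and> (\<forall>(s, R)\<in>set cs. map g s \<in> set R)"

text \<open>The invariant of pruning. Closure under \<open>f\<close> is what makes the maximal
  values a solution; the last clause gives both optimality and the verdict of infeasibility.\<close>

definition good_list :: "(nat \<times> nat) list \<Rightarrow> bool" where
  "good_list L \<longleftrightarrow> set L \<subseteq> set vs \<times> D \<and>
     (\<forall>v d d'. (v, d) \<in> set L \<longrightarrow> (v, d') \<in> set L \<longrightarrow> (v, f d d') \<in> set L) \<and>
     (\<forall>g. solution g \<longrightarrow> (\<forall>v\<in>set vs. (v, g v) \<in> set L))"

text \<open>The surviving assignments as plain tuples, the form in which \<open>f\<close> acts on
  them coordinatewise.\<close>

definition live_rel :: "(nat \<times> nat) list \<Rightarrow> nat list \<Rightarrow> nat list list \<Rightarrow> nat list set" where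
  "live_rel L s R = {r \<in> set R. consistent (zip s r) \<and> live_tuple L (zip s r)}"

lemma live_rel_iff:
  "t \<in> set (assignments (s, R)) \<and> live_tuple L t \<longleftrightarrow> t \<in> zip s ` live_rel L s R"
  by (auto simp: assignments_def live_rel_def)

lemma consistent_nth:
  assumes "consistent (zip s r)" "length r = length s" "i < length s" "j < length s" "s ! i = s ! j"
  shows "r ! i = r ! j"
proof -
  have "(s ! i, r ! i) \<in> set (zip s r)" "(s ! j, r ! j) \<in> set (zip s r)"
    using assms by (auto simp: in_set_zip)
  then show ?thesis using assms unfolding consistent_def by fastforce
qed

lemma consistentI:
  assumes "\<And>i j. i < length s \<Longrightarrow> j < length s \<Longrightarrow> s ! i = s ! j \<Longrightarrow> r ! i = r ! j"
  shows "consistent (zip s r)"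
  unfolding consistent_def
proof (intro ballI impI)
  fix p q assume "p \<in> set (zip s r)" "q \<in> set (zip s r)" and eq: "fst p = fst q"
  then obtain i j where "i < length s" "p = (s ! i, r ! i)" "j < length s" "q = (s ! j, r ! j)"
    unfolding in_set_zip by (metis prod.collapse)
  then show "snd p = snd q" using assms[of i j] eq by simp
qed

text \<open>Equal values at repeated variables stay equal under \<open>f\<close>, the result is in
  the relation by the locale assumption \<open>closed\<close>, and it is live because
  \<open>good_list\<close> closes the values of each variable under \<open>f\<close>.\<close>

lemma live_rel_closed:
  assumes c: "(s, R) \<in> set cs" and L: "good_list L" and r: "r \<in> live_rel L s R" "r' \<in> live_rel L s R"
  shows "map2 f r r' \<in> live_rel L s R"
proof -
  have len: "length r = length s" "length r' = length s"
    using r tuple[OF c] by (auto simp: live_rel_def)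
  have "map2 f r r' \<in> set R" using closed[OF c] r by (auto simp: live_rel_def)
  moreover have "consistent (zip s (map2 f r r'))"
  proof (rule consistentI)
    fix i j assume ij: "i < length s" "j < length s" "s ! i = s ! j"
    then have "r ! i = r ! j" "r' ! i = r' ! j"
      using consistent_nth[of s r i j] consistent_nth[of s r' i j] r len
      by (simp_all add: live_rel_def)
    then show "map2 f r r' ! i = map2 f r r' ! j" using ij len by simp
  qed
  moreover have "live_tuple L (zip s (map2 f r r'))"
    unfolding live_tuple_def
  proof
    fix p assume "p \<in> set (zip s (map2 f r r'))"
    then obtain i where i: "i < length s" "p = (s ! i, f (r ! i) (r' ! i))"
      using len by (auto simp: in_set_zip)
    have "(s ! i, r ! i) \<in> set L" "(s ! i, r' ! i) \<in> set L"
      using r i len by (auto simp: live_rel_def live_tuple_def in_set_zip)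
    then show "p \<in> set L" using L i by (auto simp: good_list_def)
  qed
  ultimately show ?thesis by (simp add: live_rel_def)
qed

lemma solution_live:
  assumes c: "(s, R) \<in> set cs" and L: "good_list L" and g: "solution g"
  shows "map g s \<in> live_rel L s R"
proof -
  have "consistent (zip s (map g s))" by (rule consistentI) simp
  moreover have "live_tuple L (zip s (map g s))"
  proof -
    have "(v, g v) \<in> set L" if "v \<in> set s" for v
      using L g scope[OF c] that by (auto simp: good_list_def)
    then show ?thesis by (auto simp: live_tuple_def in_set_zip)
  qed
  moreover have "map g s \<in> set R" using g c by (auto simp: solution_def)
  ultimately show ?thesis by (simp add: live_rel_def)
qed

lemma supported_iff:
  "supported N L (v, d) \<longleftrightarrow> (\<forall>(s, R)\<in>set cs.
     (\<exists>t\<in>set (assignments (s, R)). \<exists>q\<in>set t. fst q = v) \<longrightarrow> (\<exists>r\<in>live_rel L s R. (v, d) \<in> set (zip s r)))"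
proof -
  have "(\<exists>t\<in>set (assignments (s, R)). (v, d) \<in> set t \<and> live_tuple L t) \<longleftrightarrow>
      (\<exists>r\<in>live_rel L s R. (v, d) \<in> set (zip s r))" for s R
  proof -
    have "(\<exists>r\<in>live_rel L s R. (v, d) \<in> set (zip s r)) \<longleftrightarrow>
        (\<exists>t. t \<in> zip s ` live_rel L s R \<and> (v, d) \<in> set t)" by auto
    then show ?thesis unfolding live_rel_iff[symmetric] by auto
  qed
  from this[of "fst c" "snd c" for c] show ?thesis by (simp add: supported_def case_prod_beta)
qed

text \<open>If \<open>r\<close> supports \<open>d\<close> and \<open>r'\<close> supports
  \<open>d'\<close>, then \<open>map2 f r r'\<close> supports \<open>f d d'\<close>. A solution
  supports its own values by the tuple it induces on the scope.\<close>

lemma good_prune: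
  assumes L: "good_list L" shows "good_list (prune N L)"
  unfolding good_list_def
proof (intro conjI allI impI ballI)
  show "set (prune N L) \<subseteq> set vs \<times> D" using L by (auto simp: prune_def good_list_def)
next
  fix v d d' assume d: "(v, d) \<in> set (prune N L)" "(v, d') \<in> set (prune N L)"
  have "supported N L (v, f d d')"
    unfolding supported_iff
  proof (intro ballI, clarify)
    fix s R t q assume c: "(s, R) \<in> set cs" and t: "t \<in> set (assignments (s, R))" "q \<in> set t" "v = fst q"
    obtain r r' where r: "r \<in> live_rel L s R" "(v, d) \<in> set (zip s r)"
      "r' \<in> live_rel L s R" "(v, d') \<in> set (zip s r')"
      using d c t unfolding prune_def set_filter mem_Collect_eq supported_iff by blast
    have len: "length r = length s" "length r' = length s"
      using r tuple[OF c] by (auto simp: live_rel_def)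
    obtain i where i: "i < length s" "s ! i = v" "r ! i = d" using r(2) len by (auto simp: in_set_zip)
    obtain j where j: "j < length s" "s ! j = v" "r' ! j = d'" using r(4) len by (auto simp: in_set_zip)
    \<comment> \<open>The variable may stand at different positions for \<open>d\<close> and
      \<open>d'\<close> if the scope repeats it; consistency moves \<open>d'\<close> to the position
      of \<open>d\<close>.\<close>
    have "r' ! i = d'"
      using consistent_nth[of s r' i j] r(3) len i j by (simp add: live_rel_def)
    then have "(v, f d d') \<in> set (zip s (map2 f r r'))"
      using i len by (auto simp: in_set_zip intro!: exI[of _ i])
    then show "\<exists>r\<in>live_rel L s R. (fst q, f d d') \<in> set (zip s r)"
      using live_rel_closed[OF c L r(1,3)] t(3) by blast
  qed
  then show "(v, f d d') \<in> set (prune N L)"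
    using d L by (auto simp: prune_def good_list_def)
next
  fix g v assume g: "solution g" and v: "v \<in> set vs"
  have "supported N L (v, g v)"
    unfolding supported_iff
  proof (intro ballI, clarify)
    fix s R t q assume c: "(s, R) \<in> set cs" and t: "t \<in> set (assignments (s, R))" "q \<in> set t" "v = fst q"
    have "v \<in> set s" using t by (auto simp: assignments_def) (metis prod.collapse set_zip_leftD)
    then have "(v, g v) \<in> set (zip s (map g s))" by (force simp: in_set_zip in_set_conv_nth)
    then show "\<exists>r\<in>live_rel L s R. (fst q, g (fst q)) \<in> set (zip s r)"
      using solution_live[OF c L g] t(3) by blast
  qed
  then show "(v, g v) \<in> set (prune N L)"
    using L g v by (auto simp: prune_def good_list_def)
qed

abbreviation "L \<equiv> arc_closure vs ds cs"

lemma good_L: "good_list L"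
proof -
  have "set (all_pairs vs ds) = set vs \<times> D" using ds by (auto simp: all_pairs_def)
  then have "good_list (all_pairs vs ds)" using f_D by (auto simp: good_list_def solution_def)
  then have "good_list ((prune N ^^ k) (all_pairs vs ds))" for k
    by (induction k) (auto intro: good_prune)
  then show ?thesis by (simp add: arc_closure_def fold_const)
qed

lemma prune_L: "prune N L = L"
  by (simp add: arc_closure_def fold_const prune_fixpoint)

lemma solution_feasible:
  assumes "solution g" shows "feasible vs ds cs L"
proof -
  have "\<exists>t\<in>set C. live_tuple L t" if C: "C \<in> set N" for C
  proof -
    obtain s R where "(s, R) \<in> set cs" "C = assignments (s, R)" using C by auto
    then show ?thesis using solution_live[OF _ good_L assms] live_rel_iff by blast
  qed
  moreover have "(v, g v) \<in> set L" "g v \<in> set ds" if "v \<in> set vs" for v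
    using good_L assms ds that by (auto simp: good_list_def solution_def)
  ultimately show ?thesis unfolding feasible_def by blast
qed

lemma best_max:
  assumes "(v, d) \<in> set L"
  shows "(v, best ds L v) \<in> set L" "d \<le> best ds L v"
proof -
  have "d \<in> set ds" using assms good_L ds by (auto simp: good_list_def)
  then have d: "d \<in> set (filter (\<lambda>d. (v, d) \<in> set L) ds)" using assms by simp
  then obtain b bs where b: "filter (\<lambda>d. (v, d) \<in> set L) ds = b # bs"
    by (cases "filter (\<lambda>d. (v, d) \<in> set L) ds") auto
  then have "b \<in> set (filter (\<lambda>d. (v, d) \<in> set L) ds)" by simp
  then have "(v, b) \<in> set L" unfolding set_filter by simp
  then show "(v, best ds L v) \<in> set L" by (simp add: best_def b)
  have "sorted_wrt (\<ge>) (b # bs)" using ds(2) b by (metis sorted_wrt_filter)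
  then show "d \<le> best ds L v" using d b by (auto simp: best_def)
qed

lemma solution_le_best:
  assumes "solution g" "v \<in> set vs" shows "g v \<le> best ds L v"
  using assms good_L by (auto simp: good_list_def intro: best_max)

text \<open>\<open>max_closed_sup\<close> gives a live tuple that dominates all live tuples of the
  constraint. Its entry at a variable is a live value, so at most the best one; the best value is
  supported by some live tuple, so at most that entry.\<close>

lemma best_solution:
  assumes "feasible vs ds cs L" shows "solution (best ds L)"
proof -
  have "best ds L v \<in> D" if v: "v \<in> set vs" for v
  proof -
    obtain d where "(v, d) \<in> set L" using assms v by (auto simp: feasible_def)
    then show ?thesis using best_max(1) good_L by (auto simp: good_list_def)
  qed
  moreover have "map (best ds L) s \<in> set R" if c: "(s, R) \<in> set cs" for s R
  proof -
    let ?T = "live_rel L s R"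
    have len: "length r = length s" "set r \<subseteq> D" if "r \<in> ?T" for r
      using that tuple[OF c] by (auto simp: live_rel_def)
    have ne: "?T \<noteq> {}"
      using assms c live_rel_iff[of _ s R L] by (fastforce simp: feasible_def)
    have "\<exists>u\<in>(!) ` ?T. \<forall>j\<in>{..<length s}. \<forall>t\<in>(!) ` ?T. t j \<le> u j"
    proof (rule max_closed_sup[where D = D and f = f and X = "{..<length s}"])
      show "finite D" using ds by auto
      show "(!) ` ?T \<noteq> {}" using ne by simp
      show "t j \<in> D" if "t \<in> (!) ` ?T" "j \<in> {..<length s}" for t j
        using that len by fastforce
      show "\<exists>u\<in>(!) ` ?T. \<forall>i\<in>{..<length s}. u i = f (t i) (t' i)"
        if tt: "t \<in> (!) ` ?T" "t' \<in> (!) ` ?T" for t t'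
      proof -
        obtain r r' where r: "t = (!) r" "t' = (!) r'" "r \<in> ?T" "r' \<in> ?T" using tt by blast
        then show ?thesis
          using len by (intro bexI[of _ "(!) (map2 f r r')"] imageI live_rel_closed[OF c good_L]) auto
      qed
    qed (use gmax idem in auto)
    then obtain r where r: "r \<in> ?T" "\<And>j r'. j < length s \<Longrightarrow> r' \<in> ?T \<Longrightarrow> r' ! j \<le> r ! j"
      by auto
    have "r ! i = best ds L (s ! i)" if i: "i < length s" for i
    proof -
      let ?v = "s ! i"
      have z: "(?v, r ! i) \<in> set (zip s r)" using i len[OF r(1)] by (auto simp: in_set_zip)
      then have live: "(?v, r ! i) \<in> set L" using r(1) by (auto simp: live_rel_def live_tuple_def)
      \<comment> \<open>The fixpoint property turns liveness into support.\<close>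
      have "(?v, best ds L ?v) \<in> set (prune N L)" using best_max(1)[OF live] prune_L by simp
      then have "supported N L (?v, best ds L ?v)" by (simp add: prune_def)
      moreover have "\<exists>t\<in>set (assignments (s, R)). \<exists>q\<in>set t. fst q = ?v"
        using r(1) z by (force simp: assignments_def live_rel_def)
      ultimately obtain r' where r': "r' \<in> ?T" "(?v, best ds L ?v) \<in> set (zip s r')"
        using c unfolding supported_iff by blast
      then obtain j where j: "j < length s" "s ! j = ?v" "r' ! j = best ds L ?v"
        using len[OF r'(1)] by (auto simp: in_set_zip)
      have "r' ! i = best ds L ?v"
        using consistent_nth[of s r' i j] r'(1) len[OF r'(1)] i j by (simp add: live_rel_def)
      then show ?thesis using r(2)[OF i r'(1)] best_max(2)[OF live] by simp
    qed
    then have "map (best ds L) s = r" using len[OF r(1)] by (intro nth_equalityI) auto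
    then show ?thesis using r(1) by (simp add: live_rel_def)
  qed
  ultimately show ?thesis by (auto simp: solution_def)
qed

end

section \<open>Arc consistency in polynomial time\<close>

abbreviation "VQ \<equiv> VP Num Num"

abbreviation "VC \<equiv> VP (VL Num) (VL (VL Num))"

lemma inj_VQ: "inj VQ" by (intro VP_inj inj_Num)

lemma ptime_consistent:
  assumes "ptime S (\<lambda>e. VL VQ (t e))"
  shows "ptime S (\<lambda>e. VB (consistent (t e)))"
  unfolding consistent_def
proof (rule ptime_ball[OF assms], rule ptime_ball[OF ptime_lift[OF assms]], rule ptime_imp)
  let ?S = "lift (lift S VQ) VQ"
  have p: "ptime ?S (\<lambda>z. VQ (snd (fst z)))" and q: "ptime ?S (\<lambda>z. VQ (snd z))"
    by (rule ptime_new_lift, rule ptime_new)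
  show "ptime ?S (\<lambda>z. VB (fst (snd (fst z)) = fst (snd z)))"
    by (rule ptime_eq_inj[OF ptime_fst[OF p] ptime_fst[OF q] inj_Num])
  show "ptime ?S (\<lambda>z. VB (snd (snd (fst z)) = snd (snd z)))"
    by (rule ptime_eq_inj[OF ptime_snd[OF p] ptime_snd[OF q] inj_Num])
qed

lemma ptime_assignments:
  assumes "ptime S (\<lambda>e. VC (c e))"
  shows "ptime S (\<lambda>e. VL (VL VQ) (assignments (c e)))"
  unfolding assignments_def
proof (rule ptime_filter, rule ptime_map[OF ptime_snd[OF assms]])
  show "ptime (lift S (VL Num)) (\<lambda>z. VL VQ (zip (fst (c (fst z))) (snd z)))"
    by (rule ptime_zip[OF ptime_lift[OF ptime_fst[OF assms]] ptime_new])
  show "ptime (lift S (VL VQ)) (\<lambda>z. VB (consistent (snd z)))"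
    by (rule ptime_consistent[OF ptime_new])
qed

lemma ptime_live_tuple:
  assumes "ptime S (\<lambda>e. VL VQ (L e))" "ptime S (\<lambda>e. VL VQ (t e))"
  shows "ptime S (\<lambda>e. VB (live_tuple (L e) (t e)))"
  unfolding live_tuple_def
  by (rule ptime_ball[OF assms(2)], rule ptime_mem[OF ptime_lift[OF assms(1)] ptime_new inj_VQ])

lemma ptime_supported:
  assumes N: "ptime S (\<lambda>e. VL (VL (VL VQ)) (N e))" and L: "ptime S (\<lambda>e. VL VQ (L e))"
    and p: "ptime S (\<lambda>e. VQ (p e))"
  shows "ptime S (\<lambda>e. VB (supported (N e) (L e) (p e)))"
  unfolding supported_def
proof (rule ptime_ball[OF N], rule ptime_imp)
  let ?S = "lift S (VL (VL VQ))"
  have C: "ptime ?S (\<lambda>z. VL (VL VQ) (snd z))" by (rule ptime_new)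
  show "ptime ?S (\<lambda>z. VB (\<exists>t\<in>set (snd z). \<exists>q\<in>set t. fst q = fst (p (fst z))))"
  proof (rule ptime_bex[OF C], rule ptime_bex[OF ptime_new])
    show "ptime (lift (lift ?S (VL VQ)) VQ) (\<lambda>y. VB (fst (snd y) = fst (p (fst (fst (fst y))))))"
      by (rule ptime_eq_inj[OF ptime_fst[OF ptime_new]
          ptime_lift[OF ptime_lift[OF ptime_lift[OF ptime_fst[OF p]]]] inj_Num])
  qed
  show "ptime ?S (\<lambda>z. VB (\<exists>t\<in>set (snd z). p (fst z) \<in> set t \<and> live_tuple (L (fst z)) t))"
  proof (rule ptime_bex[OF C], rule ptime_conj)
    let ?S' = "lift ?S (VL VQ)"
    have t: "ptime ?S' (\<lambda>y. VL VQ (snd y))" by (rule ptime_new)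
    show "ptime ?S' (\<lambda>y. VB (p (fst (fst y)) \<in> set (snd y)))"
      by (rule ptime_mem[OF t ptime_lift[OF ptime_lift[OF p]] inj_VQ])
    show "ptime ?S' (\<lambda>y. VB (live_tuple (L (fst (fst y))) (snd y)))"
      by (rule ptime_live_tuple[OF ptime_lift[OF ptime_lift[OF L]] t])
  qed
qed

lemma ptime_prune:
  assumes N: "ptime S (\<lambda>e. VL (VL (VL VQ)) (N e))" and L: "ptime S (\<lambda>e. VL VQ (L e))"
  shows "ptime S (\<lambda>e. VL VQ (prune (N e) (L e)))"
  unfolding prune_def
  by (rule ptime_filter[OF L], rule ptime_supported[OF ptime_lift[OF N] ptime_lift[OF L] ptime_new])

lemma ptime_all_pairs:
  assumes "ptime S (\<lambda>e. VL Num (vs e))"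
  shows "ptime S (\<lambda>e. VL VQ (all_pairs (vs e) ds))"
proof -
  have "ptime (lift S Num) (\<lambda>z. VL VQ (map (\<lambda>d. (snd z, d)) ds))"
    by (rule ptime_map[OF ptime_const], rule ptime_pair[OF ptime_new_lift ptime_new])
  then have "ptime S (\<lambda>e. Lst (concat (map (\<lambda>v. map VQ (map (\<lambda>d. (v, d)) ds)) (vs e))))"
    using assms by (intro ptime_concat_map[where ex = Num]) (simp_all add: VL_def)
  then show ?thesis by (simp add: VL_def all_pairs_def map_concat comp_def)
qed

lemma length_filter_enc: "length (enc (VL ex (filter P xs))) \<le> length (enc (VL ex xs))"
  by (induction xs) (auto simp: VL_def)

text \<open>Pruning only removes pairs, so the accumulator never grows and 0 is a growth
  bound.\<close>

lemma ptime_arc_closure: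
  assumes vs: "ptime S (\<lambda>e. VL Num (vs e))" and cs: "ptime S (\<lambda>e. VL VC (cs e))"
  shows "ptime S (\<lambda>e. VL VQ (arc_closure (vs e) ds (cs e)))"
proof -
  have "ptime S (\<lambda>e. VL VQ (fold (\<lambda>x a. (\<lambda>e a x. prune (map assignments (cs e)) a) e a x)
      (all_pairs (vs e) ds) (all_pairs (vs e) ds)))"
  proof (rule ptime_fold[where ex = VQ and h = "\<lambda>_. 0"])
    show "ptime S (\<lambda>e. Lst (map VQ (all_pairs (vs e) ds)))"
      using ptime_all_pairs[OF vs, of ds] by (simp add: VL_def)
    show "ptime S (\<lambda>e. VL VQ (all_pairs (vs e) ds))" by (rule ptime_all_pairs[OF vs])
    let ?S = "lift (lift S (VL VQ)) VQ"
    have "ptime ?S (\<lambda>y. VL (VL (VL VQ)) (map assignments (cs (fst (fst y)))))"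
      by (rule ptime_map[OF ptime_lift[OF ptime_lift[OF cs]]], rule ptime_assignments[OF ptime_new])
    then show "ptime ?S (\<lambda>y. VL VQ (prune (map assignments (cs (fst (fst y)))) (snd (fst y))))"
      by (rule ptime_prune[OF _ ptime_new_lift])
  qed (auto simp: prune_def length_filter_enc bounded_const)
  then show ?thesis by (simp add: arc_closure_def)
qed

lemma ptime_feasible:
  assumes vs: "ptime S (\<lambda>e. VL Num (vs e))" and cs: "ptime S (\<lambda>e. VL VC (cs e))"
    and L: "ptime S (\<lambda>e. VL VQ (L e))"
  shows "ptime S (\<lambda>e. VB (feasible (vs e) ds (cs e) (L e)))"
  unfolding feasible_def
proof (rule ptime_conj)
  show "ptime S (\<lambda>e. VB (\<forall>v\<in>set (vs e). \<exists>d\<in>set ds. (v, d) \<in> set (L e)))"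
    by (rule ptime_ball[OF vs], rule ptime_bex[OF ptime_const],
        rule ptime_mem[OF ptime_lift[OF ptime_lift[OF L]] ptime_pair[OF ptime_new_lift ptime_new] inj_VQ])
  have "ptime S (\<lambda>e. VL (VL (VL VQ)) (map assignments (cs e)))"
    by (rule ptime_map[OF cs], rule ptime_assignments[OF ptime_new])
  then show "ptime S (\<lambda>e. VB (\<forall>C\<in>set (map assignments (cs e)). \<exists>t\<in>set C. live_tuple (L e) t))"
    by (rule ptime_ball, intro ptime_bex[OF ptime_new]
        ptime_live_tuple[OF ptime_lift[OF ptime_lift[OF L]] ptime_new])
qed

lemma ptime_best:
  assumes L: "ptime S (\<lambda>e. VL VQ (L e))" and v: "ptime S (\<lambda>e. Num (v e))"
  shows "ptime S (\<lambda>e. Num (best ds (L e) (v e)))"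
  unfolding best_def
  by (rule ptime_hd_typed, rule ptime_filter[OF ptime_const],
      rule ptime_mem[OF ptime_lift[OF L] ptime_pair[where ea = Num and eb = Num, OF ptime_lift[OF v] ptime_new] inj_VQ])

text \<open>Flat, as in \<open>enc_fun_on\<close>: the graph of a function is coded without brackets
  around its pairs.\<close>

definition best_assignment :: "nat list \<Rightarrow> nat list \<Rightarrow> (nat \<times> nat) list \<Rightarrow> val" where
  "best_assignment vs ds L = Lst (concat (map (\<lambda>v. [Num v, Num (best ds L v)]) vs))"

lemma ptime_best_assignment:
  assumes vs: "ptime S (\<lambda>e. VL Num (vs e))" and L: "ptime S (\<lambda>e. VL VQ (L e))"
  shows "ptime S (\<lambda>e. best_assignment (vs e) ds (L e))"
  unfolding best_assignment_def
proof (rule ptime_concat_map[OF vs[unfolded VL_def]])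
  have "ptime (lift S Num) (\<lambda>z. Lst (([] @ [Num (snd z)]) @ [Num (best ds (L (fst z)) (snd z))]))"
    by (intro ptime_snoc ptime_const ptime_new ptime_best[OF ptime_lift[OF L]])
  then show "ptime (lift S Num) (\<lambda>z. Lst [Num (snd z), Num (best ds (L (fst z)) (snd z))])"
    by simp
qed

text \<open>\<open>Num 0\<close> reports infeasibility. It differs from every list and is turned
  into the empty word in \<open>ptime_to_tm\<close>.\<close>

definition solve :: "nat list \<Rightarrow> nat list \<Rightarrow> (nat list \<times> nat list list) list \<Rightarrow> val" where
  "solve ds vs cs = (if feasible vs ds cs (arc_closure vs ds cs)
     then best_assignment vs ds (arc_closure vs ds cs) else Num 0)"

lemma ptime_solve:
  assumes vs: "ptime S (\<lambda>e. VL Num (vs e))" and cs: "ptime S (\<lambda>e. VL VC (cs e))"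
  shows "ptime S (\<lambda>e. solve ds (vs e) (cs e))"
proof -
  note L = ptime_arc_closure[OF vs cs, of ds]
  show ?thesis unfolding solve_def
    by (rule ptime_if[OF ptime_feasible[OF vs cs L] ptime_best_assignment[OF vs L] ptime_const])
qed

text \<open>The environment of the whole problem: variables, listed domain, constraints, weights.\<close>

definition instance_val :: "nat list \<times> val \<times> (nat list \<times> nat list list) list \<times> val \<Rightarrow> val" where
  "instance_val e = Lst [VL Num (fst e), fst (snd e),
     Lst (concat (map (\<lambda>c. [VL Num (fst c), VL (VL Num) (snd c)]) (fst (snd (snd e))))),
     snd (snd (snd e))]"

lemma ptime_solve_instance:
  "ptime [instance_val] (\<lambda>e. solve ds (fst e) (fst (snd (snd e))))"
proof (rule ptime_solve)
  let ?cs = "\<lambda>e. Lst (concat (map (\<lambda>c. [VL Num (fst c), VL (VL Num) (snd c)]) (fst (snd (snd e)))))"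
  have I: "ptime [instance_val] (\<lambda>e. Lst [VL Num (fst e), fst (snd e), ?cs e, snd (snd (snd e))])"
    by (rule ptime_var) (simp add: instance_val_def[abs_def])
  show "ptime [instance_val] (\<lambda>e. VL Num (fst e))"
    using ptime_hd[OF I] by (simp add: hd_val_def)
  have "ptime [instance_val] ?cs"
    using ptime_hd[OF ptime_tl[OF ptime_tl[OF I]]] by (simp add: hd_val_def)
  then show "ptime [instance_val] (\<lambda>e. VL VC (fst (snd (snd e))))"
    by (rule ptime_pairing)
qed

section \<open>From functions on values to Turing machines on words\<close>

lemma ptime_to_tm:
  assumes "ptime [inp] F" and F: "\<And>e. F e = Num 0 \<or> (\<exists>vs. F e = Lst vs)"
  shows "\<exists>M p. wf_tm M \<and> (\<forall>e x. enc (inp e) = 4 # x @ [5] \<longrightarrow>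
    tm_outputs_within M x (poly p (length x)) (if F e = Num 0 then [] else enc (F e)))"
proof -
  have loc: "located [inp] (\<lambda>_. 0) 1" by (simp add: located_def)
  obtain c T where c: "prog c" "polyb T"
    "\<And>e s s'. loaded [inp] (\<lambda>_. 0) 1 e s \<Longrightarrow> s' = s(1 := enc (F e)) \<Longrightarrow> runs c s s' (T (csize [inp] e))"
    using ptimeE[OF assms(1) loc] by metis
  obtain TF where TF: "polyb TF" "\<And>e. length (enc (F e)) \<le> TF (csize [inp] e)"
    using ptime_bounded[OF assms(1)] unfolding bounded_by_ctxt_def by blast
  obtain K0 where K0: "wf_com K0 c" using c(1) by (auto simp: prog_def)
  \<comment> \<open>Stack \<open>k\<close> is untouched by \<open>c\<close> and differs from 0, 1
    and 2; with \<open>Suc k\<close> tapes it is the output tape.\<close>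
  define k where "k = max K0 3"
  \<comment> \<open>An instance word is the code of a list without its outer brackets. They are
    added here; the 5 has to go underneath, so the word is lifted off and put back.\<close>
  let ?pre = "Seq (xfer 0 1) (Seq (pushw 0 [5]) (Seq (xfer 1 0) (pushw 0 [4])))"
  \<comment> \<open>Among the possible results only \<open>Num 0\<close> has a code starting with 3,
    and popping that symbol leaves the empty word. Two transfers preserve the order of the
    symbols.\<close>
  let ?post = "Seq (Cond (\<lambda>h. h 1 = 3) (Pop 1) nop) (Seq (xfer 1 2) (xfer 2 k))"
  let ?c = "Seq ?pre (Seq c ?post)"
  have "wf_com (Suc k) c" using K0 by (rule wf_com_mono) (simp add: k_def)
  moreover have k: "k \<ge> 3" by (simp add: k_def)
  ultimately have wf: "wf_com (Suc k) ?c" by (simp add: xfer_def nop_def)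
  \<comment> \<open>The context is two symbols longer than the input, because of the added
    brackets.\<close>
  define U where "U = (\<lambda>m. T (m + 2) + 10 * TF (m + 2) + 10 * m + 40)"
  have "polyb U" unfolding U_def
    by (intro polyb_add polyb_mult polyb_const polyb_id polyb_comp[OF c(2)] polyb_comp[OF TF(1)])
  then obtain p where p: "\<And>m. U m = poly p m" unfolding polyb_def by blast
  obtain M where M: "wf_tm M" "\<And>x t n s'. 0 \<notin> set x \<Longrightarrow> exec ?c ((\<lambda>_. [])(0 := x)) t s' \<Longrightarrow> t \<le> n \<Longrightarrow>
    tm_outputs_within M x n (s' k)"
    using com_to_tm[OF wf] by auto
  have "tm_outputs_within M x (poly p (length x)) (if F e = Num 0 then [] else enc (F e))"
    if x: "enc (inp e) = 4 # x @ [5]" for e x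
  proof -
    let ?z = "\<lambda>_ :: nat. [] :: nat list" and ?y = "enc (F e)"
    let ?y' = "if F e = Num 0 then [] else enc (F e)"
    have sx: "set x \<subseteq> {1..5}" using enc_symbols[of "inp e"] x by auto
    have sy: "set ?y \<subseteq> {1..5}" by (rule enc_symbols)
    have size: "csize [inp] e = length x + 2" using x by (simp add: csize_def)
    have a1: "runs (xfer 0 1) (?z(0 := x)) (?z(1 := rev x)) (5 * length x + 1)"
      using runs_xfer[of 0 1 "?z(0 := x)" "?z(1 := rev x)"] sx by (simp add: fun_eq_iff)
    have a2: "runs (pushw 0 [5]) (?z(1 := rev x)) (?z(0 := [5], 1 := rev x)) (3 * length [5::nat] + 1)"
      by (intro runs_pushw) (simp_all add: fun_eq_iff)
    have a3: "runs (xfer 1 0) (?z(0 := [5], 1 := rev x)) (?z(0 := x @ [5])) (5 * length x + 1)"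
      using runs_xfer[of 1 0 "?z(0 := [5], 1 := rev x)" "?z(0 := x @ [5])"] sx by (simp add: fun_eq_iff)
    have a4: "runs (pushw 0 [4]) (?z(0 := x @ [5])) (?z(0 := enc (inp e))) (3 * length [4::nat] + 1)"
      by (intro runs_pushw) (simp_all add: fun_eq_iff x)
    have b: "runs c (?z(0 := enc (inp e))) (?z(0 := enc (inp e), 1 := ?y)) (T (length x + 2))"
      using c(3)[of e "?z(0 := enc (inp e))", OF _ refl] by (simp add: loaded_def size)
    have d: "runs (Cond (\<lambda>h. h 1 = 3) (Pop 1) nop) (?z(0 := enc (inp e), 1 := ?y))
        (?z(0 := enc (inp e), 1 := ?y')) (Suc 1)"
    proof (cases "F e = Num 0")
      case True
      then have y: "?y = [3]" by (simp add: enc_nat_def binary.simps)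
      then show ?thesis using True
        by (intro runs_CondT runs_Pop) (simp_all only: y, simp_all add: fun_eq_iff)
    next
      case False
      then obtain vs where vs: "F e = Lst vs" using F by blast
      then show ?thesis using runs_nop by (intro runs_CondF) simp_all
    qed
    have sy': "set ?y' \<subseteq> {1..5}" using sy by simp
    have f1: "runs (xfer 1 2) (?z(0 := enc (inp e), 1 := ?y')) (?z(0 := enc (inp e), 2 := rev ?y'))
        (5 * length ?y' + 1)"
      using runs_xfer[of 1 2 "?z(0 := enc (inp e), 1 := ?y')" "?z(0 := enc (inp e), 2 := rev ?y')"] sy'
      by (simp add: fun_eq_iff)
    have f2: "runs (xfer 2 k) (?z(0 := enc (inp e), 2 := rev ?y')) (?z(0 := enc (inp e), k := ?y'))
        (5 * length ?y' + 1)"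
      using runs_xfer[of 2 k "?z(0 := enc (inp e), 2 := rev ?y')" "?z(0 := enc (inp e), k := ?y')"] sy' k
      by (simp add: fun_eq_iff)
    note r = runs_Seq[OF runs_Seq[OF a1 runs_Seq[OF a2 runs_Seq[OF a3 a4]]]
      runs_Seq[OF b runs_Seq[OF d runs_Seq[OF f1 f2]]]]
    have "length ?y' \<le> TF (length x + 2)" using TF(2)[of e] size by simp
    then have "runs ?c (?z(0 := x)) (?z(0 := enc (inp e), k := ?y')) (U (length x))"
      by (intro runs_mono[OF r]) (simp add: U_def)
    then obtain t where "t \<le> U (length x)" "exec ?c (?z(0 := x)) t (?z(0 := enc (inp e), k := ?y'))"
      unfolding runs_def by blast
    moreover have "0 \<notin> set x" using sx by auto
    ultimately show ?thesis using M(2)[of x t "?z(0 := enc (inp e), k := ?y')" "U (length x)"]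
      by (simp add: p)
  qed
  then show ?thesis using M(1) by blast
qed

lemma enc_list_Num: "enc_list enc_nat xs = enc (VL Num xs)"
  by (simp add: enc_list_def VL_def comp_def)

lemma enc_list_VL: "enc_list (enc_list enc_nat) xs = enc (VL (VL Num) xs)"
  by (simp add: enc_list_def[abs_def] VL_def comp_def)

lemma enc_list_pairs:
  "enc_list (\<lambda>a. enc_nat a @ enc_nat (g a)) xs = enc (Lst (concat (map (\<lambda>a. [Num a, Num (g a)]) xs)))"
  by (induction xs) (simp_all add: enc_list_def)

lemma enc_list_cnstrs:
  "enc_list enc_cnstr cs = enc (Lst (concat (map (\<lambda>c. [VL Num (fst c), VL (VL Num) (snd c)]) cs)))"
proof -
  have "concat (map enc_cnstr cs) =
      concat (map enc (concat (map (\<lambda>c. [VL Num (fst c), VL (VL Num) (snd c)]) cs)))"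
    by (induction cs) (simp_all add: enc_cnstr_def enc_list_Num enc_list_VL del: enc.simps)
  then show ?thesis by (simp add: enc_list_def)
qed

theorem theorem5p10:
  fixes D :: "nat set" and \<Gamma> :: "nat list set set"
  assumes "finite D"
    and "constraint_language D \<Gamma>"
    and "generalised_max_closed D \<Gamma>"
  shows "w_max_sol D \<Gamma> \<in> PO"
proof -
  obtain f where pol: "polymorphism D \<Gamma> f"
    and gmax: "\<And>a b. a \<in> D \<Longrightarrow> b \<in> D \<Longrightarrow> a \<noteq> b \<Longrightarrow> f a b \<le> min a b \<Longrightarrow> f b a > max a b"
    and idem: "\<And>a. a \<in> D \<Longrightarrow> f a a \<ge> a"
    using assms(3) unfolding generalised_max_closed_def by blast
  \<comment> \<open>An instance may list its domain in any order. As \<open>D\<close> belongs to the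
    problem, the machine carries its own decreasing list.\<close>
  define ds where "ds = rev (sorted_list_of_set D)"
  have ds: "set ds = D" "sorted_wrt (\<ge>) ds"
    using assms(1) by (auto simp: ds_def sorted_wrt_rev)
  let ?F = "\<lambda>e. solve ds (fst e) (fst (snd (snd e)))"
  obtain M p where M: "wf_tm M" "\<And>e x. enc (instance_val e) = 4 # x @ [5] \<Longrightarrow>
      tm_outputs_within M x (poly p (length x)) (if ?F e = Num 0 then [] else enc (?F e))"
  proof -
    have "?F e = Num 0 \<or> (\<exists>vs. ?F e = Lst vs)" for e
      by (simp add: solve_def best_assignment_def)
    from ptime_to_tm[OF ptime_solve_instance this] show thesis using that by blast
  qed
  let ?P = "w_max_sol D \<Gamma>"
  have "\<exists>y. tm_outputs_within M x (poly p (length x)) y \<and>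
      (if solutions ?P I = {} then y = [] else \<exists>s. optimal ?P I s \<and> y \<in> enc_sol ?P I s)"
    if I: "I \<in> instances ?P" and x: "x \<in> enc_inst ?P I" for I x
  proof -
    have I: "finite (vars I)" "dom_of I = D"
      "\<And>s R. (s, R) \<in> cnstrs I \<Longrightarrow> set s \<subseteq> vars I \<and> R \<in> \<Gamma> \<and> relation_over D (length s) R"
      using I by (auto simp: w_max_sol_def wms_instances_def)
    obtain vs ds' cs ks ws where
      xeq: "x = enc_list enc_nat vs @ enc_list enc_nat ds' @ enc_list enc_cnstr cs @ ws"
      and vs: "distinct vs" "set vs = vars I" and ks: "set ks = cnstrs I" "list_all2 lists_relation cs ks"
      and ws: "ws \<in> enc_fun_on (vars I) (weight I)"
      using x by (auto simp: w_max_sol_def wms_enc_inst_def)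
    obtain as where "ws = enc_list (\<lambda>a. enc_nat a @ enc_nat (weight I a)) as"
      using ws by (auto simp: enc_fun_on_def)
    then obtain w where w: "ws = enc w" by (simp only: enc_list_pairs) 
    let ?e = "(vs, VL Num ds', cs, w)"
    have "enc (instance_val ?e) = 4 # x @ [5]"
      by (simp add: instance_val_def xeq w enc_list_Num enc_list_cnstrs)
    note out = M(2)[OF this]
    have cs_ks: "\<exists>k. k \<in> cnstrs I \<and> fst k = fst c \<and> snd k = set (snd c)" if c: "c \<in> set cs" for c
    proof -
      obtain i where i: "i < length cs" "cs ! i = c" using c by (auto simp: in_set_conv_nth)
      then have "lists_relation c (ks ! i)" "ks ! i \<in> set ks"
        using ks(2) by (auto simp: list_all2_conv_all_nth)
      then show ?thesis using ks(1) by (auto simp: lists_relation_def)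
    qed
    have ks_cs: "\<exists>c. c \<in> set cs \<and> fst k = fst c \<and> snd k = set (snd c)" if k: "k \<in> cnstrs I" for k
    proof -
      obtain i where i: "i < length ks" "ks ! i = k" using k ks(1) by (metis in_set_conv_nth)
      then have "lists_relation (cs ! i) k" "cs ! i \<in> set cs"
        using ks(2) by (auto simp: list_all2_conv_all_nth)
      then show ?thesis by (intro exI[of _ "cs ! i"]) (simp add: lists_relation_def)
    qed
    have cnstr: "(s, set R) \<in> cnstrs I" if "(s, R) \<in> set cs" for s R
      using cs_ks[OF that] by (metis fst_conv snd_conv prod.collapse)
    interpret gmax_instance D f ds vs cs
    proof
      show "f a b \<in> D" if "a \<in> D" "b \<in> D" for a b
        using pol that by (auto simp: polymorphism_def)
      show "set s \<subseteq> set vs" if "(s, R) \<in> set cs" for s R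
        using I(3)[OF cnstr[OF that]] vs by simp
      show "length r = length s \<and> set r \<subseteq> D" if "(s, R) \<in> set cs" "r \<in> set R" for s R r
        using I(3)[OF cnstr[OF that(1)]] that(2) by (auto simp: relation_over_def)
      show "map2 f r r' \<in> set R" if "(s, R) \<in> set cs" "r \<in> set R" "r' \<in> set R" for s R r r'
        using I(3)[OF cnstr[OF that(1)]] that(2,3) pol by (auto simp: polymorphism_def)
    qed (use ds gmax idem in auto)
    have sol1: "solution g" if g: "g \<in> wms_solutions I" for g
    proof -
      have "map g s \<in> set R" if "(s, R) \<in> set cs" for s R
        using g cnstr[OF that] by (auto simp: wms_solutions_def)
      moreover have "g v \<in> D" if "v \<in> set vs" for v
        using g that vs I(2) by (auto simp: wms_solutions_def)
      ultimately show ?thesis by (auto simp: solution_def)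
    qed
    \<comment> \<open>Solutions of the instance are extensional, whereas \<open>solution\<close>
      says nothing outside the variables; restricting does not change any value on a scope.\<close>
    have sol2: "restrict g (vars I) \<in> wms_solutions I" if g: "solution g" for g
    proof -
      have "map (restrict g (vars I)) s \<in> R" if k: "(s, R) \<in> cnstrs I" for s R
      proof -
        obtain R' where "(s, R') \<in> set cs" "R = set R'" using ks_cs[OF k] by auto
        then have "map g s \<in> R" using g by (auto simp: solution_def)
        moreover have "map (restrict g (vars I)) s = map g s" using I(3)[OF k] by auto
        ultimately show ?thesis by (simp only:)
      qed
      then have "\<forall>(s, R)\<in>cnstrs I. map (restrict g (vars I)) s \<in> R" by blast
      moreover have "restrict g (vars I) \<in> vars I \<rightarrow>\<^sub>E dom_of I"
        using g vs(2) I(2) by (simp add: solution_def)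
      ultimately show ?thesis by (simp add: wms_solutions_def)
    qed
    show ?thesis
    proof (cases "feasible vs ds cs L")
      case False
      then have "wms_solutions I = {}" using sol1 solution_feasible by blast
      then show ?thesis using out False by (auto simp: w_max_sol_def solve_def)
    next
      case True
      let ?g = "best ds L"
      let ?s = "restrict ?g (vars I)"
      have s: "?s \<in> wms_solutions I" by (rule sol2[OF best_solution[OF True]])
      \<comment> \<open>Weights are natural numbers, so pointwise domination carries over to the
        weighted sum.\<close>
      have "wms_measure I h \<le> wms_measure I ?s" if "h \<in> wms_solutions I" for h
        using solution_le_best[OF sol1[OF that]] vs
        by (auto simp: wms_measure_def intro!: sum_mono)
      then have opt: "optimal ?P I ?s" using s by (auto simp: optimal_def w_max_sol_def)
      \<comment> \<open>On the variables the restriction agrees with \<open>best\<close>, so the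
        output is a code of the restriction, with the variables in the order of the input.\<close>
      have "map (\<lambda>v. [Num v, Num (?g v)]) vs = map (\<lambda>v. [Num v, Num (?s v)]) vs"
        using vs by simp
      then have "enc (best_assignment vs ds L) = enc_list (\<lambda>a. enc_nat a @ enc_nat (?s a)) vs"
        unfolding enc_list_pairs best_assignment_def by (simp only:)
      then have "enc (best_assignment vs ds L) \<in> enc_sol ?P I ?s"
        using vs by (auto simp: w_max_sol_def enc_fun_on_def)
      then show ?thesis using out True s opt
        by (auto simp: w_max_sol_def solve_def best_assignment_def)
    qed
  qed
  then show ?thesis using M(1) unfolding PO_def by blast
qed

end
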